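(* Let $\alpha>0$, $0<S<T<\infty$, let $(X^{(\alpha)}_t)_{t\in[0,T]}$ be the $\alpha$-Wiener bridge on $[0,T]$, and put $\tau_T^{(\alpha)}(t):=\int_0^t (T-s)^{-2\alpha}\,ds$, $t\in[0,T)$. In the weighted Karhunen--Loève expansion $$X_t^{(\alpha)}=\sum_{k=1}^\infty\sqrt{\kappa^{(\alpha)}_k}\,\xi_k\,f^{(\alpha)}_k(t),\qquad t\in[0,S],$$ of the $\alpha$-Wiener bridge based on $[0,S]$ with respect to the weight measure $d\mu_T^{(\alpha)}(s)=(T-s)^{-4\alpha}\,ds$, the weighted eigenvalues are $$\kappa^{(\alpha)}_k=\bigg(\frac{\tau_T^{(\alpha)}(S)}{(k-1/2)\pi}\bigg)^2,\qquad k\in\mathbb{N},$$ and the corresponding weighted normed eigenfunctions are $$f^{(\alpha)}_k(t)=\sqrt{\frac{2}{\tau_T^{(\alpha)}(S)}}\,(T-t)^\alpha\sin\!\left(\Big(k-\frac12\Big)\pi\,\frac{\tau_T^{(\alpha)}(t)}{\tau_T^{(\alpha)}(S)}\right),\qquad t\in[0,S],\ k\in\mathbb{N}.$$ Hence $$X^{(\alpha)}_t=\sum_{k=1}^\infty\sqrt{2\tau_T^{(\alpha)}(S)}\,(T-t)^\alpha\,\frac{\sin\!\left(\big(k-\frac12\big)\pi\frac{\tau_T^{(\alpha)}(t)}{\tau_T^{(\alpha)}(S)}\right)}{(k-1/2)\pi}\,\xi_k,\qquad t\in[0,S].$$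
   Context: Let $(B_t)_{t\ge 0}$ be a standard Wiener process. For $\alpha>0$ and $T\in(0,\infty)$ the $\alpha$-Wiener bridge on $[0,T]$ is the process $X_t^{(\alpha)}=\int_0^t\big(\frac{T-t}{T-s}\big)^\alpha\,dB_s$, $t\in[0,T)$, i.e. the unique strong solution of $dX_t^{(\alpha)}=-\frac{\alpha}{T-t}X_t^{(\alpha)}\,dt+dB_t$, $X_0^{(\alpha)}=0$, extended by $X_T^{(\alpha)}=0$. It is a centered Gaussian process with covariance function $R^{(\alpha)}(s,t)=(T-s)^\alpha(T-t)^\alpha\,\tau_T^{(\alpha)}(s\wedge t)$, $s,t\in[0,T)$, with $\tau_T^{(\alpha)}$ as in the claim. Weighted Karhunen--Loève expansion based on $[0,S]$ with respect to the measure $\mu_T^{(\alpha)}$ on the Borel sets of $[0,S]$: the $\xi_k$, $k\in\mathbb{N}$, are independent standard normal random variables; the $\kappa_k^{(\alpha)}$ and $f_k^{(\alpha)}$ are the non-zero eigenvalues and corresponding eigenfunctions of the covariance kernel with respect to $\mu_T^{(\alpha)}$, i.e. $\int_0^S R^{(\alpha)}(t,s)f^{(\alpha)}_k(s)\,d\mu_T^{(\alpha)}(s)=\kappa^{(\alpha)}_kf^{(\alpha)}_k(t)$, $t\in[0,S]$, with the $f_k^{(\alpha)}$ orthonormal in $L^2([0,S],\mu_T^{(\alpha)})$; and the series converges to $X_t^{(\alpha)}$ in $L^2(\Omega,\mathcal{A},\mathsf{P})$ uniformly in $t\in[0,S]$. (Equivalently, $f_k^{(\alpha)}(t)=(T-t)^\alpha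 d_k^{(\alpha)}(\tau_T^{(\alpha)}(t))$, where $(\kappa_k^{(\alpha)},d_k^{(\alpha)})$ are the eigenvalue--normed eigenfunction pairs in the usual Karhunen--Loève expansion of a standard Wiener process on $[0,\tau_T^{(\alpha)}(S)]$.) Normed eigenfunctions are understood up to sign. *)

theory Defs
  imports "HOL-Probability.Probability"
begin

section \<open>Standard Wiener process\<close>

text \<open>Only the restriction of \<open>B\<close> to the time set \<open>{0..}\<close> matters.\<close>

locale wiener_process = prob_space M for M :: "'a measure" +
  fixes B :: "real \<Rightarrow> 'a \<Rightarrow> real"
  assumes wiener_measurable: "\<And>t. 0 \<le> t \<Longrightarrow> B t \<in> borel_measurable M"
    and wiener_start: "AE \<omega> in M. B 0 \<omega> = 0"
    and wiener_increment_normal: "\<And>s t. 0 \<le> s \<Longrightarrow> s < t \<Longrightarrow>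
      distributed M lborel (\<lambda>\<omega>. B t \<omega> - B s \<omega>) (normal_density 0 (sqrt (t - s)))"
    and wiener_increments_indep: "\<And>(n::nat) p. 0 \<le> p 0 \<Longrightarrow> strict_mono_on {..n} p \<Longrightarrow>
      indep_vars (\<lambda>_. borel) (\<lambda>i \<omega>. B (p (Suc i)) \<omega> - B (p i) \<omega>) {..<n}"
    and wiener_continuous: "AE \<omega> in M. continuous_on {0..} (\<lambda>t. B t \<omega>)"

section \<open>Stochastic integral of a deterministic integrand\<close>

text \<open>
  The step function taking the value \<open>c i\<close> on \<open>[p i, p (i + 1))\<close> for \<open>i < n\<close>, and its integral
  with respect to \<open>B\<close>.
\<close>

definition step_function :: "nat \<Rightarrow> (nat \<Rightarrow> real) \<Rightarrow> (nat \<Rightarrow> real) \<Rightarrow> real \<Rightarrow> real" where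
  "step_function n p c s = (\<Sum>i<n. c i * indicator {p i..<p (Suc i)} s)"

definition step_integral ::
    "(real \<Rightarrow> 'a \<Rightarrow> real) \<Rightarrow> nat \<Rightarrow> (nat \<Rightarrow> real) \<Rightarrow> (nat \<Rightarrow> real) \<Rightarrow> 'a \<Rightarrow> real" where
  "step_integral B n p c \<omega> = (\<Sum>i<n. c i * (B (p (Suc i)) \<omega> - B (p i) \<omega>))"

text \<open>
  \<open>I\<close> is (a version of) the integral of \<open>g\<close> over \<open>[a, b]\<close> with respect to \<open>B\<close>: it is the limit in
  \<open>L\<^sup>2(M)\<close> of the integrals of step functions approximating \<open>g\<close> in \<open>L\<^sup>2([a, b])\<close>. By the Ito
  isometry the limit does not depend, up to null sets, on the approximating sequence.
\<close>

definition has_wiener_integral ::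
    "'a measure \<Rightarrow> (real \<Rightarrow> 'a \<Rightarrow> real) \<Rightarrow> (real \<Rightarrow> real) \<Rightarrow> real \<Rightarrow> real \<Rightarrow> ('a \<Rightarrow> real) \<Rightarrow> bool" where
  "has_wiener_integral M B g a b I \<longleftrightarrow>
     set_borel_measurable lborel {a..b} g \<and>
     set_integrable lborel {a..b} (\<lambda>s. (g s)\<^sup>2) \<and>
     I \<in> borel_measurable M \<and> integrable M (\<lambda>\<omega>. (I \<omega>)\<^sup>2) \<and>
     (\<exists>N p c.
        (\<forall>j. a \<le> p j 0 \<and> mono_on {..N j} (p j) \<and> p j (N j) \<le> b) \<and>
        (\<lambda>j. LBINT s:{a..b}. (g s - step_function (N j) (p j) (c j) s)\<^sup>2) \<longlonglongrightarrow> 0 \<and>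
        (\<lambda>j. \<integral>\<omega>. (I \<omega> - step_integral B (N j) (p j) (c j) \<omega>)\<^sup>2 \<partial>M) \<longlonglongrightarrow> 0)"

section \<open>The Wiener bridge with parameter alpha\<close>

text \<open>
  Each \<open>X t\<close> with \<open>t < T\<close> is the stochastic integral of the deterministic kernel; path continuity
  on \<open>[0, T)\<close> singles out the solution process of the SDE up to indistinguishability.
\<close>

definition alpha_wiener_bridge ::
    "'a measure \<Rightarrow> (real \<Rightarrow> 'a \<Rightarrow> real) \<Rightarrow> real \<Rightarrow> real \<Rightarrow> (real \<Rightarrow> 'a \<Rightarrow> real) \<Rightarrow> bool" where
  "alpha_wiener_bridge M B \<alpha> T X \<longleftrightarrow>
     (\<forall>t\<in>{0..<T}. has_wiener_integral M B (\<lambda>s. ((T - t) / (T - s)) powr \<alpha>) 0 t (X t)) \<and>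
     (AE \<omega> in M. continuous_on {0..<T} (\<lambda>t. X t \<omega>)) \<and>
     (AE \<omega> in M. X T \<omega> = 0)"

definition bridge_tau :: "real \<Rightarrow> real \<Rightarrow> real \<Rightarrow> real" where
  "bridge_tau \<alpha> T t = (LBINT s:{0..t}. (T - s) powr (- 2 * \<alpha>))"

text \<open>The weight measure lives on the Borel sets of \<open>[0, S]\<close>; its space is \<open>{0..S}\<close>.\<close>

definition bridge_weight :: "real \<Rightarrow> real \<Rightarrow> real \<Rightarrow> real measure" where
  "bridge_weight \<alpha> T S =
     density (restrict_space lborel {0..S}) (\<lambda>s. ennreal ((T - s) powr (- 4 * \<alpha>)))"

section \<open>Weighted Karhunen--Loeve expansions\<close>

definition covariance_kernel :: "'a measure \<Rightarrow> (real \<Rightarrow> 'a \<Rightarrow> real) \<Rightarrow> real \<Rightarrow> real \<Rightarrow> real" where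
  "covariance_kernel M X s t =
     (\<integral>\<omega>. (X s \<omega> - (\<integral>\<omega>'. X s \<omega>' \<partial>M)) * (X t \<omega> - (\<integral>\<omega>'. X t \<omega>' \<partial>M)) \<partial>M)"

definition square_integrable :: "'b measure \<Rightarrow> ('b \<Rightarrow> real) \<Rightarrow> bool" where
  "square_integrable N g \<longleftrightarrow> g \<in> borel_measurable N \<and> integrable N (\<lambda>x. (g x)\<^sup>2)"

text \<open>
  The eigenvalue equation is required at every point of the space of \<open>\<nu>\<close>, not just almost
  everywhere.
\<close>

definition weighted_eigenpair ::
    "(real \<Rightarrow> real \<Rightarrow> real) \<Rightarrow> real measure \<Rightarrow> real \<Rightarrow> (real \<Rightarrow> real) \<Rightarrow> bool" where
  "weighted_eigenpair R \<nu> l g \<longleftrightarrow>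
     square_integrable \<nu> g \<and> \<not> (AE s in \<nu>. g s = 0) \<and>
     (\<forall>t\<in>space \<nu>. integrable \<nu> (\<lambda>s. R t s * g s) \<and> (\<integral>s. R t s * g s \<partial>\<nu>) = l * g t)"

definition L2_uniformly_tendsto ::
    "'a measure \<Rightarrow> real set \<Rightarrow> (nat \<Rightarrow> real \<Rightarrow> 'a \<Rightarrow> real) \<Rightarrow> (real \<Rightarrow> 'a \<Rightarrow> real) \<Rightarrow> bool" where
  "L2_uniformly_tendsto M A Y X \<longleftrightarrow>
     (\<forall>t\<in>A. square_integrable M (X t) \<and> (\<forall>n. square_integrable M (Y n t))) \<and>
     uniform_limit A (\<lambda>n t. \<integral>\<omega>. (X t \<omega> - Y n t \<omega>)\<^sup>2 \<partial>M) (\<lambda>_. 0) sequentially"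

text \<open>
  Indices run over \<open>k \<ge> 1\<close>. The third condition says that the \<open>\<kappa> k\<close> are all the
  non-zero eigenvalues, each listed with its multiplicity: every eigenspace belonging to a
  non-zero eigenvalue \<open>l\<close> is spanned by the \<open>f k\<close> with \<open>\<kappa> k = l\<close>. The order of the
  enumeration is left open.
\<close>

definition weighted_KL_expansion ::
    "'a measure \<Rightarrow> (real \<Rightarrow> 'a \<Rightarrow> real) \<Rightarrow> real measure \<Rightarrow>
     (nat \<Rightarrow> real) \<Rightarrow> (nat \<Rightarrow> real \<Rightarrow> real) \<Rightarrow> (nat \<Rightarrow> 'a \<Rightarrow> real) \<Rightarrow> bool" where
  "weighted_KL_expansion M X \<nu> \<kappa> f \<xi> \<longleftrightarrow>
     (\<forall>k\<ge>1. \<kappa> k \<noteq> 0 \<and> weighted_eigenpair (covariance_kernel M X) \<nu> (\<kappa> k) (f k)) \<and>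
     (\<forall>i\<ge>1. \<forall>j\<ge>1. (\<integral>s. f i s * f j s \<partial>\<nu>) = (if i = j then 1 else 0)) \<and>
     (\<forall>l g. l \<noteq> 0 \<longrightarrow> weighted_eigenpair (covariance_kernel M X) \<nu> l g \<longrightarrow>
        (\<exists>K c. finite K \<and> K \<subseteq> {k. 1 \<le> k \<and> \<kappa> k = l} \<and>
               (\<forall>t\<in>space \<nu>. g t = (\<Sum>k\<in>K. c k * f k t)))) \<and>
     (\<forall>k\<ge>1. distributed M lborel (\<xi> k) std_normal_density) \<and>
     prob_space.indep_vars M (\<lambda>_. borel) \<xi> {1..} \<and>
     L2_uniformly_tendsto M (space \<nu>) (\<lambda>n t \<omega>. \<Sum>k=1..n. sqrt (\<kappa> k) * \<xi> k \<omega> * f k t) X"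

end

theory Submission
  imports Defs
begin

text \<open>
  Writing \<open>\<tau> = \<tau>_T\<close>, the bridge is \<open>X_t = (T - t)^\<alpha> \<integral>_0^t (T - s)^(-\<alpha>) dB_s\<close>, a Wiener process run with the
  clock \<open>\<tau>\<close>, so its covariance is \<open>(T - s)^\<alpha> (T - t)^\<alpha> \<tau>(s \<and> t)\<close>. The weight \<open>(T - s)^(-4\<alpha>)\<close> is chosen
  so that the substitution \<open>g(t) = (T - t)^\<alpha> d(\<tau> t)\<close> turns the weighted eigenvalue problem into that of
  the Wiener process on \<open>[0, \<tau> S]\<close>, an ODE with explicit solutions. The coefficients are the Wiener
  integrals \<open>\<xi>_k\<close> of the orthonormal functions \<open>sqrt (2 / \<tau> S) cos((k - 1/2) \<pi> \<tau> s / \<tau> S) (T - s)^(-\<alpha>)\<close>; being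
  jointly Gaussian and uncorrelated they are independent. The mean square error of the expansion
  after \<open>n\<close> terms is \<open>(T - t)^(2\<alpha>) \<tau> S\<close> times the remainder of the series
  \<open>x = \<Sum>_k 2 sin((k - 1/2) \<pi> x)^2 / ((k - 1/2) \<pi>)^2\<close>, \<open>0 \<le> x \<le> 1\<close>, at \<open>x = \<tau> t / \<tau> S\<close>.
\<close>

section \<open>Square integrable functions\<close>

text \<open>No spectral theorem or completeness of the eigenfunctions enters. Mean square
  convergence is obtained from an exact error: the cosines are the clock derivatives of the sines in
  the eigenfunctions, so \<open>E (X_t \<xi>_k)\<close> equals the coefficient of \<xi>_k in the
  expansion, and Pythagoras leaves the variance of \<open>X_t\<close> minus the squared
  coefficients. One numerical series thus decides everything. The obstacle there is that the
  termwise derivative of this series is the Fourier series of a square wave, which does not converge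
  uniformly near 0 and 1. Its limit is therefore controlled on compact subintervals of (0, 1) only;
  this fixes the sum up to a constant, and continuity carries the identity to the endpoints. For the
  eigenvalue problem an eigenfunction is at first just square integrable. Since the equation holds
  at every point, the integral on its left side makes the eigenfunction continuous, and only then is
  the ODE available. Its solution spaces are one-dimensional and the eigenvalues distinct, so any
  other expansion can differ only by order and signs.\<close>

lemma integrable_square_integrable_mult:
  assumes "square_integrable N f" "square_integrable N g"
  shows "integrable N (\<lambda>x. f x * g x)"
proof (rule Bochner_Integration.integrable_bound[of N "\<lambda>x. (f x)\<^sup>2 + (g x)\<^sup>2"])
  show "integrable N (\<lambda>x. (f x)\<^sup>2 + (g x)\<^sup>2)"
    using assms by (auto simp: square_integrable_def)
  show "(\<lambda>x. f x * g x) \<in> borel_measurable N"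
    using assms by (auto simp: square_integrable_def)
  have "\<bar>a * b\<bar> \<le> a\<^sup>2 + b\<^sup>2" for a b :: real
  proof -
    have "0 \<le> \<bar>a\<bar> * \<bar>b\<bar>" by simp
    then have "\<bar>a\<bar> * \<bar>b\<bar> \<le> \<bar>a\<bar>\<^sup>2 + \<bar>b\<bar>\<^sup>2"
      using sum_squares_bound[of "\<bar>a\<bar>" "\<bar>b\<bar>"] by linarith
    then show ?thesis by (simp only: abs_mult power2_abs)
  qed
  then show "AE x in N. norm (f x * g x) \<le> norm ((f x)\<^sup>2 + (g x)\<^sup>2)"
    by (intro AE_I2) simp
qed

lemma square_integrable_cmult:
  "square_integrable N f \<Longrightarrow> square_integrable N (\<lambda>x. c * f x)"
  by (auto simp: square_integrable_def power_mult_distrib)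

lemma square_integrable_add:
  assumes "square_integrable N f" "square_integrable N g"
  shows "square_integrable N (\<lambda>x. f x + g x)"
  using assms integrable_square_integrable_mult[OF assms]
  by (auto simp: square_integrable_def power2_sum mult.assoc)

lemma square_integrable_diff:
  assumes "square_integrable N f" "square_integrable N g"
  shows "square_integrable N (\<lambda>x. f x - g x)"
  using square_integrable_add[OF assms(1) square_integrable_cmult[OF assms(2), of "-1"]] by simp

lemma square_integrable_zero: "square_integrable N (\<lambda>_. 0)"
  by (auto simp: square_integrable_def)

lemma square_integrable_sum:
  assumes "\<And>i. i \<in> A \<Longrightarrow> square_integrable N (f i)"
  shows "square_integrable N (\<lambda>x. \<Sum>i\<in>A. f i x)"
  using assms by (induction A rule: infinite_finite_induct)
    (auto intro!: square_integrable_add square_integrable_zero)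

lemma (in finite_measure) square_integrable_bounded:
  assumes "f \<in> borel_measurable M" "\<And>x. x \<in> space M \<Longrightarrow> \<bar>f x\<bar> \<le> C"
  shows "square_integrable M f"
  unfolding square_integrable_def
proof
  show "integrable M (\<lambda>x. (f x)\<^sup>2)"
    by (rule integrable_const_bound[where B = "C\<^sup>2"])
      (use assms in \<open>auto intro!: AE_I2 simp: abs_le_square_iff[symmetric] intro: order_trans[OF _ abs_ge_self]\<close>)
qed fact

lemma (in finite_measure) square_integrable_integrable: "square_integrable M f \<Longrightarrow> integrable M f"
  using integrable_square_integrable_mult[of M f "\<lambda>_. 1"] square_integrable_bounded[of "\<lambda>_. 1" 1]
  by simp

lemma integral_square_diff:
  assumes "square_integrable N f" "square_integrable N g"
  shows "(\<integral>x. (f x - g x)\<^sup>2 \<partial>N) = (\<integral>x. (f x)\<^sup>2 \<partial>N) - 2 * (\<integral>x. f x * g x \<partial>N) + (\<integral>x. (g x)\<^sup>2 \<partial>N)"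
  using assms integrable_square_integrable_mult[OF assms]
  by (simp add: square_integrable_def power2_diff mult.assoc)

lemma integral_square_orthogonal_sum:
  assumes J: "finite J" and sq: "\<And>i. i \<in> J \<Longrightarrow> square_integrable N (h i)"
    and ortho: "\<And>i j. i \<in> J \<Longrightarrow> j \<in> J \<Longrightarrow> i \<noteq> j \<Longrightarrow> (\<integral>s. h i s * h j s \<partial>N) = 0"
  shows "(\<integral>s. (\<Sum>i\<in>J. u i * h i s)\<^sup>2 \<partial>N) = (\<Sum>i\<in>J. (u i)\<^sup>2 * (\<integral>s. (h i s)\<^sup>2 \<partial>N))"
proof -
  have int: "integrable N (\<lambda>s. u i * u j * (h i s * h j s))" if "i \<in> J" "j \<in> J" for i j
    using integrable_square_integrable_mult[OF sq[OF that(1)] sq[OF that(2)]] by simp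
  have "(\<integral>s. (\<Sum>i\<in>J. u i * h i s)\<^sup>2 \<partial>N) = (\<integral>s. (\<Sum>i\<in>J. \<Sum>j\<in>J. u i * u j * (h i s * h j s)) \<partial>N)"
    by (intro Bochner_Integration.integral_cong) (auto simp: power2_eq_square sum_product mult_ac)
  also have "\<dots> = (\<Sum>i\<in>J. \<Sum>j\<in>J. u i * u j * (\<integral>s. h i s * h j s \<partial>N))"
  proof -
    have "(\<integral>s. (\<Sum>j\<in>J. u i * u j * (h i s * h j s)) \<partial>N) = (\<Sum>j\<in>J. u i * u j * (\<integral>s. h i s * h j s \<partial>N))"
      if "i \<in> J" for i
      using int[OF that] by (subst Bochner_Integration.integral_sum) auto
    then show ?thesis
      using int by (subst Bochner_Integration.integral_sum) (auto intro!: Bochner_Integration.integrable_sum)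
  qed
  also have "\<dots> = (\<Sum>i\<in>J. \<Sum>j\<in>J. if j = i then (u i)\<^sup>2 * (\<integral>s. (h i s)\<^sup>2 \<partial>N) else 0)"
  proof (intro sum.cong refl)
    fix i j assume "i \<in> J" "j \<in> J"
    then show "u i * u j * (\<integral>s. h i s * h j s \<partial>N) = (if j = i then (u i)\<^sup>2 * (\<integral>s. (h i s)\<^sup>2 \<partial>N) else 0)"
      using ortho[of i j] by (auto simp: power2_eq_square)
  qed
  finally show ?thesis using J by (simp add: sum.delta)
qed

section \<open>Inequalities, limits and completeness in the space of square integrable
  functions\<close>

lemma Cauchy_Schwarz_integral:
  assumes f: "square_integrable N f" and g: "square_integrable N g"
  shows "\<bar>\<integral>x. f x * g x \<partial>N\<bar> \<le> sqrt (\<integral>x. (f x)\<^sup>2 \<partial>N) * sqrt (\<integral>x. (g x)\<^sup>2 \<partial>N)"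
proof -
  define a b c where "a = (\<integral>x. (f x)\<^sup>2 \<partial>N)" and "b = (\<integral>x. f x * g x \<partial>N)" and "c = (\<integral>x. (g x)\<^sup>2 \<partial>N)"
  have nonneg: "a \<ge> 0" "c \<ge> 0" by (auto simp: a_def c_def)
  have quad: "0 \<le> a - 2 * t * b + t\<^sup>2 * c" for t
  proof -
    have "0 \<le> (\<integral>x. (f x - t * g x)\<^sup>2 \<partial>N)" by simp
    also have "\<dots> = a - 2 * t * b + t\<^sup>2 * c"
      unfolding a_def b_def c_def
      by (subst integral_square_diff[OF f square_integrable_cmult[OF g]])
        (simp add: power_mult_distrib mult.left_commute)
    finally show ?thesis .
  qed
  have "b\<^sup>2 \<le> a * c"
  proof (cases "c = 0")
    case True
    have "b = 0"
    proof (rule ccontr)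
      assume "b \<noteq> 0"
      \<comment> \<open>For \<open>c = 0\<close> the quadratic is affine in \<open>t\<close>, and at
        this \<open>t\<close> it takes the value \<open>-1\<close>.\<close>
      then show False using quad[of "(a + 1) / (2 * b)"] True by (simp add: field_simps)
    qed
    then show ?thesis using True by simp
  next
    case False
    then have "0 < c" using nonneg by simp
    then show ?thesis using quad[of "b / c"]
      by (simp add: field_simps power2_eq_square)
  qed
  then have "sqrt (b\<^sup>2) \<le> sqrt (a * c)" by (rule real_sqrt_le_mono)
  then show ?thesis by (simp add: real_sqrt_mult a_def b_def c_def)
qed

lemma Minkowski_integral:
  assumes f: "square_integrable N f" and g: "square_integrable N g"
  shows "sqrt (\<integral>x. (f x + g x)\<^sup>2 \<partial>N) \<le> sqrt (\<integral>x. (f x)\<^sup>2 \<partial>N) + sqrt (\<integral>x. (g x)\<^sup>2 \<partial>N)"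
proof (rule real_le_lsqrt)
  have "(\<integral>x. (f x + g x)\<^sup>2 \<partial>N) = (\<integral>x. (f x)\<^sup>2 \<partial>N) + 2 * (\<integral>x. f x * g x \<partial>N) + (\<integral>x. (g x)\<^sup>2 \<partial>N)"
    using f g integrable_square_integrable_mult[OF f g]
    by (simp add: square_integrable_def power2_sum mult.assoc)
  also have "\<dots> \<le> (\<integral>x. (f x)\<^sup>2 \<partial>N) + 2 * (sqrt (\<integral>x. (f x)\<^sup>2 \<partial>N) * sqrt (\<integral>x. (g x)\<^sup>2 \<partial>N)) + (\<integral>x. (g x)\<^sup>2 \<partial>N)"
    using Cauchy_Schwarz_integral[OF f g] by simp
  also have "\<dots> = (sqrt (\<integral>x. (f x)\<^sup>2 \<partial>N) + sqrt (\<integral>x. (g x)\<^sup>2 \<partial>N))\<^sup>2"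
    by (simp add: power2_sum)
  finally show "(\<integral>x. (f x + g x)\<^sup>2 \<partial>N) \<le> (sqrt (\<integral>x. (f x)\<^sup>2 \<partial>N) + sqrt (\<integral>x. (g x)\<^sup>2 \<partial>N))\<^sup>2" .
qed auto

text \<open>The difference of the products is \<open>(F - f)(G - g) - (F - f) G - F (G - g)\<close>,
  and Cauchy-Schwarz makes each term small. With \<open>g\<close> constantly 1 this yields
  convergence of means, with \<open>g = f\<close> convergence of squared norms.\<close>

lemma L2_tendsto_integral_mult:
  assumes fn: "\<And>n. square_integrable N (f n)" and gn: "\<And>n. square_integrable N (g n)"
    and F: "square_integrable N F" and G: "square_integrable N G"
    and f: "(\<lambda>n. \<integral>x. (F x - f n x)\<^sup>2 \<partial>N) \<longlonglongrightarrow> 0"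
    and g: "(\<lambda>n. \<integral>x. (G x - g n x)\<^sup>2 \<partial>N) \<longlonglongrightarrow> 0"
  shows "(\<lambda>n. \<integral>x. f n x * g n x \<partial>N) \<longlonglongrightarrow> (\<integral>x. F x * G x \<partial>N)"
proof -
  let ?n = "\<lambda>h. sqrt (\<integral>x. (h x)\<^sup>2 \<partial>N)"
  have bound: "norm ((\<integral>x. f n x * g n x \<partial>N) - (\<integral>x. F x * G x \<partial>N)) \<le>
      sqrt (\<integral>x. (F x - f n x)\<^sup>2 \<partial>N) * sqrt (\<integral>x. (G x - g n x)\<^sup>2 \<partial>N) +
      sqrt (\<integral>x. (F x - f n x)\<^sup>2 \<partial>N) * ?n G + ?n F * sqrt (\<integral>x. (G x - g n x)\<^sup>2 \<partial>N)" for n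
  proof -
    note d = square_integrable_diff[OF F fn[of n]] square_integrable_diff[OF G gn[of n]]
    have "(\<integral>x. f n x * g n x \<partial>N) - (\<integral>x. F x * G x \<partial>N) = (\<integral>x. f n x * g n x - F x * G x \<partial>N)"
      using integrable_square_integrable_mult F G fn gn by (intro Bochner_Integration.integral_diff[symmetric]) blast+
    also have "\<dots> = (\<integral>x. (F x - f n x) * (G x - g n x) - (F x - f n x) * G x - F x * (G x - g n x) \<partial>N)"
      by (intro Bochner_Integration.integral_cong refl) (simp add: algebra_simps)
    also have "\<dots> = (\<integral>x. (F x - f n x) * (G x - g n x) \<partial>N) - (\<integral>x. (F x - f n x) * G x \<partial>N) - (\<integral>x. F x * (G x - g n x) \<partial>N)"
      using integrable_square_integrable_mult[OF d] integrable_square_integrable_mult[OF d(1) G]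
        integrable_square_integrable_mult[OF F d(2)] by simp
    finally show ?thesis
      using Cauchy_Schwarz_integral[OF d] Cauchy_Schwarz_integral[OF d(1) G]
        Cauchy_Schwarz_integral[OF F d(2)] by simp
  qed
  have "(\<lambda>n. sqrt (\<integral>x. (F x - f n x)\<^sup>2 \<partial>N) * sqrt (\<integral>x. (G x - g n x)\<^sup>2 \<partial>N) +
      sqrt (\<integral>x. (F x - f n x)\<^sup>2 \<partial>N) * ?n G + ?n F * sqrt (\<integral>x. (G x - g n x)\<^sup>2 \<partial>N)) \<longlonglongrightarrow>
      sqrt 0 * sqrt 0 + sqrt 0 * ?n G + ?n F * sqrt 0"
    by (intro tendsto_intros f g)
  then have "(\<lambda>n. (\<integral>x. f n x * g n x \<partial>N) - (\<integral>x. F x * G x \<partial>N)) \<longlonglongrightarrow> 0"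
    by (intro Lim_null_comparison[OF always_eventually[OF allI[OF bound]]]) simp
  then show ?thesis by (simp add: LIM_zero_iff)
qed

lemma L2_tendsto_add:
  assumes fn: "\<And>n. square_integrable N (f n)" and gn: "\<And>n. square_integrable N (g n)"
    and F: "square_integrable N F" and G: "square_integrable N G"
    and f: "(\<lambda>n. \<integral>x. (F x - f n x)\<^sup>2 \<partial>N) \<longlonglongrightarrow> 0"
    and g: "(\<lambda>n. \<integral>x. (G x - g n x)\<^sup>2 \<partial>N) \<longlonglongrightarrow> 0"
  shows "(\<lambda>n. \<integral>x. ((F x + G x) - (f n x + g n x))\<^sup>2 \<partial>N) \<longlonglongrightarrow> 0"
proof -
  have bound: "norm (sqrt (\<integral>x. ((F x + G x) - (f n x + g n x))\<^sup>2 \<partial>N)) \<le>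
     sqrt (\<integral>x. (F x - f n x)\<^sup>2 \<partial>N) + sqrt (\<integral>x. (G x - g n x)\<^sup>2 \<partial>N)" for n
    using Minkowski_integral[OF square_integrable_diff[OF F fn[of n]] square_integrable_diff[OF G gn[of n]]]
    by (simp add: algebra_simps)
  have "(\<lambda>n. sqrt (\<integral>x. (F x - f n x)\<^sup>2 \<partial>N) + sqrt (\<integral>x. (G x - g n x)\<^sup>2 \<partial>N)) \<longlonglongrightarrow> sqrt 0 + sqrt 0"
    by (intro tendsto_intros f g)
  then have "(\<lambda>n. sqrt (\<integral>x. ((F x + G x) - (f n x + g n x))\<^sup>2 \<partial>N)) \<longlonglongrightarrow> 0"
    by (intro Lim_null_comparison[OF always_eventually[OF allI[OF bound]]]) simp
  then have "(\<lambda>n. (sqrt (\<integral>x. ((F x + G x) - (f n x + g n x))\<^sup>2 \<partial>N))\<^sup>2) \<longlonglongrightarrow> 0\<^sup>2"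
    by (rule tendsto_power)
  then show ?thesis by simp
qed

text \<open>Riesz-Fischer for geometrically fast sequences. On a finite measure space the mean
  square bounds control the absolute means, so the telescoping series converges absolutely almost
  everywhere; Fatou's lemma then turns the pointwise limit into a mean square limit.\<close>

lemma (in finite_measure) L2_complete:
  fixes f :: "nat \<Rightarrow> 'a \<Rightarrow> real"
  assumes fn: "\<And>n. square_integrable M (f n)"
    and fast: "\<And>n. sqrt (\<integral>x. (f (Suc n) x - f n x)\<^sup>2 \<partial>M) \<le> (1 / 2) ^ n"
  obtains F where "square_integrable M F" "(\<lambda>n. \<integral>x. (F x - f n x)\<^sup>2 \<partial>M) \<longlonglongrightarrow> 0"
proof -
  have [measurable]: "f n \<in> borel_measurable M" for n
    using fn by (simp add: square_integrable_def)
  define D where "D n x = f (Suc n) x - f n x" for n x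
  have D: "square_integrable M (D n)" for n
    unfolding D_def[abs_def] by (intro square_integrable_diff fn)
  have [measurable]: "D n \<in> borel_measurable M" for n
    using D by (simp add: square_integrable_def)
  have one: "square_integrable M (\<lambda>_. 1)" by (intro square_integrable_bounded[where C = 1]) auto
  define c where "c = sqrt (measure M (space M))"
  have intD: "(\<integral>x. \<bar>D n x\<bar> \<partial>M) \<le> (1/2)^n * c" and iD: "integrable M (D n)" for n
  proof -
    have abs: "square_integrable M (\<lambda>x. \<bar>D n x\<bar>)"
      using D[of n] by (simp add: square_integrable_def)
    show "integrable M (D n)"
      using integrable_square_integrable_mult[OF D[of n] one] by simp
    have "(\<integral>x. \<bar>D n x\<bar> \<partial>M) \<le> sqrt (\<integral>x. (D n x)\<^sup>2 \<partial>M) * c"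
      using Cauchy_Schwarz_integral[OF abs one] by (simp add: c_def)
    also have "\<dots> \<le> (1/2)^n * c"
      using fast[of n] by (intro mult_right_mono) (auto simp: D_def c_def)
    finally show "(\<integral>x. \<bar>D n x\<bar> \<partial>M) \<le> (1/2)^n * c" .
  qed
  have "AE x in M. summable (\<lambda>n. \<bar>D n x\<bar>)"
  proof -
    have "(\<integral>\<^sup>+x. (\<Sum>n. ennreal \<bar>D n x\<bar>) \<partial>M) = (\<Sum>n. \<integral>\<^sup>+x. ennreal \<bar>D n x\<bar> \<partial>M)"
      by (intro nn_integral_suminf) auto
    also have "\<dots> = (\<Sum>n. ennreal (\<integral>x. \<bar>D n x\<bar> \<partial>M))"
      using iD by (intro suminf_cong nn_integral_eq_integral) auto
    also have "\<dots> \<le> (\<Sum>n. ennreal ((1/2)^n * c))"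
      using intD by (intro suminf_le ennreal_leI) auto
    also have "\<dots> = ennreal (\<Sum>n. (1/2)^n * c)"
      by (intro suminf_ennreal2) (auto simp: c_def intro!: summable_mult2 summable_geometric)
    also have "\<dots> < \<infinity>" by simp
    finally have "AE x in M. (\<Sum>n. ennreal \<bar>D n x\<bar>) \<noteq> \<infinity>"
      by (intro nn_integral_noteq_infinite) auto
    then show ?thesis
      by eventually_elim (auto intro: summable_suminf_not_top)
  qed
  \<comment> \<open>Where the series is not summable, which is a null set, the infinite sum is an
    unspecified value; this does no harm.\<close>
  define F where "F x = f 0 x + (\<Sum>n. D n x)" for x
  have [measurable]: "F \<in> borel_measurable M" unfolding F_def[abs_def] by measurable
  have lim: "AE x in M. (\<lambda>m. f m x) \<longlonglongrightarrow> F x"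
    using \<open>AE x in M. summable (\<lambda>n. \<bar>D n x\<bar>)\<close>
  proof eventually_elim
    case (elim x)
    then have "(\<lambda>n. D n x) sums (\<Sum>n. D n x)"
      by (rule summable_sums[OF summable_rabs_cancel])
    then have "(\<lambda>m. f 0 x + (\<Sum>n<m. D n x)) \<longlonglongrightarrow> F x"
      unfolding F_def sums_def by (intro tendsto_intros)
    moreover have "f 0 x + (\<Sum>n<m. D n x) = f m x" for m
      by (induction m) (simp_all add: D_def)
    ultimately show ?case by simp
  qed
  \<comment> \<open>The bound is the geometric sum of \<open>(1/2)^(n + j)\<close> over
    \<open>j < k\<close>; it stays below \<open>2 * (1/2)^n\<close> for all
    \<open>k\<close>.\<close>
  have dist: "sqrt (\<integral>x. (f (n + k) x - f n x)\<^sup>2 \<partial>M) \<le> (1/2)^n * (2 - 2 * (1/2)^k)" for n k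
  proof (induction k)
    case (Suc k)
    have "sqrt (\<integral>x. (f (n + Suc k) x - f n x)\<^sup>2 \<partial>M) \<le> 
      sqrt (\<integral>x. (f (n + k) x - f n x)\<^sup>2 \<partial>M) + sqrt (\<integral>x. (D (n + k) x)\<^sup>2 \<partial>M)"
      using Minkowski_integral[OF square_integrable_diff[OF fn[of "n + k"] fn[of n]] D[of "n + k"]]
      by (simp add: D_def algebra_simps)
    also have "\<dots> \<le> (1/2)^n * (2 - 2 * (1/2)^k) + (1/2)^(n+k)"
      using Suc fast[of "n + k"] by (intro add_mono) (auto simp: D_def)
    also have "\<dots> = (1/2)^n * (2 - 2 * (1/2)^Suc k)"
      by (simp add: power_add algebra_simps)
    finally show ?case .
  qed simp
  have near: "(\<integral>\<^sup>+x. ennreal ((F x - f n x)\<^sup>2) \<partial>M) \<le> ennreal (((1/2)^n * 2)\<^sup>2)" for n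
  proof -
    \<comment> \<open>Fatou's lemma in the index \<open>m\<close> with \<open>n\<close> fixed: the
      uniform bound on the distances \<open>f m - f n\<close> passes to
      \<open>F - f n\<close>.\<close>
    have "(\<integral>\<^sup>+x. ennreal ((F x - f n x)\<^sup>2) \<partial>M) = (\<integral>\<^sup>+x. liminf (\<lambda>m. ennreal ((f m x - f n x)\<^sup>2)) \<partial>M)"
      using lim
    proof (intro nn_integral_cong_AE, eventually_elim)
      case (elim x)
      then have "(\<lambda>m. ennreal ((f m x - f n x)\<^sup>2)) \<longlonglongrightarrow> ennreal ((F x - f n x)\<^sup>2)"
        by (intro tendsto_intros)
      then show ?case by (intro lim_imp_Liminf[symmetric]) auto
    qed
    also have "\<dots> \<le> liminf (\<lambda>m. \<integral>\<^sup>+x. ennreal ((f m x - f n x)\<^sup>2) \<partial>M)"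
      by (intro nn_integral_liminf) auto
    also have "\<dots> \<le> ennreal (((1/2)^n * 2)\<^sup>2)"
    proof (rule Liminf_le)
      have "(\<integral>\<^sup>+x. ennreal ((f (n + k) x - f n x)\<^sup>2) \<partial>M) \<le> ennreal (((1/2)^n * 2)\<^sup>2)" for k
      proof -
        have "sqrt (\<integral>x. (f (n + k) x - f n x)\<^sup>2 \<partial>M) \<le> (1/2)^n * 2"
          using dist[of n k] by (rule order_trans) (intro mult_left_mono, auto)
        then have "(\<integral>x. (f (n + k) x - f n x)\<^sup>2 \<partial>M) \<le> ((1/2)^n * 2)\<^sup>2"
          by (rule sqrt_le_D)
        then show ?thesis
          using square_integrable_diff[OF fn[of "n + k"] fn[of n]]
          by (subst nn_integral_eq_integral) (auto simp: square_integrable_def intro: ennreal_leI)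
      qed
      then have "\<forall>m\<ge>n. (\<integral>\<^sup>+x. ennreal ((f m x - f n x)\<^sup>2) \<partial>M) \<le> ennreal (((1/2)^n * 2)\<^sup>2)"
        by (metis le_iff_add)
      then show "eventually (\<lambda>m. (\<integral>\<^sup>+x. ennreal ((f m x - f n x)\<^sup>2) \<partial>M) \<le> ennreal (((1/2)^n * 2)\<^sup>2)) sequentially"
        by (auto simp: eventually_sequentially)
    qed auto
    finally show ?thesis .
  qed
  have sqd: "square_integrable M (\<lambda>x. F x - f n x)" for n
    unfolding square_integrable_def
    by (auto intro!: integrableI_bounded order.strict_trans1[OF near[of n]])
  have "square_integrable M F"
    using square_integrable_add[OF sqd[of 0] fn[of 0]] by simp
  moreover have "(\<lambda>n. \<integral>x. (F x - f n x)\<^sup>2 \<partial>M) \<longlonglongrightarrow> 0"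
  proof (rule Lim_null_comparison)
    show "\<forall>\<^sub>F n in sequentially. norm (\<integral>x. (F x - f n x)\<^sup>2 \<partial>M) \<le> ((1/2)^n * 2)\<^sup>2"
    proof (intro always_eventually allI)
      fix n
      show "norm (\<integral>x. (F x - f n x)\<^sup>2 \<partial>M) \<le> ((1/2)^n * 2)\<^sup>2"
        using near[of n] sqd[of n]
        by (subst (asm) nn_integral_eq_integral) (auto simp: square_integrable_def ennreal_le_iff)
    qed
    have "(\<lambda>n. ((1/2)^n * 2)\<^sup>2 :: real) \<longlonglongrightarrow> (0 * 2)\<^sup>2"
      by (intro tendsto_intros LIMSEQ_power_zero) auto
    then show "(\<lambda>n. ((1/2)^n * 2)\<^sup>2 :: real) \<longlonglongrightarrow> 0" by simp
  qed
  ultimately show ?thesis using that by blast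
qed

section \<open>Wiener integrals of step functions\<close>

text \<open>An unordered list of initial intervals \<open>[0, v)\<close> with coefficients: addition
  is concatenation, no common refinement of partitions is ever formed, and bilinear identities
  reduce to pairs of initial intervals.\<close>

definition simple_fun :: "(real \<times> real) list \<Rightarrow> real \<Rightarrow> real" where
  "simple_fun xs s = (\<Sum>(c, v)\<leftarrow>xs. c * indicat_real {0..<v} s)"

text \<open>\<open>B 0\<close> is subtracted because it vanishes only almost surely; in this form
  the algebraic identities hold at every \<omega>.\<close>

definition simple_int :: "(real \<Rightarrow> 'a \<Rightarrow> real) \<Rightarrow> (real \<times> real) list \<Rightarrow> 'a \<Rightarrow> real" where
  "simple_int B xs \<omega> = (\<Sum>(c, v)\<leftarrow>xs. c * (B v \<omega> - B 0 \<omega>))"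

abbreviation lebesgue_upto :: "real \<Rightarrow> real measure" where
  "lebesgue_upto S \<equiv> restrict_space lborel {0..S}"

lemma simple_fun_simps [simp]:
  "simple_fun [] s = 0"
  "simple_fun (x # xs) s = fst x * indicat_real {0..<snd x} s + simple_fun xs s"
  "simple_fun (xs @ ys) s = simple_fun xs s + simple_fun ys s"
  by (auto simp: simple_fun_def split: prod.split)

lemma simple_int_simps [simp]:
  "simple_int B [] \<omega> = 0"
  "simple_int B (x # xs) \<omega> = fst x * (B (snd x) \<omega> - B 0 \<omega>) + simple_int B xs \<omega>"
  "simple_int B (xs @ ys) \<omega> = simple_int B xs \<omega> + simple_int B ys \<omega>"
  by (auto simp: simple_int_def split: prod.split)

lemma simple_fun_scale: "simple_fun (map (\<lambda>(c, v). (a * c, v)) xs) s = a * simple_fun xs s"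
  by (induction xs) (auto simp: algebra_simps)

lemma simple_int_scale: "simple_int B (map (\<lambda>(c, v). (a * c, v)) xs) \<omega> = a * simple_int B xs \<omega>"
  by (induction xs) (auto simp: algebra_simps)

lemma finite_measure_lebesgue_upto: "finite_measure (lebesgue_upto S)"
  by (rule finite_measureI) (simp add: emeasure_restrict_space emeasure_lborel_Icc_eq)

lemma integral_lebesgue_upto:
  fixes h :: "real \<Rightarrow> real"
  shows "(\<integral>s. h s \<partial>lebesgue_upto S) = (LBINT s:{0..S}. h s)"
  by (subst integral_restrict_space) (auto simp: set_lebesgue_integral_def)

lemma integrable_lebesgue_upto:
  fixes h :: "real \<Rightarrow> real"
  shows "integrable (lebesgue_upto S) h \<longleftrightarrow> set_integrable lborel {0..S} h"
  by (subst integrable_restrict_space) (auto simp: set_integrable_def)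

lemma square_integrable_indicator:
  assumes "A \<in> sets borel"
  shows "square_integrable (lebesgue_upto S) (indicat_real A)"
proof -
  interpret finite_measure "lebesgue_upto S" by (rule finite_measure_lebesgue_upto)
  show ?thesis
    by (rule square_integrable_bounded[where C = 1])
      (use assms in \<open>auto simp: indicator_def intro!: measurable_restrict_space1\<close>)
qed

lemma square_integrable_simple_fun: "square_integrable (lebesgue_upto S) (simple_fun xs)"
proof (induction xs)
  case Nil
  have "simple_fun [] = (\<lambda>_. 0)" by auto
  then show ?case by (simp add: square_integrable_zero)
next
  case (Cons x xs)
  have "simple_fun (x # xs) = (\<lambda>s. fst x * indicat_real {0..<snd x} s + simple_fun xs s)" by auto
  then show ?case
    by (auto intro!: square_integrable_add square_integrable_cmult square_integrable_indicator Cons)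
qed

lemma square_integrable_continuous:
  assumes "continuous_on {0..S} g"
  shows "square_integrable (lebesgue_upto S) g"
  unfolding square_integrable_def
proof
  have "g \<in> borel_measurable (restrict_space borel {0..S})"
    using assms by (rule borel_measurable_continuous_on_restrict)
  then show "g \<in> borel_measurable (lebesgue_upto S)"
    by (simp cong: measurable_cong_sets add: sets_restrict_space)
  show "integrable (lebesgue_upto S) (\<lambda>s. (g s)\<^sup>2)"
    unfolding integrable_lebesgue_upto
    by (intro borel_integrable_atLeastAtMost' continuous_intros assms)
qed

lemma integral_indicator_mult_indicator:
  assumes "0 \<le> v" "v \<le> S" "0 \<le> w" "w \<le> S"
  shows "(\<integral>s. indicat_real {0..<v} s * indicat_real {0..<w} s \<partial>lebesgue_upto S) = min v w"
proof -
  have "(\<integral>s. indicat_real {0..<v} s * indicat_real {0..<w} s \<partial>lebesgue_upto S) =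
      (\<integral>s. indicat_real {0..<min v w} s \<partial>lborel)"
    using assms unfolding integral_lebesgue_upto set_lebesgue_integral_def
    by (intro Bochner_Integration.integral_cong) (auto simp: indicator_def)
  also have "\<dots> = min v w" using assms by simp
  finally show ?thesis .
qed

section \<open>Moments and characteristic function of a centred normal variable\<close>

context prob_space
begin

lemma square_integrable_normal:
  assumes D: "distributed M lborel X (normal_density 0 \<sigma>)" and \<sigma>: "0 < \<sigma>"
  shows "square_integrable M X" "expectation (\<lambda>\<omega>. (X \<omega>)\<^sup>2) = \<sigma>\<^sup>2" "expectation X = 0"
proof -
  have [measurable]: "X \<in> borel_measurable M"
    using distributed_measurable[OF D] by simp
  have "integrable lborel (\<lambda>x. normal_density 0 \<sigma> x * x\<^sup>2)"
    using integrable_normal_moment[OF \<sigma>, of 0 2] by simp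
  then show "square_integrable M X"
    unfolding square_integrable_def
    using distributed_integrable[OF D, of "\<lambda>x. x\<^sup>2"] by simp
  show e: "expectation X = 0" by (rule normal_distributed_expectation[OF \<sigma> D])
  show "expectation (\<lambda>\<omega>. (X \<omega>)\<^sup>2) = \<sigma>\<^sup>2"
    using normal_distributed_variance[OF \<sigma> D] by (simp add: e)
qed

lemma iexp_normal:
  assumes D: "distributed M lborel X (normal_density 0 \<sigma>)" and \<sigma>: "0 < \<sigma>"
  shows "(CLINT \<omega>|M. iexp (u * X \<omega>)) = exp (- (u\<^sup>2 * \<sigma>\<^sup>2) / 2)"
proof -
  have D1: "distributed M lborel (\<lambda>\<omega>. X \<omega> / \<sigma>) std_normal_density"
    using normal_standard_normal_convert[OF \<sigma>, of X 0] D by simp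
  have [measurable]: "X \<in> borel_measurable M"
    using distributed_measurable[OF D] by simp
  have "char std_normal_distribution (u * \<sigma>) = (CLINT \<omega>|M. iexp ((u * \<sigma>) * (X \<omega> / \<sigma>)))"
    unfolding char_def distributed_distr_eq_density[OF D1, symmetric]
    by (subst integral_distr) auto
  also have "\<dots> = (CLINT \<omega>|M. iexp (u * X \<omega>))"
    using \<sigma> by (intro Bochner_Integration.integral_cong) auto
  finally show ?thesis
    by (simp add: char_std_normal_distribution power_mult_distrib)
qed

end

section \<open>Ito isometry and Gaussian law for step integrands\<close>

context wiener_process
begin

lemma increment_square_integrable:
  assumes "0 \<le> s" "s \<le> t"
  shows "square_integrable M (\<lambda>\<omega>. B t \<omega> - B s \<omega>)" "expectation (\<lambda>\<omega>. (B t \<omega> - B s \<omega>)\<^sup>2) = t - s"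
    "expectation (\<lambda>\<omega>. B t \<omega> - B s \<omega>) = 0"
proof -
  have "square_integrable M (\<lambda>\<omega>. B t \<omega> - B s \<omega>) \<and> expectation (\<lambda>\<omega>. (B t \<omega> - B s \<omega>)\<^sup>2) = t - s \<and>
    expectation (\<lambda>\<omega>. B t \<omega> - B s \<omega>) = 0"
  proof (cases "s = t")
    case False
    then have st: "s < t" using assms by simp
    show ?thesis
      using square_integrable_normal[OF wiener_increment_normal[OF assms(1) st]] st by simp
  qed (simp add: square_integrable_zero)
  then show "square_integrable M (\<lambda>\<omega>. B t \<omega> - B s \<omega>)" "expectation (\<lambda>\<omega>. (B t \<omega> - B s \<omega>)\<^sup>2) = t - s"
    "expectation (\<lambda>\<omega>. B t \<omega> - B s \<omega>) = 0"
    by auto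
qed

text \<open>Polarisation: the mixed moment is read off from the variances of the increments over
  \<open>[0, s]\<close>, \<open>[0, t]\<close> and \<open>[s, t]\<close>.\<close>

lemma wiener_covariance:
  assumes "0 \<le> s" "0 \<le> t"
  shows "expectation (\<lambda>\<omega>. (B s \<omega> - B 0 \<omega>) * (B t \<omega> - B 0 \<omega>)) = min s t"
  using assms
proof (induction s t rule: linorder_wlog)
  case (le s t)
  have "expectation (\<lambda>\<omega>. (B t \<omega> - B s \<omega>)\<^sup>2) =
      expectation (\<lambda>\<omega>. ((B t \<omega> - B 0 \<omega>) - (B s \<omega> - B 0 \<omega>))\<^sup>2)"
    by simp
  also have "\<dots> = t - 2 * expectation (\<lambda>\<omega>. (B t \<omega> - B 0 \<omega>) * (B s \<omega> - B 0 \<omega>)) + s"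
    using increment_square_integrable[of 0 s] increment_square_integrable[of 0 t] le
    by (subst integral_square_diff) auto
  finally show ?case
    using increment_square_integrable[of s t] le by (simp add: mult.commute)
next
  case (sym s t)
  then show ?case by (simp add: mult.commute min.commute)
qed

lemma square_integrable_simple_int:
  "(\<And>c v. (c, v) \<in> set xs \<Longrightarrow> 0 \<le> v) \<Longrightarrow> square_integrable M (simple_int B xs)"
proof (induction xs)
  case Nil
  have "simple_int B [] = (\<lambda>_. 0)" by auto
  then show ?case by (simp add: square_integrable_zero)
next
  case (Cons x xs)
  have "simple_int B (x # xs) = (\<lambda>\<omega>. fst x * (B (snd x) \<omega> - B 0 \<omega>) + simple_int B xs \<omega>)" by auto
  moreover have "0 \<le> snd x" using Cons.prems[of "fst x" "snd x"] by simp
  moreover have "square_integrable M (simple_int B xs)"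
    using Cons.prems by (intro Cons.IH) auto
  ultimately show ?case
    using increment_square_integrable(1)[of 0 "snd x"]
    by (auto intro!: square_integrable_add square_integrable_cmult)
qed

lemma expectation_simple_int:
  "(\<And>c v. (c, v) \<in> set xs \<Longrightarrow> 0 \<le> v) \<Longrightarrow> expectation (simple_int B xs) = 0"
proof (induction xs)
  case (Cons x xs)
  have "simple_int B (x # xs) = (\<lambda>\<omega>. fst x * (B (snd x) \<omega> - B 0 \<omega>) + simple_int B xs \<omega>)" by auto
  moreover have "0 \<le> snd x" using Cons.prems[of "fst x" "snd x"] by simp
  moreover have "square_integrable M (simple_int B xs)"
    using Cons.prems by (intro square_integrable_simple_int) auto
  moreover have "expectation (simple_int B xs) = 0" using Cons.prems by (intro Cons.IH) auto
  ultimately show ?case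
    using increment_square_integrable[of 0 "snd x"] square_integrable_integrable by simp
next
  case Nil
  have "simple_int B [] = (\<lambda>_. 0)" by auto
  then show ?case by simp
qed

text \<open>Both sides are bilinear in the lists, so two nested inductions reduce the claim to
  initial intervals \<open>[0, v)\<close> and \<open>[0, w)\<close>, where both sides equal
  \<open>min v w\<close>.\<close>

lemma simple_isometry:
  assumes "\<And>c v. (c, v) \<in> set xs \<Longrightarrow> 0 \<le> v \<and> v \<le> S" "\<And>c v. (c, v) \<in> set ys \<Longrightarrow> 0 \<le> v \<and> v \<le> S"
  shows "expectation (\<lambda>\<omega>. simple_int B xs \<omega> * simple_int B ys \<omega>) =
    (\<integral>s. simple_fun xs s * simple_fun ys s \<partial>lebesgue_upto S)"
  using assms(1)
proof (induction xs)
  case (Cons x xs)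
  have x: "0 \<le> snd x" "snd x \<le> S" using Cons.prems[of "fst x" "snd x"] by auto
  have one: "expectation (\<lambda>\<omega>. (B (snd x) \<omega> - B 0 \<omega>) * simple_int B ys \<omega>) =
    (\<integral>s. indicat_real {0..<snd x} s * simple_fun ys s \<partial>lebesgue_upto S)"
    using assms(2)
  proof (induction ys)
    case (Cons y ys)
    have y: "0 \<le> snd y" "snd y \<le> S" using Cons.prems[of "fst y" "snd y"] by auto
    have ys: "square_integrable M (simple_int B ys)"
      using Cons.prems by (intro square_integrable_simple_int) auto
    have IH: "expectation (\<lambda>\<omega>. (B (snd x) \<omega> - B 0 \<omega>) * simple_int B ys \<omega>) =
      (\<integral>s. indicat_real {0..<snd x} s * simple_fun ys s \<partial>lebesgue_upto S)"
      using Cons.prems by (intro Cons.IH) auto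
    note sq = increment_square_integrable(1)[OF order_refl x(1)]
      increment_square_integrable(1)[OF order_refl y(1)]
    note ind = square_integrable_indicator[of "{0..<snd x}" S] square_integrable_indicator[of "{0..<snd y}" S]
    have "expectation (\<lambda>\<omega>. (B (snd x) \<omega> - B 0 \<omega>) * simple_int B (y # ys) \<omega>) =
      expectation (\<lambda>\<omega>. fst y * ((B (snd x) \<omega> - B 0 \<omega>) * (B (snd y) \<omega> - B 0 \<omega>)) +
        (B (snd x) \<omega> - B 0 \<omega>) * simple_int B ys \<omega>)"
      by (intro Bochner_Integration.integral_cong) (auto simp: algebra_simps)
    also have "\<dots> = fst y * min (snd x) (snd y) + (\<integral>s. indicat_real {0..<snd x} s * simple_fun ys s \<partial>lebesgue_upto S)"
      using integrable_square_integrable_mult[OF sq] integrable_square_integrable_mult[OF sq(1) ys]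
        wiener_covariance[OF x(1) y(1)] IH by simp
    also have "\<dots> = (\<integral>s. fst y * (indicat_real {0..<snd x} s * indicat_real {0..<snd y} s) +
        indicat_real {0..<snd x} s * simple_fun ys s \<partial>lebesgue_upto S)"
      using integrable_square_integrable_mult[OF ind]
        integrable_square_integrable_mult[OF ind(1) square_integrable_simple_fun[of S ys]]
        integral_indicator_mult_indicator[OF x y] by simp
    also have "\<dots> = (\<integral>s. indicat_real {0..<snd x} s * simple_fun (y # ys) s \<partial>lebesgue_upto S)"
      by (intro Bochner_Integration.integral_cong) (auto simp: algebra_simps)
    finally show ?case .
  qed simp
  have IH: "expectation (\<lambda>\<omega>. simple_int B xs \<omega> * simple_int B ys \<omega>) =
    (\<integral>s. simple_fun xs s * simple_fun ys s \<partial>lebesgue_upto S)"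
    using Cons.prems by (intro Cons.IH) auto
  have sq: "square_integrable M (simple_int B xs)" "square_integrable M (simple_int B ys)"
    using Cons.prems assms(2) by (auto intro!: square_integrable_simple_int)
  have "expectation (\<lambda>\<omega>. simple_int B (x # xs) \<omega> * simple_int B ys \<omega>) =
    expectation (\<lambda>\<omega>. fst x * ((B (snd x) \<omega> - B 0 \<omega>) * simple_int B ys \<omega>) + simple_int B xs \<omega> * simple_int B ys \<omega>)"
    by (intro Bochner_Integration.integral_cong) (auto simp: algebra_simps)
  also have "\<dots> = fst x * (\<integral>s. indicat_real {0..<snd x} s * simple_fun ys s \<partial>lebesgue_upto S) +
     (\<integral>s. simple_fun xs s * simple_fun ys s \<partial>lebesgue_upto S)"
    using integrable_square_integrable_mult[OF increment_square_integrable(1)[OF order_refl x(1)] sq(2)]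
      integrable_square_integrable_mult[OF sq] one IH by simp
  also have "\<dots> = (\<integral>s. fst x * (indicat_real {0..<snd x} s * simple_fun ys s) +
      simple_fun xs s * simple_fun ys s \<partial>lebesgue_upto S)"
    using integrable_square_integrable_mult[OF square_integrable_indicator[of "{0..<snd x}" S] square_integrable_simple_fun[of S ys]]
      integrable_square_integrable_mult[OF square_integrable_simple_fun[of S xs] square_integrable_simple_fun[of S ys]]
    by simp
  also have "\<dots> = (\<integral>s. simple_fun (x # xs) s * simple_fun ys s \<partial>lebesgue_upto S)"
    by (intro Bochner_Integration.integral_cong) (auto simp: algebra_simps)
  finally show ?case .
qed simp

text \<open>The two lists encode the indicators of \<open>[s, s')\<close> and
  \<open>[t, t')\<close>, which are disjoint, so the isometry gives zero.\<close>

lemma increment_covariance: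
  assumes "0 \<le> s" "s \<le> s'" "s' \<le> t" "t \<le> t'"
  shows "expectation (\<lambda>\<omega>. (B s' \<omega> - B s \<omega>) * (B t' \<omega> - B t \<omega>)) = 0"
proof -
  have "expectation (\<lambda>\<omega>. simple_int B [(1, s'), (-1, s)] \<omega> * simple_int B [(1, t'), (-1, t)] \<omega>) =
    (\<integral>r. simple_fun [(1, s'), (-1, s)] r * simple_fun [(1, t'), (-1, t)] r \<partial>lebesgue_upto t')"
    using assms by (intro simple_isometry) auto
  also have "\<dots> = (\<integral>r. 0 \<partial>lebesgue_upto t')"
    using assms by (intro Bochner_Integration.integral_cong) (auto simp: indicator_def)
  finally show ?thesis by simp
qed

text \<open>Needed to reach independent increments: the overlapping intervals of the list are cut at
  all their endpoints. On each resulting cell the step function is constant, so its value at the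
  left end \<open>p i\<close> is the coefficient.\<close>

lemma simple_int_as_increments:
  assumes "\<forall>x\<in>set xs. 0 \<le> snd x"
  shows "\<exists>n p. p 0 = 0 \<and> strict_mono_on {..n} p \<and>
    (\<forall>\<omega>. simple_int B xs \<omega> = (\<Sum>i<n. simple_fun xs (p i) * (B (p (Suc i)) \<omega> - B (p i) \<omega>)))"
proof -
  define F where "F = insert 0 (snd ` set xs)"
  define l where "l = sorted_list_of_set F"
  define p where "p i = l ! i" for i
  define n where "n = card F - 1"
  have F: "finite F" "0 \<in> F" "\<And>v. v \<in> F \<Longrightarrow> 0 \<le> v"
    using assms by (auto simp: F_def)
  have l: "set l = F" "length l = card F" "sorted_wrt (<) l"
    using F strict_sorted_list_of_set[of F] by (auto simp: l_def)
  have "card F > 0" using F card_gt_0_iff by fastforce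
  then have cardF: "card F = Suc n" by (simp add: n_def)
  have mono: "p i < p j" if "i < j" "j \<le> n" for i j
    using that l cardF sorted_wrt_nth_less[of "(<)" l i j] unfolding p_def by auto
  have memp: "p i \<in> F" if "i \<le> n" for i
    using that l cardF unfolding p_def by (metis le_imp_less_Suc nth_mem)
  have surj: "\<exists>m\<le>n. v = p m" if "v \<in> F" for v
    using that l cardF unfolding p_def by (metis in_set_conv_nth less_Suc_eq_le)
  have p0: "p 0 = 0"
  proof -
    obtain m where m: "m \<le> n" "0 = p m" using surj[OF F(2)] by auto
    then show ?thesis using mono[of 0 m] F(3)[OF memp[of 0]] by (cases "m = 0") auto
  qed
  have smono: "strict_mono_on {..n} p" by (auto intro!: strict_mono_onI mono)
  \<comment> \<open>Since \<open>v\<close> is itself one of the cut points, the cells to its left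
    telescope to the increment from 0 to \<open>v\<close>.\<close>
  have tele: "B v \<omega> - B 0 \<omega> = (\<Sum>i<n. indicat_real {0..<v} (p i) * (B (p (Suc i)) \<omega> - B (p i) \<omega>))"
    if v: "v \<in> F" for v \<omega>
  proof -
    obtain m where m: "m \<le> n" "v = p m" using surj[OF v] by auto
    have less: "p i < p m \<longleftrightarrow> i < m" if "i < n" for i
      using mono[of i m] mono[of m i] that m by (cases i m rule: linorder_cases) auto
    have "(\<Sum>i<n. indicat_real {0..<v} (p i) * (B (p (Suc i)) \<omega> - B (p i) \<omega>)) =
        (\<Sum>i<n. if i < m then B (p (Suc i)) \<omega> - B (p i) \<omega> else 0)"
      using m less F(3)[OF memp] by (intro sum.cong) (auto simp: indicator_def)
    also have "\<dots> = (\<Sum>i\<in>{..<n} \<inter> {i. i < m}. B (p (Suc i)) \<omega> - B (p i) \<omega>)"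
      by (subst sum.inter_restrict) auto
    also have "{..<n} \<inter> {i. i < m} = {..<m}" using m by auto
    also have "(\<Sum>i<m. B (p (Suc i)) \<omega> - B (p i) \<omega>) = B (p m) \<omega> - B (p 0) \<omega>"
      by (induction m) auto
    finally show ?thesis using m p0 by simp
  qed
  have "simple_int B ys \<omega> = (\<Sum>i<n. simple_fun ys (p i) * (B (p (Suc i)) \<omega> - B (p i) \<omega>))"
    if "snd ` set ys \<subseteq> F" for ys \<omega>
    using that
    by (induction ys) (auto simp: tele sum_distrib_left sum.distrib[symmetric] algebra_simps)
  then have "simple_int B xs \<omega> = (\<Sum>i<n. simple_fun xs (p i) * (B (p (Suc i)) \<omega> - B (p i) \<omega>))" for \<omega>
    by (auto simp: F_def)
  with p0 smono show ?thesis by blast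
qed

text \<open>Over the cells of a partition the integral is a sum of independent centred normal
  variables; their characteristic functions multiply and the variances add up to the squared norm of
  the integrand.\<close>

lemma iexp_simple_int:
  assumes "\<And>c v. (c, v) \<in> set xs \<Longrightarrow> 0 \<le> v \<and> v \<le> S"
  shows "(CLINT \<omega>|M. iexp (u * simple_int B xs \<omega>)) =
    exp (- (u\<^sup>2 * (\<integral>s. (simple_fun xs s)\<^sup>2 \<partial>lebesgue_upto S)) / 2)"
proof -
  have nn: "\<forall>x\<in>set xs. 0 \<le> snd x" using assms by auto
  obtain n p where p: "p 0 = 0" "strict_mono_on {..n} p" and
    eq: "\<And>\<omega>. simple_int B xs \<omega> = (\<Sum>i<n. simple_fun xs (p i) * (B (p (Suc i)) \<omega> - B (p i) \<omega>))"
    using simple_int_as_increments[OF nn] by blast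
  define d where "d i = simple_fun xs (p i)" for i
  define D where "D i \<omega> = B (p (Suc i)) \<omega> - B (p i) \<omega>" for i \<omega>
  have less: "p i < p j" if "i < j" "j \<le> n" for i j
    using that by (intro strict_mono_onD[OF p(2)]) auto
  then have pnn: "0 \<le> p i" if "i \<le> n" for i
    using p(1) that by (cases "i = 0") (force intro: less_imp_le)+
  have sqD: "square_integrable M (D i)" "expectation (\<lambda>\<omega>. (D i \<omega>)\<^sup>2) = p (Suc i) - p i" if "i < n" for i
    unfolding D_def[abs_def] using increment_square_integrable[of "p i" "p (Suc i)"] pnn[of i] less[of i "Suc i"] that
    by auto
  have norm: "distributed M lborel (D i) (normal_density 0 (sqrt (p (Suc i) - p i)))" if "i < n" for i
    unfolding D_def[abs_def] using pnn[of i] less[of i "Suc i"] that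
    by (intro wiener_increment_normal) auto
  have DD: "expectation (\<lambda>\<omega>. D i \<omega> * D j \<omega>) = (if i = j then p (Suc i) - p i else 0)"
    if "i < n" "j < n" for i j
  proof -
    have lt: "expectation (\<lambda>\<omega>. D i \<omega> * D j \<omega>) = 0" if "i < j" "j < n" for i j
      unfolding D_def
    proof (rule increment_covariance)
      show "p (Suc i) \<le> p j" using that less[of "Suc i" j] by (cases "Suc i = j") auto
    qed (use that pnn[of i] less[of i "Suc i"] less[of j "Suc j"] in auto)
    consider "i < j" | "i = j" | "j < i" by linarith
    then show ?thesis
    proof cases
      case 1 then show ?thesis using lt[of i j] that by simp
    next
      case 2 then show ?thesis using sqD[of i] that by (simp add: power2_eq_square)
    next
      case 3 then show ?thesis using lt[of j i] that by (simp add: mult.commute)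
    qed
  qed
  \<comment> \<open>The norm is not integrated cell by cell: the isometry turns it into a second
    moment, which the orthogonality of the increments evaluates.\<close>
  have var: "(\<integral>s. (simple_fun xs s)\<^sup>2 \<partial>lebesgue_upto S) = (\<Sum>i<n. (d i)\<^sup>2 * (p (Suc i) - p i))"
  proof -
    have "(\<integral>s. (simple_fun xs s)\<^sup>2 \<partial>lebesgue_upto S) = expectation (\<lambda>\<omega>. simple_int B xs \<omega> * simple_int B xs \<omega>)"
      using simple_isometry[of xs S xs] assms by (simp add: power2_eq_square)
    also have "\<dots> = expectation (\<lambda>\<omega>. \<Sum>i<n. \<Sum>j<n. (d i * d j) * (D i \<omega> * D j \<omega>))"
      unfolding eq by (intro Bochner_Integration.integral_cong) (auto simp: D_def d_def sum_product algebra_simps)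
    also have "\<dots> = (\<Sum>i<n. \<Sum>j<n. (d i * d j) * expectation (\<lambda>\<omega>. D i \<omega> * D j \<omega>))"
    proof -
      have int: "integrable M (\<lambda>\<omega>. d i * d j * (D i \<omega> * D j \<omega>))" if "i < n" "j < n" for i j
        using integrable_square_integrable_mult[OF sqD(1)[OF that(1)] sqD(1)[OF that(2)]] by simp
      have "expectation (\<lambda>\<omega>. \<Sum>j<n. (d i * d j) * (D i \<omega> * D j \<omega>)) =
          (\<Sum>j<n. (d i * d j) * expectation (\<lambda>\<omega>. D i \<omega> * D j \<omega>))" if "i < n" for i
        using int[OF that] by (subst Bochner_Integration.integral_sum) auto
      then show ?thesis
        using int by (subst Bochner_Integration.integral_sum) (auto intro!: Bochner_Integration.integrable_sum)
    qed
    also have "\<dots> = (\<Sum>i<n. \<Sum>j<n. if j = i then (d i)\<^sup>2 * (p (Suc i) - p i) else 0)"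
      by (intro sum.cong refl) (auto simp: DD power2_eq_square)
    finally show ?thesis by (simp add: sum.delta)
  qed
  have "indep_vars (\<lambda>_. borel) D {..<n}"
    unfolding D_def[abs_def] using wiener_increments_indep[of p n] p by simp
  then have ind: "indep_vars (\<lambda>_. borel) (\<lambda>i \<omega>. d i * D i \<omega>) {..<n}"
    by (rule indep_vars_compose2) auto
  then have meas: "(\<lambda>\<omega>. d i * D i \<omega>) \<in> borel_measurable M" if "i < n" for i
    using that by (auto simp: indep_vars_def2)
  have "(CLINT \<omega>|M. iexp (u * simple_int B xs \<omega>)) = char (distr M borel (\<lambda>\<omega>. \<Sum>i<n. d i * D i \<omega>)) u"
    unfolding char_def using meas
    by (subst integral_distr) (auto simp: eq d_def D_def intro!: borel_measurable_sum)
  also have "\<dots> = (\<Prod>i<n. char (distr M borel (\<lambda>\<omega>. d i * D i \<omega>)) u)"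
    by (rule char_distr_sum[OF ind])
  also have "\<dots> = (\<Prod>i<n. of_real (exp (- (u\<^sup>2 * ((d i)\<^sup>2 * (p (Suc i) - p i))) / 2)))"
  proof (intro prod.cong refl)
    fix i assume "i \<in> {..<n}"
    then have i: "i < n" by simp
    have "char (distr M borel (\<lambda>\<omega>. d i * D i \<omega>)) u = (CLINT \<omega>|M. iexp ((u * d i) * D i \<omega>))"
      unfolding char_def using meas[OF i] by (subst integral_distr) (auto simp: mult.assoc)
    also have "\<dots> = of_real (exp (- ((u * d i)\<^sup>2 * (sqrt (p (Suc i) - p i))\<^sup>2) / 2))"
      using less[of i "Suc i"] i by (intro iexp_normal norm) auto
    finally show "char (distr M borel (\<lambda>\<omega>. d i * D i \<omega>)) u =
        of_real (exp (- (u\<^sup>2 * ((d i)\<^sup>2 * (p (Suc i) - p i))) / 2))"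
      using less[of i "Suc i"] i by (simp add: power_mult_distrib mult.assoc)
  qed
  also have "\<dots> = of_real (exp (\<Sum>i<n. - (u\<^sup>2 * ((d i)\<^sup>2 * (p (Suc i) - p i))) / 2))"
    by (simp add: exp_sum)
  also have "(\<Sum>i<n. - (u\<^sup>2 * ((d i)\<^sup>2 * (p (Suc i) - p i))) / 2) =
      - (u\<^sup>2 * (\<integral>s. (simple_fun xs s)\<^sup>2 \<partial>lebesgue_upto S)) / 2"
    unfolding var by (simp add: sum_distrib_left sum_negf sum_divide_distrib)
  finally show ?thesis .
qed

end

section \<open>Independence from characteristic functions\<close>

context prob_space
begin

lemma integrable_bounded_complex:
  fixes Z :: "'a \<Rightarrow> complex"
  assumes "Z \<in> borel_measurable M" "\<And>\<omega>. cmod (Z \<omega>) \<le> C"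
  shows "integrable M Z"
  using assms by (intro integrable_const_bound[where B = C]) auto

text \<open>Reweighting \<open>M\<close> by the positive density proportional to \<open>Z + C + 1\<close> leaves the characteristic
  function of \<open>Y\<close>, hence by Levy's theorem its law, unchanged.\<close>

lemma indicator_expectation_factor_real:
  fixes Z :: "'a \<Rightarrow> real"
  assumes [measurable]: "Y \<in> borel_measurable M" "Z \<in> borel_measurable M" "A \<in> sets borel"
    and bound: "\<And>\<omega>. \<bar>Z \<omega>\<bar> \<le> C"
    and factor: "\<And>u. (CLINT \<omega>|M. iexp (u * Y \<omega>) * of_real (Z \<omega>)) = (CLINT \<omega>|M. iexp (u * Y \<omega>)) * of_real (expectation Z)"
  shows "expectation (\<lambda>\<omega>. indicat_real A (Y \<omega>) * Z \<omega>) = expectation (\<lambda>\<omega>. indicat_real A (Y \<omega>)) * expectation Z"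
proof -
  define W where "W \<omega> = Z \<omega> + C + 1" for \<omega>
  have [measurable]: "W \<in> borel_measurable M" unfolding W_def[abs_def] by measurable
  have W_ge: "1 \<le> W \<omega>" for \<omega> using bound[of \<omega>] by (simp add: W_def)
  have W_le: "\<bar>W \<omega>\<bar> \<le> 2 * C + 1" for \<omega> using bound[of \<omega>] by (simp add: W_def)
  have intZ: "integrable M Z" using bound by (intro integrable_const_bound[where B = C]) auto
  have intW: "integrable M W" using W_le by (intro integrable_const_bound[where B = "2 * C + 1"]) auto
  define w where "w = expectation W"
  have w_eq: "w = expectation Z + C + 1"
    using intZ by (simp add: w_def W_def[abs_def] prob_space)
  have "expectation (\<lambda>_. 1) \<le> w"
    unfolding w_def using intW W_ge by (intro integral_mono) auto
  then have w: "0 < w" by (simp add: prob_space)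
  define Q where "Q = density M (\<lambda>\<omega>. W \<omega> / w)"
  have W_nonneg: "0 \<le> W \<omega> / w" for \<omega> using W_ge[of \<omega>] w by simp
  have [measurable_cong]: "sets Q = sets M" by (simp add: Q_def)
  interpret Q: prob_space Q
  proof
    have "emeasure Q (space Q) = (\<integral>\<^sup>+\<omega>. ennreal (W \<omega> / w) \<partial>M)"
      unfolding Q_def by (simp add: emeasure_density cong: nn_integral_cong)
    also have "\<dots> = ennreal (expectation (\<lambda>\<omega>. W \<omega> / w))"
      using intW W_nonneg by (intro nn_integral_eq_integral) auto
    finally show "emeasure Q (space Q) = 1" using w by (simp add: w_def)
  qed
  have [measurable]: "Y \<in> borel_measurable Q" by simp
  have char_eq: "char (distr Q borel Y) = char (distr M borel Y)"
  proof
    fix u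
    have int: "integrable M (\<lambda>\<omega>. iexp (u * Y \<omega>))"
      by (rule integrable_bounded_complex[where C = 1]) auto
    have int': "integrable M (\<lambda>\<omega>. iexp (u * Y \<omega>) * of_real (Z \<omega>))"
      by (rule integrable_bounded_complex[where C = C]) (use bound in \<open>auto simp: norm_mult\<close>)
    have "char (distr Q borel Y) u = (CLINT \<omega>|M. (W \<omega> / w) *\<^sub>R iexp (u * Y \<omega>))"
      unfolding char_def Q_def using W_nonneg by (simp add: integral_distr integral_density)
    also have "\<dots> = (CLINT \<omega>|M. (iexp (u * Y \<omega>) * of_real (Z \<omega>) + of_real (C + 1) * iexp (u * Y \<omega>)) / of_real w)"
      using w by (intro Bochner_Integration.integral_cong) (auto simp: scaleR_conv_of_real W_def field_simps)
    also have "\<dots> = ((CLINT \<omega>|M. iexp (u * Y \<omega>)) * of_real (expectation Z) + of_real (C + 1) * (CLINT \<omega>|M. iexp (u * Y \<omega>))) / of_real w"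
      using int int' factor[of u] by simp
    also have "\<dots> = (CLINT \<omega>|M. iexp (u * Y \<omega>)) * of_real w / of_real w"
      unfolding w_eq by (simp add: algebra_simps)
    also have "\<dots> = char (distr M borel Y) u"
      unfolding char_def using w by (simp add: integral_distr)
    finally show "char (distr Q borel Y) u = char (distr M borel Y) u" .
  qed
  have "real_distribution (distr Q borel Y)" "real_distribution (distr M borel Y)"
    using Q.prob_space_distr[of Y borel] prob_space_distr[of Y borel]
    by (auto simp: real_distribution_def real_distribution_axioms_def)
  then have eq: "distr Q borel Y = distr M borel Y"
    using char_eq by (rule Levy_uniqueness)
  \<comment> \<open>Equality of the two laws is tested on \<open>A\<close>. In the resulting
    identity the contributions of the shift \<open>C + 1\<close> cancel and the factorisation for
    \<open>Z\<close> remains.\<close>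
  have "expectation (\<lambda>\<omega>. indicat_real A (Y \<omega>)) = (\<integral>y. indicat_real A y \<partial>distr M borel Y)"
    by (subst integral_distr) auto
  also have "\<dots> = (\<integral>\<omega>. indicat_real A (Y \<omega>) \<partial>Q)"
    unfolding eq[symmetric] by (subst integral_distr) auto
  also have "\<dots> = expectation (\<lambda>\<omega>. (W \<omega> / w) *\<^sub>R indicat_real A (Y \<omega>))"
    unfolding Q_def using W_nonneg by (subst integral_density) auto
  also have "\<dots> = expectation (\<lambda>\<omega>. (indicat_real A (Y \<omega>) * Z \<omega> + (C + 1) * indicat_real A (Y \<omega>)) / w)"
    by (intro Bochner_Integration.integral_cong) (auto simp: W_def algebra_simps)
  also have "\<dots> = (expectation (\<lambda>\<omega>. indicat_real A (Y \<omega>) * Z \<omega>) + (C + 1) * expectation (\<lambda>\<omega>. indicat_real A (Y \<omega>))) / w"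
  proof -
    have "integrable M (\<lambda>\<omega>. indicat_real A (Y \<omega>) * Z \<omega>)"
      by (rule integrable_const_bound[where B = C])
        (use bound order_trans[OF abs_ge_zero bound] in \<open>auto simp: indicator_def\<close>)
    moreover have "integrable M (\<lambda>\<omega>. indicat_real A (Y \<omega>))"
      by (rule integrable_const_bound[where B = 1]) (auto simp: indicator_def)
    ultimately show ?thesis by simp
  qed
  finally show ?thesis using w by (simp add: w_eq field_simps)
qed

text \<open>The real case is applied to real and imaginary part. These are combinations of
  \<open>Z\<close> and its conjugate, which is why the factorisation is assumed for both.\<close>

lemma indicator_expectation_factor:
  fixes Z :: "'a \<Rightarrow> complex"
  assumes [measurable]: "Y \<in> borel_measurable M" "Z \<in> borel_measurable M" "A \<in> sets borel"
    and bound: "\<And>\<omega>. cmod (Z \<omega>) \<le> 1"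
    and factor: "\<And>u. (CLINT \<omega>|M. iexp (u * Y \<omega>) * Z \<omega>) = (CLINT \<omega>|M. iexp (u * Y \<omega>)) * (CLINT \<omega>|M. Z \<omega>)"
    and factor_cnj: "\<And>u. (CLINT \<omega>|M. iexp (u * Y \<omega>) * cnj (Z \<omega>)) = (CLINT \<omega>|M. iexp (u * Y \<omega>)) * (CLINT \<omega>|M. cnj (Z \<omega>))"
  shows "(CLINT \<omega>|M. of_real (indicator A (Y \<omega>)) * Z \<omega>) = of_real (expectation (\<lambda>\<omega>. indicator A (Y \<omega>))) * (CLINT \<omega>|M. Z \<omega>)"
proof -
  have Re_le: "\<bar>Re (Z \<omega>)\<bar> \<le> 1" "\<bar>Im (Z \<omega>)\<bar> \<le> 1" for \<omega>
    using bound[of \<omega>] abs_Re_le_cmod[of "Z \<omega>"] abs_Im_le_cmod[of "Z \<omega>"] by linarith+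
  have Im_eq: "complex_of_real (Im z) = (z - cnj z) / (2 * \<i>)" for z
    by (simp add: complex_diff_cnj field_simps)
  have [measurable]: "(\<lambda>\<omega>. cnj (Z \<omega>)) \<in> borel_measurable M"
    by (intro borel_measurable_continuous_on[of cnj] continuous_intros) auto
  have intZ: "integrable M Z" "integrable M (\<lambda>\<omega>. cnj (Z \<omega>))"
    using bound by (auto intro!: integrable_bounded_complex)
  have inti: "integrable M (\<lambda>\<omega>. iexp (u * Y \<omega>) * Z \<omega>)" "integrable M (\<lambda>\<omega>. iexp (u * Y \<omega>) * cnj (Z \<omega>))" for u
    using bound by (auto intro!: integrable_bounded_complex[where C = 1] simp: norm_mult)
  have "expectation (\<lambda>\<omega>. indicator A (Y \<omega>) * Re (Z \<omega>)) = expectation (\<lambda>\<omega>. indicator A (Y \<omega>)) * expectation (\<lambda>\<omega>. Re (Z \<omega>))"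
  proof (rule indicator_expectation_factor_real[where C = 1])
    fix u
    have "(CLINT \<omega>|M. iexp (u * Y \<omega>) * of_real (Re (Z \<omega>))) =
        (CLINT \<omega>|M. (iexp (u * Y \<omega>) * Z \<omega> + iexp (u * Y \<omega>) * cnj (Z \<omega>)) / 2)"
      by (intro Bochner_Integration.integral_cong) (auto simp: complex_add_cnj distrib_left[symmetric])
    also have "\<dots> = (CLINT \<omega>|M. iexp (u * Y \<omega>)) * (CLINT \<omega>|M. (Z \<omega> + cnj (Z \<omega>)) / 2)"
      using inti[of u] intZ factor[of u] factor_cnj[of u] by (simp add: distrib_left)
    also have "(CLINT \<omega>|M. (Z \<omega> + cnj (Z \<omega>)) / 2) = of_real (expectation (\<lambda>\<omega>. Re (Z \<omega>)))"
      by (subst integral_complex_of_real[symmetric]) (intro Bochner_Integration.integral_cong, auto simp: complex_add_cnj)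
    finally show "(CLINT \<omega>|M. iexp (u * Y \<omega>) * of_real (Re (Z \<omega>))) =
      (CLINT \<omega>|M. iexp (u * Y \<omega>)) * of_real (expectation (\<lambda>\<omega>. Re (Z \<omega>)))" .
  qed (auto intro: Re_le)
  moreover have "expectation (\<lambda>\<omega>. indicator A (Y \<omega>) * Im (Z \<omega>)) = expectation (\<lambda>\<omega>. indicator A (Y \<omega>)) * expectation (\<lambda>\<omega>. Im (Z \<omega>))"
  proof (rule indicator_expectation_factor_real[where C = 1])
    fix u
    have "(CLINT \<omega>|M. iexp (u * Y \<omega>) * of_real (Im (Z \<omega>))) =
        (CLINT \<omega>|M. (iexp (u * Y \<omega>) * Z \<omega> - iexp (u * Y \<omega>) * cnj (Z \<omega>)) / (2 * \<i>))"
      by (intro Bochner_Integration.integral_cong refl) (simp only: Im_eq times_divide_eq_right right_diff_distrib)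
    also have "\<dots> = (CLINT \<omega>|M. iexp (u * Y \<omega>)) * (CLINT \<omega>|M. (Z \<omega> - cnj (Z \<omega>)) / (2 * \<i>))"
      using inti[of u] intZ factor[of u] factor_cnj[of u] by (simp add: right_diff_distrib)
    also have "(CLINT \<omega>|M. (Z \<omega> - cnj (Z \<omega>)) / (2 * \<i>)) = of_real (expectation (\<lambda>\<omega>. Im (Z \<omega>)))"
      by (subst integral_complex_of_real[symmetric]) (intro Bochner_Integration.integral_cong refl, simp only: Im_eq)
    finally show "(CLINT \<omega>|M. iexp (u * Y \<omega>) * of_real (Im (Z \<omega>))) =
      (CLINT \<omega>|M. iexp (u * Y \<omega>)) * of_real (expectation (\<lambda>\<omega>. Im (Z \<omega>)))" .
  qed (auto intro: Re_le)
  moreover have int: "integrable M (\<lambda>\<omega>. of_real (indicator A (Y \<omega>)) * Z \<omega>)"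
    using bound by (auto intro!: integrable_bounded_complex[where C = 1] simp: norm_mult indicator_def)
  ultimately show ?thesis
    using intZ by (auto simp: complex_eq_iff integral_Re[symmetric] integral_Im[symmetric] simp del: integral_Re integral_Im)
qed

text \<open>Levy's uniqueness theorem is only available for one-dimensional laws, so the exponentials are
  exchanged for indicators one coordinate at a time.\<close>

lemma indep_vars_from_iexp:
  fixes \<xi> :: "'i \<Rightarrow> 'a \<Rightarrow> real"
  assumes meas: "\<And>i. i \<in> I \<Longrightarrow> \<xi> i \<in> borel_measurable M"
    and factor: "\<And>J u. finite J \<Longrightarrow> J \<subseteq> I \<Longrightarrow>
      (CLINT \<omega>|M. iexp (\<Sum>j\<in>J. u j * \<xi> j \<omega>)) = (\<Prod>j\<in>J. CLINT \<omega>|M. iexp (u j * \<xi> j \<omega>))"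
  shows "indep_vars (\<lambda>_. borel) \<xi> I"
proof -
  \<comment> \<open>The hybrid of hypothesis and conclusion: indicators on \<open>J\<close>,
    exponentials still on \<open>K\<close>. The induction on \<open>J\<close> keeps \<open>K\<close>
    and \<open>u\<close> arbitrary, because an index is on loan to \<open>K\<close> while it is
    being converted.\<close>
  have mixed: "(CLINT \<omega>|M. of_real (\<Prod>j\<in>J. indicator (A j) (\<xi> j \<omega>)) * iexp (\<Sum>k\<in>K. u k * \<xi> k \<omega>)) =
      of_real (\<Prod>j\<in>J. expectation (\<lambda>\<omega>. indicator (A j) (\<xi> j \<omega>))) * (\<Prod>k\<in>K. CLINT \<omega>|M. iexp (u k * \<xi> k \<omega>))"
    if "finite J" "J \<subseteq> I" "finite K" "K \<subseteq> I" "J \<inter> K = {}" "\<And>j. j \<in> J \<Longrightarrow> A j \<in> sets borel" for J K A u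
    using that
  proof (induction J arbitrary: K u rule: finite_induct)
    case empty
    then show ?case using factor[of K u] by simp
  next
    case (insert i J)
    have [measurable]: "\<xi> i \<in> borel_measurable M" "A i \<in> sets borel"
      using insert.prems meas by auto
    have measJK: "\<xi> j \<in> borel_measurable M" if "j \<in> J \<union> K" for j
      using insert.prems meas that by auto
    define Z where "Z u \<omega> = complex_of_real (\<Prod>j\<in>J. indicator (A j) (\<xi> j \<omega>)) * iexp (\<Sum>k\<in>K. u k * \<xi> k \<omega>)" for u \<omega>
    have IH: "(CLINT \<omega>|M. Z u \<omega>) = of_real (\<Prod>j\<in>J. expectation (\<lambda>\<omega>. indicator (A j) (\<xi> j \<omega>))) * (\<Prod>k\<in>K. CLINT \<omega>|M. iexp (u k * \<xi> k \<omega>))" for u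
      unfolding Z_def using insert by (intro insert.IH) auto
    have Zmeas: "Z u \<in> borel_measurable M" for u
    proof -
      have "(\<lambda>\<omega>. indicat_real (A j) (\<xi> j \<omega>)) \<in> borel_measurable M" if "j \<in> J" for j
        by (rule measurable_compose[OF measJK borel_measurable_indicator]) (use insert.prems that in auto)
      then have "(\<lambda>\<omega>. \<Prod>j\<in>J. indicat_real (A j) (\<xi> j \<omega>)) \<in> borel_measurable M"
        by (rule borel_measurable_prod)
      moreover have "(\<lambda>\<omega>. \<Sum>k\<in>K. u k * \<xi> k \<omega>) \<in> borel_measurable M"
        using measJK by (intro borel_measurable_sum borel_measurable_times) auto
      ultimately show ?thesis unfolding Z_def[abs_def] by measurable
    qed
    have Zb: "cmod (Z u \<omega>) \<le> 1" for u \<omega>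
    proof -
      have "\<bar>\<Prod>j\<in>J. indicat_real (A j) (\<xi> j \<omega>)\<bar> \<le> 1"
        unfolding abs_prod by (intro prod_le_1) (auto simp: indicator_def)
      then show ?thesis by (simp only: Z_def norm_mult norm_of_real norm_exp_i_times mult_1_right)
    qed
    \<comment> \<open>The test exponential in \<open>\<xi> i\<close> joins those over
      \<open>K\<close>; the induction hypothesis for \<open>insert i K\<close> then splits it off
      again.\<close>
    have Zf: "(CLINT \<omega>|M. iexp (v * \<xi> i \<omega>) * Z u \<omega>) = (CLINT \<omega>|M. iexp (v * \<xi> i \<omega>)) * (CLINT \<omega>|M. Z u \<omega>)" for u v
    proof -
      define u' where "u' = u(i := v)"
      have iK: "i \<notin> K" using insert.prems by auto
      have "iexp (v * \<xi> i \<omega>) * Z u \<omega> =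
        of_real (\<Prod>j\<in>J. indicator (A j) (\<xi> j \<omega>)) * iexp (\<Sum>k\<in>insert i K. u' k * \<xi> k \<omega>)" for \<omega>
      proof -
        have "(\<Sum>k\<in>insert i K. u' k * \<xi> k \<omega>) = v * \<xi> i \<omega> + (\<Sum>k\<in>K. u k * \<xi> k \<omega>)"
          using iK insert.prems by (auto simp: u'_def intro!: sum.cong)
        then show ?thesis by (simp add: Z_def distrib_left exp_add)
      qed
      then have "(CLINT \<omega>|M. iexp (v * \<xi> i \<omega>) * Z u \<omega>) =
        of_real (\<Prod>j\<in>J. expectation (\<lambda>\<omega>. indicator (A j) (\<xi> j \<omega>))) * (\<Prod>k\<in>insert i K. CLINT \<omega>|M. iexp (u' k * \<xi> k \<omega>))"
        using insert.hyps insert.prems iK by (simp only:) (intro insert.IH, auto)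
      also have "(\<Prod>k\<in>insert i K. CLINT \<omega>|M. iexp (u' k * \<xi> k \<omega>)) =
        (CLINT \<omega>|M. iexp (v * \<xi> i \<omega>)) * (\<Prod>k\<in>K. CLINT \<omega>|M. iexp (u k * \<xi> k \<omega>))"
        using iK insert.prems by (auto simp: u'_def intro!: prod.cong)
      finally show ?thesis by (simp add: IH mult_ac)
    qed
    \<comment> \<open>Conjugation only flips the sign of \<open>u\<close>, so the conjugate
      factorisation is another instance of \<open>Zf\<close>.\<close>
    have cnjZ: "cnj (Z u \<omega>) = Z (\<lambda>k. - u k) \<omega>" for u \<omega>
      by (simp add: Z_def exp_cnj sum_negf)
    have eq: "of_real (\<Prod>j\<in>insert i J. indicator (A j) (\<xi> j \<omega>)) * iexp (\<Sum>k\<in>K. u k * \<xi> k \<omega>) =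
        of_real (indicator (A i) (\<xi> i \<omega>)) * Z u \<omega>" for \<omega>
      using insert.hyps by (simp add: Z_def mult.assoc)
    have "(CLINT \<omega>|M. of_real (\<Prod>j\<in>insert i J. indicator (A j) (\<xi> j \<omega>)) * iexp (\<Sum>k\<in>K. u k * \<xi> k \<omega>)) =
        (CLINT \<omega>|M. of_real (indicator (A i) (\<xi> i \<omega>)) * Z u \<omega>)"
      by (simp only: eq)
    also have "\<dots> = of_real (expectation (\<lambda>\<omega>. indicator (A i) (\<xi> i \<omega>))) * (CLINT \<omega>|M. Z u \<omega>)"
      by (rule indicator_expectation_factor) (auto simp: Zmeas Zb Zf cnjZ simp del: of_real_mult)
    also have "\<dots> = of_real (\<Prod>j\<in>insert i J. expectation (\<lambda>\<omega>. indicator (A j) (\<xi> j \<omega>))) *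
        (\<Prod>k\<in>K. CLINT \<omega>|M. iexp (u k * \<xi> k \<omega>))"
      by (simp only: IH prod.insert[OF insert.hyps(1,2)] of_real_mult mult.assoc)
    finally show ?case .
  qed
  show ?thesis
    unfolding indep_vars_def2
  proof (intro conjI ballI)
    show "indep_sets (\<lambda>i. {\<xi> i -` A \<inter> space M |A. A \<in> sets borel}) I"
    proof (rule indep_setsI)
      fix J E assume J: "J \<noteq> {}" "J \<subseteq> I" "finite J" and E: "\<forall>j\<in>J. E j \<in> {\<xi> j -` A \<inter> space M |A. A \<in> sets borel}"
      then have "\<forall>j\<in>J. \<exists>A. A \<in> sets borel \<and> E j = \<xi> j -` A \<inter> space M" by auto
      then obtain A where A: "\<And>j. j \<in> J \<Longrightarrow> A j \<in> sets borel" "\<And>j. j \<in> J \<Longrightarrow> E j = \<xi> j -` A j \<inter> space M"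
        by metis
      have ev: "E j \<in> events" if "j \<in> J" for j
        using A[OF that] meas[of j] J that by (auto intro: measurable_sets)
      have one: "expectation (\<lambda>\<omega>. indicat_real (A j) (\<xi> j \<omega>)) = prob (E j)" if "j \<in> J" for j
      proof -
        have "expectation (\<lambda>\<omega>. indicat_real (A j) (\<xi> j \<omega>)) = expectation (indicator (E j))"
          using A[OF that] by (intro Bochner_Integration.integral_cong) (auto simp: indicator_def)
        then show ?thesis using ev[OF that] by simp
      qed
      have "expectation (\<lambda>\<omega>. \<Prod>j\<in>J. indicat_real (A j) (\<xi> j \<omega>)) = expectation (indicator (\<Inter>j\<in>J. E j))"
      proof (intro Bochner_Integration.integral_cong refl)
        fix \<omega> assume \<omega>: "\<omega> \<in> space M"
        show "(\<Prod>j\<in>J. indicat_real (A j) (\<xi> j \<omega>)) = indicator (\<Inter>j\<in>J. E j) \<omega>"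
        proof (cases "\<forall>j\<in>J. \<xi> j \<omega> \<in> A j")
          case True
          then show ?thesis using A(2) \<omega> by (auto simp: indicator_def)
        next
          case False
          then obtain j where j: "j \<in> J" "\<xi> j \<omega> \<notin> A j" by auto
          then have "(\<Prod>j\<in>J. indicat_real (A j) (\<xi> j \<omega>)) = 0"
            using J by (auto intro!: prod_zero simp: indicator_def)
          moreover have "\<omega> \<notin> (\<Inter>j\<in>J. E j)" using j A(2) by auto
          ultimately show ?thesis by simp
        qed
      qed
      also have "\<dots> = prob (\<Inter>j\<in>J. E j)"
        using ev J by (simp add: sets.finite_INT)
      finally have "prob (\<Inter>j\<in>J. E j) = expectation (\<lambda>\<omega>. \<Prod>j\<in>J. indicat_real (A j) (\<xi> j \<omega>))" by simp
      \<comment> \<open>All exponentials have been converted: \<open>K\<close> is empty and its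
        product is 1.\<close>
      moreover have "complex_of_real (expectation (\<lambda>\<omega>. \<Prod>j\<in>J. indicat_real (A j) (\<xi> j \<omega>))) =
          of_real (\<Prod>j\<in>J. expectation (\<lambda>\<omega>. indicator (A j) (\<xi> j \<omega>)))"
        using mixed[of J "{}" A "\<lambda>_. 0"] J A(1) by (simp add: prob_space del: of_real_prod)
      ultimately show "prob (\<Inter>j\<in>J. E j) = (\<Prod>j\<in>J. prob (E j))"
        using one by (simp only: of_real_eq_iff) simp
    qed (use meas in \<open>auto intro: measurable_sets\<close>)
  qed (use meas in auto)
qed

end

section \<open>Wiener integrals of square integrable functions\<close>

text \<open>A variant of \<open>has_wiener_integral\<close> on \<open>[0, S]\<close> whose approximating step functions need
  no ordered partition, which makes the relation visibly linear.\<close>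

definition wiener_integral_upto ::
    "'a measure \<Rightarrow> (real \<Rightarrow> 'a \<Rightarrow> real) \<Rightarrow> real \<Rightarrow> (real \<Rightarrow> real) \<Rightarrow> ('a \<Rightarrow> real) \<Rightarrow> bool" where
  "wiener_integral_upto M B S g I \<longleftrightarrow>
     square_integrable (lebesgue_upto S) g \<and> square_integrable M I \<and>
     (\<exists>xs. (\<forall>j. \<forall>x\<in>set (xs j). 0 \<le> snd x \<and> snd x \<le> S) \<and>
        (\<lambda>j. \<integral>s. (g s - simple_fun (xs j) s)\<^sup>2 \<partial>lebesgue_upto S) \<longlonglongrightarrow> 0 \<and>
        (\<lambda>j. \<integral>\<omega>. (I \<omega> - simple_int B (xs j) \<omega>)\<^sup>2 \<partial>M) \<longlonglongrightarrow> 0)"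

lemma wiener_integral_upto_square_integrable:
  assumes "wiener_integral_upto M B S g I"
  shows "square_integrable (lebesgue_upto S) g" "square_integrable M I"
  using assms by (auto simp: wiener_integral_upto_def)

lemma wiener_integral_upto_zero: "wiener_integral_upto M B S (\<lambda>_. 0) (\<lambda>_. 0)"
  unfolding wiener_integral_upto_def
  by (intro conjI square_integrable_zero exI[of _ "\<lambda>_. []"]) auto

lemma wiener_integral_upto_scale:
  assumes "wiener_integral_upto M B S g I"
  shows "wiener_integral_upto M B S (\<lambda>s. a * g s) (\<lambda>\<omega>. a * I \<omega>)"
proof -
  obtain xs where xs: "\<forall>j. \<forall>x\<in>set (xs j). 0 \<le> snd x \<and> snd x \<le> S"
    "(\<lambda>j. \<integral>s. (g s - simple_fun (xs j) s)\<^sup>2 \<partial>lebesgue_upto S) \<longlonglongrightarrow> 0"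
    "(\<lambda>j. \<integral>\<omega>. (I \<omega> - simple_int B (xs j) \<omega>)\<^sup>2 \<partial>M) \<longlonglongrightarrow> 0"
    using assms by (auto simp: wiener_integral_upto_def)
  have sq: "(a * x - a * y)\<^sup>2 = a\<^sup>2 * (x - y)\<^sup>2" for x y :: real
    by (simp add: power_mult_distrib right_diff_distrib[symmetric])
  define ys where "ys j = map (\<lambda>(c, v). (a * c, v)) (xs j)" for j
  have "(\<lambda>j. a\<^sup>2 * (\<integral>s. (g s - simple_fun (xs j) s)\<^sup>2 \<partial>lebesgue_upto S)) \<longlonglongrightarrow> a\<^sup>2 * 0"
    by (intro tendsto_intros xs)
  then have 1: "(\<lambda>j. \<integral>s. (a * g s - simple_fun (ys j) s)\<^sup>2 \<partial>lebesgue_upto S) \<longlonglongrightarrow> 0"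
    by (simp add: ys_def simple_fun_scale sq)
  have "(\<lambda>j. a\<^sup>2 * (\<integral>\<omega>. (I \<omega> - simple_int B (xs j) \<omega>)\<^sup>2 \<partial>M)) \<longlonglongrightarrow> a\<^sup>2 * 0"
    by (intro tendsto_intros xs)
  then have 2: "(\<lambda>j. \<integral>\<omega>. (a * I \<omega> - simple_int B (ys j) \<omega>)\<^sup>2 \<partial>M) \<longlonglongrightarrow> 0"
    by (simp add: ys_def simple_int_scale sq)
  have 3: "\<forall>j. \<forall>x\<in>set (ys j). 0 \<le> snd x \<and> snd x \<le> S"
    using xs(1) by (force simp: ys_def)
  show ?thesis
    unfolding wiener_integral_upto_def
    using wiener_integral_upto_square_integrable[OF assms] 1 2 3
    by (auto intro!: square_integrable_cmult)
qed

lemma iexp_diff_le: "cmod (iexp x - iexp y) \<le> \<bar>x - y\<bar>"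
proof -
  have "iexp x - iexp y = iexp y * (iexp (x - y) - 1)"
    by (simp add: right_diff_distrib exp_add[symmetric])
  then have "cmod (iexp x - iexp y) = cmod (iexp (x - y) - 1)"
    by (simp add: norm_mult)
  then show ?thesis using iexp_approx1[of "x - y" 0] by simp
qed

context wiener_process
begin

text \<open>The approximating lists are concatenated; this is the gain from dropping ordered
  partitions.\<close>

lemma wiener_integral_upto_add:
  assumes "wiener_integral_upto M B S g I" "wiener_integral_upto M B S h J"
  shows "wiener_integral_upto M B S (\<lambda>s. g s + h s) (\<lambda>\<omega>. I \<omega> + J \<omega>)"
proof -
  obtain xs where xs: "\<forall>j. \<forall>x\<in>set (xs j). 0 \<le> snd x \<and> snd x \<le> S"
    "(\<lambda>j. \<integral>s. (g s - simple_fun (xs j) s)\<^sup>2 \<partial>lebesgue_upto S) \<longlonglongrightarrow> 0"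
    "(\<lambda>j. \<integral>\<omega>. (I \<omega> - simple_int B (xs j) \<omega>)\<^sup>2 \<partial>M) \<longlonglongrightarrow> 0"
    using assms by (auto simp: wiener_integral_upto_def)
  obtain ys where ys: "\<forall>j. \<forall>x\<in>set (ys j). 0 \<le> snd x \<and> snd x \<le> S"
    "(\<lambda>j. \<integral>s. (h s - simple_fun (ys j) s)\<^sup>2 \<partial>lebesgue_upto S) \<longlonglongrightarrow> 0"
    "(\<lambda>j. \<integral>\<omega>. (J \<omega> - simple_int B (ys j) \<omega>)\<^sup>2 \<partial>M) \<longlonglongrightarrow> 0"
    using assms by (auto simp: wiener_integral_upto_def)
  note sq = wiener_integral_upto_square_integrable[OF assms(1)] wiener_integral_upto_square_integrable[OF assms(2)]
  have sqx: "square_integrable M (simple_int B (xs j))" for j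
    by (rule square_integrable_simple_int) (use xs(1) in force)
  have sqy: "square_integrable M (simple_int B (ys j))" for j
    by (rule square_integrable_simple_int) (use ys(1) in force)
  have 1: "(\<lambda>j. \<integral>s. ((g s + h s) - simple_fun (xs j @ ys j) s)\<^sup>2 \<partial>lebesgue_upto S) \<longlonglongrightarrow> 0"
    using L2_tendsto_add[OF square_integrable_simple_fun square_integrable_simple_fun sq(1) sq(3) xs(2) ys(2)] by simp
  have 2: "(\<lambda>j. \<integral>\<omega>. ((I \<omega> + J \<omega>) - simple_int B (xs j @ ys j) \<omega>)\<^sup>2 \<partial>M) \<longlonglongrightarrow> 0"
    using L2_tendsto_add[OF sqx sqy sq(2) sq(4) xs(3) ys(3)] by simp
  have 3: "\<forall>j. \<forall>x\<in>set (xs j @ ys j). 0 \<le> snd x \<and> snd x \<le> S"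
    using xs(1) ys(1) by auto
  show ?thesis
    unfolding wiener_integral_upto_def
    by (intro conjI square_integrable_add sq exI[of _ "\<lambda>j. xs j @ ys j"] 1 2 3)
qed

lemma wiener_integral_upto_sum:
  assumes "\<And>i. i \<in> A \<Longrightarrow> wiener_integral_upto M B S (g i) (I i)"
  shows "wiener_integral_upto M B S (\<lambda>s. \<Sum>i\<in>A. u i * g i s) (\<lambda>\<omega>. \<Sum>i\<in>A. u i * I i \<omega>)"
  using assms
  by (induction A rule: infinite_finite_induct)
    (auto intro!: wiener_integral_upto_zero wiener_integral_upto_add wiener_integral_upto_scale)

lemma wiener_integral_upto_covariance:
  assumes "wiener_integral_upto M B S g I" "wiener_integral_upto M B S h J"
  shows "expectation (\<lambda>\<omega>. I \<omega> * J \<omega>) = (\<integral>s. g s * h s \<partial>lebesgue_upto S)"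
proof -
  obtain xs where xs: "\<forall>j. \<forall>x\<in>set (xs j). 0 \<le> snd x \<and> snd x \<le> S"
    "(\<lambda>j. \<integral>s. (g s - simple_fun (xs j) s)\<^sup>2 \<partial>lebesgue_upto S) \<longlonglongrightarrow> 0"
    "(\<lambda>j. \<integral>\<omega>. (I \<omega> - simple_int B (xs j) \<omega>)\<^sup>2 \<partial>M) \<longlonglongrightarrow> 0"
    using assms by (auto simp: wiener_integral_upto_def)
  obtain ys where ys: "\<forall>j. \<forall>x\<in>set (ys j). 0 \<le> snd x \<and> snd x \<le> S"
    "(\<lambda>j. \<integral>s. (h s - simple_fun (ys j) s)\<^sup>2 \<partial>lebesgue_upto S) \<longlonglongrightarrow> 0"
    "(\<lambda>j. \<integral>\<omega>. (J \<omega> - simple_int B (ys j) \<omega>)\<^sup>2 \<partial>M) \<longlonglongrightarrow> 0"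
    using assms by (auto simp: wiener_integral_upto_def)
  note sq = wiener_integral_upto_square_integrable[OF assms(1)] wiener_integral_upto_square_integrable[OF assms(2)]
  have sqx: "square_integrable M (simple_int B (xs j))" for j
    by (rule square_integrable_simple_int) (use xs(1) in force)
  have sqy: "square_integrable M (simple_int B (ys j))" for j
    by (rule square_integrable_simple_int) (use ys(1) in force)
  have "expectation (\<lambda>\<omega>. simple_int B (xs j) \<omega> * simple_int B (ys j) \<omega>) =
      (\<integral>s. simple_fun (xs j) s * simple_fun (ys j) s \<partial>lebesgue_upto S)" for j
    by (rule simple_isometry) (use xs(1) ys(1) in force)+
  moreover have "(\<lambda>j. expectation (\<lambda>\<omega>. simple_int B (xs j) \<omega> * simple_int B (ys j) \<omega>)) \<longlonglongrightarrow> expectation (\<lambda>\<omega>. I \<omega> * J \<omega>)"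
    by (rule L2_tendsto_integral_mult[OF sqx sqy sq(2) sq(4) xs(3) ys(3)])
  moreover have "(\<lambda>j. \<integral>s. simple_fun (xs j) s * simple_fun (ys j) s \<partial>lebesgue_upto S) \<longlonglongrightarrow> (\<integral>s. g s * h s \<partial>lebesgue_upto S)"
    by (rule L2_tendsto_integral_mult[OF square_integrable_simple_fun square_integrable_simple_fun sq(1) sq(3) xs(2) ys(2)])
  ultimately show ?thesis by (simp add: LIMSEQ_unique)
qed

lemma wiener_integral_upto_expectation:
  assumes "wiener_integral_upto M B S g I"
  shows "expectation I = 0"
proof -
  obtain xs where xs: "\<forall>j. \<forall>x\<in>set (xs j). 0 \<le> snd x \<and> snd x \<le> S"
    "(\<lambda>j. \<integral>\<omega>. (I \<omega> - simple_int B (xs j) \<omega>)\<^sup>2 \<partial>M) \<longlonglongrightarrow> 0"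
    using assms by (auto simp: wiener_integral_upto_def)
  have sqx: "square_integrable M (simple_int B (xs j))" for j
    by (rule square_integrable_simple_int) (use xs(1) in force)
  have one: "square_integrable M (\<lambda>_. 1)"
    by (rule square_integrable_bounded[where C = 1]) auto
  have "expectation (simple_int B (xs j)) = 0" for j
    by (rule expectation_simple_int) (use xs(1) in force)
  moreover have "(\<lambda>j. expectation (\<lambda>\<omega>. simple_int B (xs j) \<omega> * 1)) \<longlonglongrightarrow> expectation (\<lambda>\<omega>. I \<omega> * 1)"
    by (rule L2_tendsto_integral_mult[OF sqx one wiener_integral_upto_square_integrable(2)[OF assms] one xs(2)]) simp
  ultimately show ?thesis by (simp add: LIMSEQ_const_iff)
qed

text \<open>Both sides pass to the limit along the approximating step functions: the left one
  because \<open>iexp\<close> is 1-Lipschitz and mean square convergence implies convergence in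
  mean, the right one because the norms of the integrands converge.\<close>

lemma wiener_integral_upto_iexp:
  assumes "wiener_integral_upto M B S g I"
  shows "(CLINT \<omega>|M. iexp (u * I \<omega>)) = exp (- (u\<^sup>2 * (\<integral>s. (g s)\<^sup>2 \<partial>lebesgue_upto S)) / 2)"
proof -
  obtain xs where xs: "\<forall>j. \<forall>x\<in>set (xs j). 0 \<le> snd x \<and> snd x \<le> S"
    "(\<lambda>j. \<integral>s. (g s - simple_fun (xs j) s)\<^sup>2 \<partial>lebesgue_upto S) \<longlonglongrightarrow> 0"
    "(\<lambda>j. \<integral>\<omega>. (I \<omega> - simple_int B (xs j) \<omega>)\<^sup>2 \<partial>M) \<longlonglongrightarrow> 0"
    using assms by (auto simp: wiener_integral_upto_def)
  note sq = wiener_integral_upto_square_integrable[OF assms]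
  have sqx: "square_integrable M (simple_int B (xs j))" for j
    by (rule square_integrable_simple_int) (use xs(1) in force)
  have [measurable]: "I \<in> borel_measurable M" "simple_int B (xs j) \<in> borel_measurable M" for j
    using sq sqx by (auto simp: square_integrable_def)
  have one: "square_integrable M (\<lambda>_. 1)"
    by (rule square_integrable_bounded[where C = 1]) auto
  have bound: "norm ((CLINT \<omega>|M. iexp (u * simple_int B (xs j) \<omega>)) - (CLINT \<omega>|M. iexp (u * I \<omega>))) \<le>
      \<bar>u\<bar> * sqrt (\<integral>\<omega>. (I \<omega> - simple_int B (xs j) \<omega>)\<^sup>2 \<partial>M)" for j
  proof -
    have abs: "square_integrable M (\<lambda>\<omega>. \<bar>I \<omega> - simple_int B (xs j) \<omega>\<bar>)"
      using square_integrable_diff[OF sq(2) sqx[of j]] by (auto simp: square_integrable_def)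
    have "(CLINT \<omega>|M. iexp (u * simple_int B (xs j) \<omega>)) - (CLINT \<omega>|M. iexp (u * I \<omega>)) =
        (CLINT \<omega>|M. iexp (u * simple_int B (xs j) \<omega>) - iexp (u * I \<omega>))"
      by (intro Bochner_Integration.integral_diff[symmetric] integrable_bounded_complex[where C = 1]) auto
    also have "norm \<dots> \<le> (\<integral>\<omega>. norm (iexp (u * simple_int B (xs j) \<omega>) - iexp (u * I \<omega>)) \<partial>M)"
      by (rule integral_norm_bound)
    also have "\<dots> \<le> (\<integral>\<omega>. \<bar>u\<bar> * \<bar>I \<omega> - simple_int B (xs j) \<omega>\<bar> \<partial>M)"
    proof (intro integral_mono)
      show "norm (iexp (u * simple_int B (xs j) \<omega>) - iexp (u * I \<omega>)) \<le> \<bar>u\<bar> * \<bar>I \<omega> - simple_int B (xs j) \<omega>\<bar>" for \<omega>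
      proof -
        have "\<bar>u * simple_int B (xs j) \<omega> - u * I \<omega>\<bar> = \<bar>u\<bar> * \<bar>I \<omega> - simple_int B (xs j) \<omega>\<bar>"
          by (simp only: right_diff_distrib[symmetric] abs_mult abs_minus_commute[of "I \<omega>"])
        then show ?thesis
          using iexp_diff_le[of "u * simple_int B (xs j) \<omega>" "u * I \<omega>"] by simp
      qed
      show "integrable M (\<lambda>\<omega>. norm (iexp (u * simple_int B (xs j) \<omega>) - iexp (u * I \<omega>)))"
        by (intro integrable_norm Bochner_Integration.integrable_diff integrable_bounded_complex[where C = 1]) auto
    qed (use square_integrable_integrable[OF abs] in auto)
    also have "\<dots> = \<bar>u\<bar> * (\<integral>\<omega>. \<bar>I \<omega> - simple_int B (xs j) \<omega>\<bar> * 1 \<partial>M)" by simp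
    also have "\<dots> \<le> \<bar>u\<bar> * sqrt (\<integral>\<omega>. (I \<omega> - simple_int B (xs j) \<omega>)\<^sup>2 \<partial>M)"
      using Cauchy_Schwarz_integral[OF abs one] by (intro mult_left_mono) (auto simp: prob_space)
    finally show ?thesis .
  qed
  have "(\<lambda>j. \<bar>u\<bar> * sqrt (\<integral>\<omega>. (I \<omega> - simple_int B (xs j) \<omega>)\<^sup>2 \<partial>M)) \<longlonglongrightarrow> \<bar>u\<bar> * sqrt 0"
    by (intro tendsto_intros xs)
  then have null: "(\<lambda>j. \<bar>u\<bar> * sqrt (\<integral>\<omega>. (I \<omega> - simple_int B (xs j) \<omega>)\<^sup>2 \<partial>M)) \<longlonglongrightarrow> 0" by simp
  have "(\<lambda>j. (CLINT \<omega>|M. iexp (u * simple_int B (xs j) \<omega>)) - (CLINT \<omega>|M. iexp (u * I \<omega>))) \<longlonglongrightarrow> 0"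
    by (rule Lim_null_comparison[OF always_eventually[OF allI[OF bound]] null])
  then have 1: "(\<lambda>j. CLINT \<omega>|M. iexp (u * simple_int B (xs j) \<omega>)) \<longlonglongrightarrow> (CLINT \<omega>|M. iexp (u * I \<omega>))"
    by (simp add: LIM_zero_iff)
  have "(\<lambda>j. \<integral>s. simple_fun (xs j) s * simple_fun (xs j) s \<partial>lebesgue_upto S) \<longlonglongrightarrow> (\<integral>s. g s * g s \<partial>lebesgue_upto S)"
    by (rule L2_tendsto_integral_mult[OF square_integrable_simple_fun square_integrable_simple_fun sq(1) sq(1) xs(2) xs(2)])
  then have "(\<lambda>j. \<integral>s. (simple_fun (xs j) s)\<^sup>2 \<partial>lebesgue_upto S) \<longlonglongrightarrow> (\<integral>s. (g s)\<^sup>2 \<partial>lebesgue_upto S)"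
    by (simp add: power2_eq_square)
  then have "(\<lambda>j. complex_of_real (exp (- (u\<^sup>2 * (\<integral>s. (simple_fun (xs j) s)\<^sup>2 \<partial>lebesgue_upto S)) / 2))) \<longlonglongrightarrow>
      of_real (exp (- (u\<^sup>2 * (\<integral>s. (g s)\<^sup>2 \<partial>lebesgue_upto S)) / 2))"
    by (intro tendsto_intros) auto
  moreover have "(CLINT \<omega>|M. iexp (u * simple_int B (xs j) \<omega>)) =
      of_real (exp (- (u\<^sup>2 * (\<integral>s. (simple_fun (xs j) s)\<^sup>2 \<partial>lebesgue_upto S)) / 2))" for j
    by (rule iexp_simple_int) (use xs(1) in force)
  ultimately show ?thesis using 1 by (simp only: LIMSEQ_unique)
qed

lemma wiener_integral_upto_std_normal:
  assumes "wiener_integral_upto M B S g I" "(\<integral>s. (g s)\<^sup>2 \<partial>lebesgue_upto S) = 1"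
  shows "distributed M lborel I std_normal_density"
proof -
  have [measurable]: "I \<in> borel_measurable M"
    using wiener_integral_upto_square_integrable[OF assms(1)] by (simp add: square_integrable_def)
  have "char (distr M borel I) = char std_normal_distribution"
    unfolding char_std_normal_distribution
    using wiener_integral_upto_iexp[OF assms(1)] assms(2)
    by (auto simp: fun_eq_iff char_def integral_distr)
  moreover have "real_distribution (distr M borel I)"
    using prob_space_distr[of I borel] by (auto simp: real_distribution_def real_distribution_axioms_def)
  ultimately have "distr M borel I = std_normal_distribution"
    using real_dist_normal_dist by (intro Levy_uniqueness) auto
  moreover have "distr M lborel I = distr M borel I" by (intro distr_cong) auto
  ultimately show ?thesis unfolding distributed_def by auto
qed

text \<open>A linear combination of the integrals is the integral of the combined integrand.
  Orthogonality makes its squared norm additive, so its characteristic function is a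
  product.\<close>

lemma wiener_integral_upto_indep:
  fixes \<xi> :: "'i \<Rightarrow> 'a \<Rightarrow> real"
  assumes W: "\<And>i. i \<in> A \<Longrightarrow> wiener_integral_upto M B S (h i) (\<xi> i)"
    and ortho: "\<And>i j. i \<in> A \<Longrightarrow> j \<in> A \<Longrightarrow> i \<noteq> j \<Longrightarrow> (\<integral>s. h i s * h j s \<partial>lebesgue_upto S) = 0"
  shows "indep_vars (\<lambda>_. borel) \<xi> A"
proof (rule indep_vars_from_iexp)
  show "\<xi> i \<in> borel_measurable M" if "i \<in> A" for i
    using wiener_integral_upto_square_integrable[OF W[OF that]] by (simp add: square_integrable_def)
  fix J and u :: "'i \<Rightarrow> real"
  assume J: "finite J" "J \<subseteq> A"
  have sq: "square_integrable (lebesgue_upto S) (h i)" if "i \<in> J" for i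
    using wiener_integral_upto_square_integrable[OF W, of i] that J by auto
  have WJ: "wiener_integral_upto M B S (\<lambda>s. \<Sum>i\<in>J. u i * h i s) (\<lambda>\<omega>. \<Sum>i\<in>J. u i * \<xi> i \<omega>)"
    using W J by (intro wiener_integral_upto_sum) auto
  have var: "(\<integral>s. (\<Sum>i\<in>J. u i * h i s)\<^sup>2 \<partial>lebesgue_upto S) =
      (\<Sum>i\<in>J. (u i)\<^sup>2 * (\<integral>s. (h i s)\<^sup>2 \<partial>lebesgue_upto S))"
    using J ortho by (intro integral_square_orthogonal_sum sq) auto
  have "(CLINT \<omega>|M. iexp (\<Sum>j\<in>J. u j * \<xi> j \<omega>)) = of_real (exp (- (\<Sum>i\<in>J. (u i)\<^sup>2 * (\<integral>s. (h i s)\<^sup>2 \<partial>lebesgue_upto S)) / 2))"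
    using wiener_integral_upto_iexp[OF WJ, of 1] by (simp add: var)
  also have "\<dots> = (\<Prod>j\<in>J. of_real (exp (- ((u j)\<^sup>2 * (\<integral>s. (h j s)\<^sup>2 \<partial>lebesgue_upto S)) / 2)))"
    using J by (simp add: exp_sum[symmetric] sum_negf[symmetric] sum_divide_distrib del: of_real_exp flip: of_real_prod)
  also have "\<dots> = (\<Prod>j\<in>J. CLINT \<omega>|M. iexp (u j * \<xi> j \<omega>))"
    using W J by (intro prod.cong refl wiener_integral_upto_iexp[symmetric]) auto
  finally show "(CLINT \<omega>|M. iexp (\<Sum>j\<in>J. u j * \<xi> j \<omega>)) = (\<Prod>j\<in>J. CLINT \<omega>|M. iexp (u j * \<xi> j \<omega>))" .
qed

end

text \<open>Translates ordered partitions into lists: each cell \<open>[p i, p (i + 1))\<close> is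
  the difference of two initial intervals.\<close>

definition step_list :: "nat \<Rightarrow> (nat \<Rightarrow> real) \<Rightarrow> (nat \<Rightarrow> real) \<Rightarrow> (real \<times> real) list" where
  "step_list n p c = concat (map (\<lambda>i. [(c i, p (Suc i)), (- c i, p i)]) [0..<n])"

lemma simple_int_step_list: "simple_int B (step_list n p c) \<omega> = step_integral B n p c \<omega>"
  by (induction n) (auto simp: step_list_def step_integral_def algebra_simps)

lemma simple_fun_step_list:
  assumes "\<And>i. i < n \<Longrightarrow> 0 \<le> p i \<and> p i \<le> p (Suc i)"
  shows "simple_fun (step_list n p c) s = step_function n p c s"
proof -
  have "indicat_real {p i..<p (Suc i)} s = indicator {0..<p (Suc i)} s - indicator {0..<p i} s" if "i < n" for i
    using assms[OF that] by (auto simp: indicator_def)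
  then have "step_function n p c s = (\<Sum>i<n. c i * (indicator {0..<p (Suc i)} s - indicator {0..<p i} s))"
    by (simp add: step_function_def)
  also have "\<dots> = simple_fun (step_list n p c) s"
    by (induction n) (auto simp: step_list_def algebra_simps)
  finally show ?thesis ..
qed

lemma step_list_times:
  assumes "\<And>i. i \<le> n \<Longrightarrow> 0 \<le> p i \<and> p i \<le> S"
  shows "\<forall>x\<in>set (step_list n p c). 0 \<le> snd x \<and> snd x \<le> S"
  using assms by (auto simp: step_list_def less_imp_le Suc_leI)

text \<open>Integrals over different \<open>[0, t]\<close> are brought to the common interval
  \<open>[0, S]\<close> by cutting the integrand off after \<open>t\<close>; only then can they be
  paired with each other by the isometry.\<close>

lemma wiener_integral_upto_of_has_wiener_integral:
  assumes W: "has_wiener_integral M B g 0 t I" and t: "0 \<le> t" "t \<le> S"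
  shows "wiener_integral_upto M B S (\<lambda>s. indicator {0..t} s * g s) I"
proof -
  obtain N p c where p: "\<And>j. 0 \<le> p j 0 \<and> mono_on {..N j} (p j) \<and> p j (N j) \<le> t"
    and g: "(\<lambda>j. LBINT s:{0..t}. (g s - step_function (N j) (p j) (c j) s)\<^sup>2) \<longlonglongrightarrow> 0"
    and I: "(\<lambda>j. \<integral>\<omega>. (I \<omega> - step_integral B (N j) (p j) (c j) \<omega>)\<^sup>2 \<partial>M) \<longlonglongrightarrow> 0"
    using W unfolding has_wiener_integral_def by blast
  have pt: "0 \<le> p j i \<and> p j i \<le> t" if "i \<le> N j" for i j
    using p[of j] mono_onD[of "{..N j}" "p j" 0 i] mono_onD[of "{..N j}" "p j" i "N j"] that by force
  have pmono: "0 \<le> p j i \<and> p j i \<le> p j (Suc i)" if "i < N j" for i j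
    using p[of j] pt[of i j] mono_onD[of "{..N j}" "p j" i "Suc i"] that by force
  have sqg: "square_integrable (lebesgue_upto S) (\<lambda>s. indicator {0..t} s * g s)"
    unfolding square_integrable_def
  proof
    have "(\<lambda>s. indicator {0..t} s * g s) \<in> borel_measurable lborel"
      using W by (simp add: has_wiener_integral_def set_borel_measurable_def)
    then show "(\<lambda>s. indicator {0..t} s * g s) \<in> borel_measurable (lebesgue_upto S)"
      by (rule measurable_restrict_space1)
    have "set_integrable lborel {0..t} (\<lambda>s. (g s)\<^sup>2)"
      using W by (simp add: has_wiener_integral_def)
    moreover have "(\<lambda>s. indicator {0..t} s *\<^sub>R (g s)\<^sup>2) = (\<lambda>s. indicator {0..S} s *\<^sub>R (indicator {0..t} s * g s)\<^sup>2)"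
      using t by (auto simp: indicator_def)
    ultimately show "integrable (lebesgue_upto S) (\<lambda>s. (indicator {0..t} s * g s)\<^sup>2)"
      by (simp add: integrable_lebesgue_upto set_integrable_def)
  qed
  have "(\<integral>s. (indicator {0..t} s * g s - simple_fun (step_list (N j) (p j) (c j)) s)\<^sup>2 \<partial>lebesgue_upto S) =
      (LBINT s:{0..t}. (g s - step_function (N j) (p j) (c j) s)\<^sup>2)" for j
  proof -
    \<comment> \<open>All partition points lie in \<open>[0, t]\<close>, so extending the interval
      to \<open>S\<close> adds no approximation error.\<close>
    have "step_function (N j) (p j) (c j) s = 0" if "t < s" for s
      unfolding step_function_def
    proof (intro sum.neutral ballI)
      fix i assume "i \<in> {..<N j}"
      then have "p j (Suc i) \<le> t" using pt[of "Suc i" j] by simp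
      then show "c j i * indicat_real {p j i..<p j (Suc i)} s = 0" using that by (simp add: indicator_def)
    qed
    then have "indicator {0..S} s *\<^sub>R (indicator {0..t} s * g s - step_function (N j) (p j) (c j) s)\<^sup>2 =
        indicator {0..t} s *\<^sub>R (g s - step_function (N j) (p j) (c j) s)\<^sup>2" for s
      using t by (auto simp: indicator_def)
    then show ?thesis
      using simple_fun_step_list[of "N j" "p j" "c j", OF pmono]
      by (simp add: integral_lebesgue_upto set_lebesgue_integral_def)
  qed
  moreover have "\<forall>j. \<forall>x\<in>set (step_list (N j) (p j) (c j)). 0 \<le> snd x \<and> snd x \<le> S"
    using pt t by (intro allI step_list_times) force
  moreover have "square_integrable M I"
    using W by (simp add: has_wiener_integral_def square_integrable_def)
  ultimately show ?thesis
    unfolding wiener_integral_upto_def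
    using g I sqg by (auto simp: simple_int_step_list intro!: exI[of _ "\<lambda>j. step_list (N j) (p j) (c j)"])
qed

section \<open>Existence of the Wiener integral of a continuous function\<close>

lemma step_function_eq:
  assumes "m < n" "s \<in> {p m..<p (Suc m)}" "mono_on {..n} p"
  shows "step_function n p c s = c m"
proof -
  have "step_function n p c s = (\<Sum>i<n. if i = m then c i else 0)"
    unfolding step_function_def
  proof (intro sum.cong refl)
    fix i assume i: "i \<in> {..<n}"
    consider "i < m" | "i = m" | "m < i" by linarith
    then show "c i * indicator {p i..<p (Suc i)} s = (if i = m then c i else 0)"
    proof cases
      case 1
      then have "p (Suc i) \<le> p m" using assms i by (intro mono_onD[OF assms(3)]) auto
      then show ?thesis using 1 assms by (auto simp: indicator_def)
    next
      case 3
      then have "p (Suc m) \<le> p i" using assms i by (intro mono_onD[OF assms(3)]) auto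
      then show ?thesis using 3 assms by (auto simp: indicator_def)
    qed (use assms in auto)
  qed
  then show ?thesis using assms(1) by (simp add: sum.delta)
qed

text \<open>Uniform continuity on an equidistant partition, sampled at left endpoints. The point
  \<open>S\<close> is excluded because the half-open cells leave it uncovered and the step function
  is 0 there.\<close>

lemma continuous_simple_approximation:
  assumes g: "continuous_on {0..S} g" and S: "0 < S" and e: "0 < e"
  shows "\<exists>xs. (\<forall>x\<in>set xs. 0 \<le> snd x \<and> snd x \<le> S) \<and> (\<forall>s\<in>{0..<S}. \<bar>g s - simple_fun xs s\<bar> \<le> e)"
proof -
  have "uniformly_continuous_on {0..S} g"
    using g by (intro compact_uniformly_continuous) auto
  then obtain d where d: "0 < d" "\<And>x y. x \<in> {0..S} \<Longrightarrow> y \<in> {0..S} \<Longrightarrow> dist y x < d \<Longrightarrow> dist (g y) (g x) < e"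
    using e unfolding uniformly_continuous_on_def by metis
  obtain n where n: "S / d < real n" using reals_Archimedean2 by blast
  have "0 < S / d" using S d by simp
  then have n0: "0 < n" using n by (cases "n = 0") auto
  have nd: "S / real n < d" using n n0 d by (simp add: field_simps)
  define p where "p i = real i * (S / real n)" for i
  have pS: "0 \<le> p i \<and> p i \<le> S" if "i \<le> n" for i
    using that S n0 by (simp add: p_def field_simps)
  have pmono: "mono_on {..n} p"
    using S n0 by (intro mono_onI) (auto simp: p_def intro!: divide_right_mono mult_right_mono)
  have "\<bar>g s - simple_fun (step_list n p (\<lambda>i. g (p i))) s\<bar> \<le> e" if s: "s \<in> {0..<S}" for s
  proof -
    \<comment> \<open>The index of the cell containing \<open>s\<close>.\<close>
    define m where "m = nat \<lfloor>s / (S / real n)\<rfloor>"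
    have q: "0 < S / real n" using S n0 by simp
    have m1: "real m \<le> s / (S / real n)" "s / (S / real n) < real m + 1"
      unfolding m_def using s q by (simp_all add: of_nat_nat)
    have sm: "s \<in> {p m..<p (Suc m)}"
      using m1 q by (simp add: p_def pos_le_divide_eq pos_divide_less_eq add.commute del: divide_divide_eq_right)
    have "p m < S" using sm s by simp
    then have m: "m < n" using S n0 by (simp add: p_def field_simps)
    have eq: "simple_fun (step_list n p (\<lambda>i. g (p i))) s = g (p m)"
    proof -
      have "0 \<le> p i \<and> p i \<le> p (Suc i)" if "i < n" for i
        using pS[of i] mono_onD[OF pmono, of i "Suc i"] that by simp
      then show ?thesis
        using simple_fun_step_list[of n p "\<lambda>i. g (p i)" s] step_function_eq[OF m sm pmono, of "\<lambda>i. g (p i)"] by simp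
    qed
    have "p (Suc m) = p m + S / real n" by (simp add: p_def algebra_simps add_divide_distrib)
    then have "dist s (p m) < d" using sm nd by (simp add: dist_real_def)
    then have "dist (g s) (g (p m)) < e" using pS[of m] m s by (intro d(2)) auto
    then show ?thesis unfolding eq dist_real_def by simp
  qed
  moreover have "\<forall>x\<in>set (step_list n p (\<lambda>i. g (p i))). 0 \<le> snd x \<and> snd x \<le> S"
    using pS by (rule step_list_times)
  ultimately show ?thesis by blast
qed

lemma continuous_L2_approximation:
  assumes g: "continuous_on {0..S} g" and S: "0 < S" and e: "0 < e"
  shows "\<exists>xs. (\<forall>x\<in>set xs. 0 \<le> snd x \<and> snd x \<le> S) \<and>
    sqrt (\<integral>s. (g s - simple_fun xs s)\<^sup>2 \<partial>lebesgue_upto S) \<le> e"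
proof -
  \<comment> \<open>A uniform error of \<open>e / sqrt S\<close> on an interval of length
    \<open>S\<close> has mean square norm at most \<open>e\<close>.\<close>
  have "0 < e / sqrt S" using S e by simp
  from continuous_simple_approximation[OF g S this]
  obtain xs where xs: "\<forall>x\<in>set xs. 0 \<le> snd x \<and> snd x \<le> S" "\<forall>s\<in>{0..<S}. \<bar>g s - simple_fun xs s\<bar> \<le> e / sqrt S"
    by blast
  interpret finite_measure "lebesgue_upto S" by (rule finite_measure_lebesgue_upto)
  have "AE s in lebesgue_upto S. s \<noteq> S"
    by (subst AE_restrict_space_iff) (auto intro: AE_mp[OF AE_lborel_singleton])
  then have AE: "AE s in lebesgue_upto S. (g s - simple_fun xs s)\<^sup>2 \<le> (e / sqrt S)\<^sup>2"
    using AE_space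
  proof eventually_elim
    case (elim s)
    then have "\<bar>g s - simple_fun xs s\<bar> \<le> e / sqrt S" using xs(2) by (auto simp: space_restrict_space)
    then show ?case using power_mono[OF _ abs_ge_zero, of _ _ 2] by fastforce
  qed
  have "(\<integral>s. (g s - simple_fun xs s)\<^sup>2 \<partial>lebesgue_upto S) \<le> (\<integral>s. (e / sqrt S)\<^sup>2 \<partial>lebesgue_upto S)"
    using square_integrable_diff[OF square_integrable_continuous[OF g] square_integrable_simple_fun[of S xs]] AE
    by (intro integral_mono_AE) (auto simp: square_integrable_def)
  also have "\<dots> = e\<^sup>2"
    using S by (simp add: measure_restrict_space space_restrict_space power_divide)
  finally have "sqrt (\<integral>s. (g s - simple_fun xs s)\<^sup>2 \<partial>lebesgue_upto S) \<le> sqrt (e\<^sup>2)"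
    by (rule real_sqrt_le_mono)
  then show ?thesis using xs(1) e by auto
qed

text \<open>By the isometry the integrals of the approximants form a Cauchy sequence. The rate
  \<open>(1/2)^(n + 1)\<close> is taken so that consecutive approximants differ by at most
  \<open>(1/2)^(n + 1) + (1/2)^(n + 2)\<close>, hence by at most \<open>(1/2)^n\<close>, as
  \<open>L2_complete\<close> requires.\<close>

lemma (in wiener_process) wiener_integral_upto_exists:
  assumes g: "continuous_on {0..S} g" and S: "0 < S"
  shows "\<exists>I. wiener_integral_upto M B S g I"
proof -
  have "\<exists>xs. (\<forall>x\<in>set xs. 0 \<le> snd x \<and> snd x \<le> S) \<and>
    sqrt (\<integral>s. (g s - simple_fun xs s)\<^sup>2 \<partial>lebesgue_upto S) \<le> (1 / 2) ^ Suc n" for n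
    by (rule continuous_L2_approximation[OF g S]) simp
  then obtain xs where xs: "\<And>n. \<forall>x\<in>set (xs n). 0 \<le> snd x \<and> snd x \<le> S"
    "\<And>n. sqrt (\<integral>s. (g s - simple_fun (xs n) s)\<^sup>2 \<partial>lebesgue_upto S) \<le> (1 / 2) ^ Suc n"
    by metis
  note sqg = square_integrable_continuous[OF g]
  have sqx: "square_integrable M (simple_int B (xs j))" for j
    by (rule square_integrable_simple_int) (use xs(1) in force)
  have "sqrt (\<integral>\<omega>. (simple_int B (xs (Suc n)) \<omega> - simple_int B (xs n) \<omega>)\<^sup>2 \<partial>M) \<le> (1 / 2) ^ n" for n
  proof -
    define ys where "ys = xs (Suc n) @ map (\<lambda>(c, v). (-1 * c, v)) (xs n)"
    have ysi: "simple_int B ys \<omega> = simple_int B (xs (Suc n)) \<omega> - simple_int B (xs n) \<omega>" for \<omega>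
      unfolding ys_def simple_int_simps simple_int_scale by simp
    have ysf: "simple_fun ys s = simple_fun (xs (Suc n)) s - simple_fun (xs n) s" for s
      unfolding ys_def simple_fun_simps simple_fun_scale by simp
    have "\<forall>x\<in>set ys. 0 \<le> snd x \<and> snd x \<le> S" using xs(1) by (force simp: ys_def)
    then have "expectation (\<lambda>\<omega>. simple_int B ys \<omega> * simple_int B ys \<omega>) =
        (\<integral>s. simple_fun ys s * simple_fun ys s \<partial>lebesgue_upto S)"
      by (intro simple_isometry) force+
    then have "sqrt (\<integral>\<omega>. (simple_int B (xs (Suc n)) \<omega> - simple_int B (xs n) \<omega>)\<^sup>2 \<partial>M) =
        sqrt (\<integral>s. ((g s - simple_fun (xs n) s) + - 1 * (g s - simple_fun (xs (Suc n)) s))\<^sup>2 \<partial>lebesgue_upto S)"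
      unfolding ysi ysf by (simp add: power2_eq_square)
    also have "\<dots> \<le> sqrt (\<integral>s. (g s - simple_fun (xs n) s)\<^sup>2 \<partial>lebesgue_upto S) +
        sqrt (\<integral>s. (- 1 * (g s - simple_fun (xs (Suc n)) s))\<^sup>2 \<partial>lebesgue_upto S)"
      by (intro Minkowski_integral square_integrable_cmult square_integrable_diff sqg square_integrable_simple_fun)
    also have "\<dots> = sqrt (\<integral>s. (g s - simple_fun (xs n) s)\<^sup>2 \<partial>lebesgue_upto S) +
        sqrt (\<integral>s. (g s - simple_fun (xs (Suc n)) s)\<^sup>2 \<partial>lebesgue_upto S)"
      by (simp only: power_mult_distrib) simp
    also have "\<dots> \<le> (1 / 2) ^ Suc n + (1 / 2) ^ Suc (Suc n)"
      by (intro add_mono xs(2))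
    also have "\<dots> \<le> (1 / 2) ^ n" by simp
    finally show ?thesis .
  qed
  from L2_complete[OF sqx this] obtain I where I: "square_integrable M I"
    "(\<lambda>n. \<integral>\<omega>. (I \<omega> - simple_int B (xs n) \<omega>)\<^sup>2 \<partial>M) \<longlonglongrightarrow> 0" by blast
  have "(\<lambda>n. \<integral>s. (g s - simple_fun (xs n) s)\<^sup>2 \<partial>lebesgue_upto S) \<longlonglongrightarrow> 0"
  proof (rule Lim_null_comparison)
    have "(\<integral>s. (g s - simple_fun (xs n) s)\<^sup>2 \<partial>lebesgue_upto S) \<le> ((1 / 2) ^ Suc n)\<^sup>2" for n
      using xs(2)[of n] by (rule sqrt_le_D)
    then show "\<forall>\<^sub>F n in sequentially. norm (\<integral>s. (g s - simple_fun (xs n) s)\<^sup>2 \<partial>lebesgue_upto S) \<le> ((1 / 2) ^ Suc n)\<^sup>2"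
      by (intro always_eventually allI) simp
    have "(\<lambda>n. ((1 / 2) ^ n)\<^sup>2 :: real) \<longlonglongrightarrow> 0\<^sup>2"
      by (intro tendsto_intros LIMSEQ_power_zero) auto
    then show "(\<lambda>n. ((1 / 2) ^ Suc n)\<^sup>2 :: real) \<longlonglongrightarrow> 0"
      by (subst filterlim_sequentially_Suc[of "\<lambda>n. ((1 / 2) ^ n)\<^sup>2 :: real"]) simp
  qed
  then show ?thesis
    unfolding wiener_integral_upto_def using sqg I xs(1) by blast
qed

section \<open>The clock of the bridge\<close>

lemma FTC_upto:
  fixes F f :: "real \<Rightarrow> real"
  assumes ab: "0 \<le> a" "a \<le> b" "b \<le> S"
    and F: "\<And>s. s \<in> {0..S} \<Longrightarrow> (F has_real_derivative f s) (at s within {0..S})"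
    and f: "continuous_on {0..S} f"
  shows "(\<integral>s. indicator {a..b} s * f s \<partial>lebesgue_upto S) = F b - F a"
proof -
  have "(\<integral>s. indicator {a..b} s * f s \<partial>lebesgue_upto S) = (\<integral>s. indicator {a..b} s *\<^sub>R f s \<partial>lborel)"
    unfolding integral_lebesgue_upto set_lebesgue_integral_def
    using ab by (intro Bochner_Integration.integral_cong) (auto simp: indicator_def)
  also have "\<dots> = F b - F a"
  proof (rule integral_FTC_atLeastAtMost[OF ab(2)])
    show "(F has_vector_derivative f s) (at s within {a..b})" if "a \<le> s" "s \<le> b" for s
      using F[of s] that ab unfolding has_real_derivative_iff_has_vector_derivative
      by (auto intro: has_vector_derivative_within_subset)
    show "continuous_on {a..b} f" using ab by (intro continuous_on_subset[OF f]) auto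
  qed
  finally show ?thesis .
qed

lemma integral_indicator_upto:
  fixes q :: "real \<Rightarrow> real"
  assumes "0 \<le> t" "t \<le> S" "continuous_on {0..S} q"
  shows "(\<integral>s. indicator {0..t} s * q s \<partial>lebesgue_upto S) = integral {0..t} q"
proof -
  have "(\<integral>s. indicator {0..t} s * q s \<partial>lebesgue_upto S) = (LBINT s:{0..t}. q s)"
    unfolding integral_lebesgue_upto set_lebesgue_integral_def
    using assms by (intro Bochner_Integration.integral_cong) (auto simp: indicator_def)
  also have "\<dots> = integral {0..t} q"
    by (intro set_borel_integral_eq_integral borel_integrable_atLeastAtMost' continuous_on_subset[OF assms(3)])
      (use assms in auto)
  finally show ?thesis .
qed

locale bridge_clock =
  fixes \<alpha> S T :: real
  assumes S_pos: "0 < S" and S_less_T: "S < T"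
begin

definition tau :: "real \<Rightarrow> real" where "tau = bridge_tau \<alpha> T"
text \<open>The speed of the clock, that is, the derivative of \<open>tau\<close>.\<close>

definition rho :: "real \<Rightarrow> real" where "rho s = (T - s) powr (- 2 * \<alpha>)"

lemma less_T: "s \<in> {0..S} \<Longrightarrow> 0 < T - s"
  using S_less_T by auto

lemma continuous_powr: "continuous_on {0..S} (\<lambda>s. (T - s) powr a)"
  using less_T by (intro continuous_intros) force

lemma continuous_rho: "continuous_on {0..S} rho"
  unfolding rho_def[abs_def] by (rule continuous_powr)

lemma rho_pos: "s \<in> {0..S} \<Longrightarrow> 0 < rho s"
  using less_T[of s] by (simp add: rho_def)

lemma tau_eq_integral: "t \<in> {0..S} \<Longrightarrow> tau t = integral {0..t} rho"
  unfolding tau_def bridge_tau_def rho_def[symmetric]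
  by (intro set_borel_integral_eq_integral borel_integrable_atLeastAtMost' continuous_on_subset[OF continuous_rho]) auto

lemma has_derivative_tau:
  assumes "t \<in> {0..S}"
  shows "(tau has_real_derivative rho t) (at t within {0..S})"
proof (rule has_field_derivative_transform_within[OF _ zero_less_one assms])
  show "((\<lambda>t. integral {0..t} rho) has_real_derivative rho t) (at t within {0..S})"
    by (rule integral_has_real_derivative[OF continuous_rho assms])
qed (simp add: tau_eq_integral)

lemma continuous_tau: "continuous_on {0..S} tau"
  using has_derivative_tau DERIV_continuous_on by blast

lemma tau_0 [simp]: "tau 0 = 0"
  using tau_eq_integral[of 0] S_pos by simp

lemma tau_strict_mono:
  assumes "0 \<le> a" "a < b" "b \<le> S"
  shows "tau a < tau b"
proof (rule DERIV_pos_imp_increasing_open[OF assms(2)])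
  fix x assume x: "a < x" "x < b"
  have "at x within {0..S} = at x" using x assms by (intro at_within_Icc_at) auto
  then show "\<exists>y. (tau has_real_derivative y) (at x) \<and> 0 < y"
    using has_derivative_tau[of x] rho_pos[of x] x assms by auto
next
  show "continuous_on {a..b} tau"
    using assms by (intro continuous_on_subset[OF continuous_tau]) auto
qed

lemma tau_mono: "0 \<le> a \<Longrightarrow> a \<le> b \<Longrightarrow> b \<le> S \<Longrightarrow> tau a \<le> tau b"
  using tau_strict_mono[of a b] by (cases "a = b") auto

lemma tau_S_pos: "0 < tau S"
  using tau_strict_mono[of 0 S] S_pos by simp

lemma tau_bounds: "t \<in> {0..S} \<Longrightarrow> 0 \<le> tau t \<and> tau t \<le> tau S"
  using tau_mono[of 0 t] tau_mono[of t S] by auto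

text \<open>Substitution of \<open>x = tau s\<close>, done by differentiating \<open>P\<close> along
  the clock. The explicit integrals below reduce to exhibiting a primitive \<open>P\<close>.\<close>

lemma integral_clock_change:
  assumes ab: "0 \<le> a" "a \<le> b" "b \<le> S"
    and P: "\<And>x. (P has_real_derivative p x) (at x)" and p: "continuous_on UNIV p"
  shows "(\<integral>s. indicator {a..b} s * (p (tau s) * rho s) \<partial>lebesgue_upto S) = P (tau b) - P (tau a)"
proof (rule FTC_upto[OF ab])
  fix s assume "s \<in> {0..S}"
  then show "((\<lambda>s. P (tau s)) has_real_derivative p (tau s) * rho s) (at s within {0..S})"
    by (intro DERIV_chain2[OF P] has_derivative_tau)
next
  show "continuous_on {0..S} (\<lambda>s. p (tau s) * rho s)"
    by (intro continuous_on_mult continuous_rho continuous_on_compose2[OF p continuous_tau]) auto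
qed

lemma integral_clock_change_full:
  assumes P: "\<And>x. (P has_real_derivative p x) (at x)" and p: "continuous_on UNIV p"
  shows "(\<integral>s. p (tau s) * rho s \<partial>lebesgue_upto S) = P (tau S) - P 0"
proof -
  have "(\<integral>s. p (tau s) * rho s \<partial>lebesgue_upto S) = (\<integral>s. indicator {0..S} s * (p (tau s) * rho s) \<partial>lebesgue_upto S)"
    by (intro Bochner_Integration.integral_cong) (auto simp: space_restrict_space)
  then show ?thesis
    using integral_clock_change[OF _ _ _ P p, of 0 S] S_pos by simp
qed

section \<open>Eigenfrequencies and trigonometric integrals in clock time\<close>

definition freq :: "nat \<Rightarrow> real" where "freq k = (real k - 1 / 2) * pi"

text \<open>Scaled so that \<open>cos (omega k * x)\<close> vanishes at \<open>x = tau S\<close>: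
  this is the free-end condition of the Wiener process on \<open>[0, tau S]\<close>.\<close>

definition omega :: "nat \<Rightarrow> real" where "omega k = freq k / tau S"

lemma freq_pos: "1 \<le> k \<Longrightarrow> 0 < freq k"
  by (simp add: freq_def)

lemma omega_pos: "1 \<le> k \<Longrightarrow> 0 < omega k"
  using freq_pos[of k] tau_S_pos by (simp add: omega_def)

lemma omega_tau_S: "omega k * tau S = freq k"
  using tau_S_pos by (simp add: omega_def)

lemma cos_freq: "1 \<le> k \<Longrightarrow> cos (freq k) = 0"
  using cos_zero_iff_int2[of "freq k"] by (auto simp: freq_def algebra_simps intro!: exI[of _ "int k - 1"])

lemma freq_inj: "freq i = freq j \<Longrightarrow> i = j"
  by (simp add: freq_def)

lemma sin_freq_sum: "1 \<le> i \<Longrightarrow> 1 \<le> j \<Longrightarrow> sin (freq i + freq j) = 0" "1 \<le> i \<Longrightarrow> 1 \<le> j \<Longrightarrow> sin (freq i - freq j) = 0"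
  by (simp_all add: sin_add sin_diff cos_freq)

text \<open>The primitives come from the product-to-sum formulas; their values at
  \<open>tau S\<close> involve sines of sums and differences of the frequencies, which vanish
  because \<open>cos (freq k) = 0\<close>.\<close>

lemma integral_cos_cos:
  assumes "1 \<le> i" "1 \<le> j"
  shows "(\<integral>s. cos (omega i * tau s) * cos (omega j * tau s) * rho s \<partial>lebesgue_upto S) = (if i = j then tau S / 2 else 0)"
proof (cases "i = j")
  case True
  define P where "P x = x / 2 + sin (2 * omega i * x) / (4 * omega i)" for x
  have "(P has_real_derivative cos (omega i * x) * cos (omega j * x)) (at x)" for x
  proof -
    have "(P has_real_derivative 1 / 2 + cos (2 * omega i * x) * (2 * omega i) / (4 * omega i)) (at x)"
      unfolding P_def[abs_def] by (auto intro!: derivative_eq_intros)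
    moreover have "1 / 2 + cos (2 * omega i * x) * (2 * omega i) / (4 * omega i) = cos (omega i * x) * cos (omega j * x)"
      using omega_pos[OF assms(1)] True cos_double_cos[of "omega i * x"]
      by (simp add: power2_eq_square mult.assoc field_simps)
    ultimately show ?thesis by simp
  qed
  then have "(\<integral>s. cos (omega i * tau s) * cos (omega j * tau s) * rho s \<partial>lebesgue_upto S) = P (tau S) - P 0"
    by (rule integral_clock_change_full) (auto intro!: continuous_intros)
  moreover have "sin (2 * omega i * tau S) = 0"
    using sin_freq_sum(1)[OF assms(1) assms(1)] by (simp add: omega_tau_S mult.assoc)
  ultimately show ?thesis using True by (simp add: P_def)
next
  case False
  have ne: "omega i - omega j \<noteq> 0" "omega i + omega j \<noteq> 0"
    using freq_inj[of i j] False omega_pos[OF assms(1)] omega_pos[OF assms(2)] tau_S_pos by (auto simp: omega_def)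
  define P where "P x = (sin ((omega i - omega j) * x) / (omega i - omega j) + sin ((omega i + omega j) * x) / (omega i + omega j)) / 2" for x
  have "(P has_real_derivative cos (omega i * x) * cos (omega j * x)) (at x)" for x
  proof -
    have "(P has_real_derivative (cos ((omega i - omega j) * x) + cos ((omega i + omega j) * x)) / 2) (at x)"
      unfolding P_def[abs_def] using ne by (auto intro!: derivative_eq_intros)
    then show ?thesis by (simp add: distrib_right left_diff_distrib cos_add cos_diff)
  qed
  then have "(\<integral>s. cos (omega i * tau s) * cos (omega j * tau s) * rho s \<partial>lebesgue_upto S) = P (tau S) - P 0"
    by (rule integral_clock_change_full) (auto intro!: continuous_intros)
  then show ?thesis using False sin_freq_sum[OF assms]
    by (simp add: P_def omega_tau_S distrib_right left_diff_distrib)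
qed

lemma integral_sin_sin:
  assumes "1 \<le> i" "1 \<le> j"
  shows "(\<integral>s. sin (omega i * tau s) * sin (omega j * tau s) * rho s \<partial>lebesgue_upto S) = (if i = j then tau S / 2 else 0)"
proof (cases "i = j")
  case True
  define P where "P x = x / 2 - sin (2 * omega i * x) / (4 * omega i)" for x
  have "(P has_real_derivative sin (omega i * x) * sin (omega j * x)) (at x)" for x
  proof -
    have "(P has_real_derivative 1 / 2 - cos (2 * omega i * x) * (2 * omega i) / (4 * omega i)) (at x)"
      unfolding P_def[abs_def] by (auto intro!: derivative_eq_intros)
    moreover have "1 / 2 - cos (2 * omega i * x) * (2 * omega i) / (4 * omega i) = sin (omega i * x) * sin (omega j * x)"
      using omega_pos[OF assms(1)] True cos_double_sin[of "omega i * x"]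
      by (simp add: power2_eq_square mult.assoc field_simps)
    ultimately show ?thesis by simp
  qed
  then have "(\<integral>s. sin (omega i * tau s) * sin (omega j * tau s) * rho s \<partial>lebesgue_upto S) = P (tau S) - P 0"
    by (rule integral_clock_change_full) (auto intro!: continuous_intros)
  moreover have "sin (2 * omega i * tau S) = 0"
    using sin_freq_sum(1)[OF assms(1) assms(1)] by (simp add: omega_tau_S mult.assoc)
  ultimately show ?thesis using True by (simp add: P_def)
next
  case False
  have ne: "omega i - omega j \<noteq> 0" "omega i + omega j \<noteq> 0"
    using freq_inj[of i j] False omega_pos[OF assms(1)] omega_pos[OF assms(2)] tau_S_pos by (auto simp: omega_def)
  define P where "P x = (sin ((omega i - omega j) * x) / (omega i - omega j) - sin ((omega i + omega j) * x) / (omega i + omega j)) / 2" for x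
  have "(P has_real_derivative sin (omega i * x) * sin (omega j * x)) (at x)" for x
  proof -
    have "(P has_real_derivative (cos ((omega i - omega j) * x) - cos ((omega i + omega j) * x)) / 2) (at x)"
      unfolding P_def[abs_def] using ne by (auto intro!: derivative_eq_intros)
    then show ?thesis by (simp add: distrib_right left_diff_distrib cos_add cos_diff)
  qed
  then have "(\<integral>s. sin (omega i * tau s) * sin (omega j * tau s) * rho s \<partial>lebesgue_upto S) = P (tau S) - P 0"
    by (rule integral_clock_change_full) (auto intro!: continuous_intros)
  then show ?thesis using False sin_freq_sum[OF assms]
    by (simp add: P_def omega_tau_S distrib_right left_diff_distrib)
qed

lemma integral_cos_clock:
  assumes "0 \<le> t" "t \<le> S" "w \<noteq> 0"
  shows "(\<integral>s. indicator {0..t} s * (cos (w * tau s) * rho s) \<partial>lebesgue_upto S) = sin (w * tau t) / w"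
  using assms
  by (subst integral_clock_change[where P = "\<lambda>x. sin (w * x) / w" and p = "\<lambda>x. cos (w * x)"])
    (auto intro!: derivative_eq_intros continuous_intros)

text \<open>The kernel is \<open>tau s\<close> before \<open>t\<close> and the constant
  \<open>tau t\<close> after it. Only integrability of \<open>q\<close> is assumed, since the
  splitting is also applied to an eigenfunction whose continuity is not yet known.\<close>

lemma integral_min_tau_split:
  assumes t: "t \<in> {0..S}" and q: "integrable (lebesgue_upto S) q"
  shows "integrable (lebesgue_upto S) (\<lambda>s. tau (min t s) * q s)"
    "(\<integral>s. tau (min t s) * q s \<partial>lebesgue_upto S) = (\<integral>s. indicator {0..t} s * (tau s * q s) \<partial>lebesgue_upto S)
      + tau t * ((\<integral>s. q s \<partial>lebesgue_upto S) - (\<integral>s. indicator {0..t} s * q s \<partial>lebesgue_upto S))"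
proof -
  have [measurable]: "q \<in> borel_measurable (lebesgue_upto S)" using q by auto
  have [measurable]: "tau \<in> borel_measurable (lebesgue_upto S)"
    using square_integrable_continuous[OF continuous_tau] by (simp add: square_integrable_def)
  have ind[measurable]: "indicat_real {0..t} \<in> borel_measurable (lebesgue_upto S)"
    using square_integrable_indicator[of "{0..t}" S] by (simp add: square_integrable_def)
  have i1: "integrable (lebesgue_upto S) (\<lambda>s. indicator {0..t} s * q s)"
  proof (rule Bochner_Integration.integrable_bound[OF q])
    show "(\<lambda>s. indicator {0..t} s * q s) \<in> borel_measurable (lebesgue_upto S)" by measurable
  qed (auto simp: indicator_def)
  have i2: "integrable (lebesgue_upto S) (\<lambda>s. indicator {0..t} s * (tau s * q s))"
  proof (rule Bochner_Integration.integrable_bound[of _ "\<lambda>s. tau S * q s"])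
    show "(\<lambda>s. indicator {0..t} s * (tau s * q s)) \<in> borel_measurable (lebesgue_upto S)" by measurable
    show "AE s in lebesgue_upto S. norm (indicator {0..t} s * (tau s * q s)) \<le> norm (tau S * q s)"
      using tau_bounds tau_S_pos
      by (intro AE_I2) (auto simp: indicator_def space_restrict_space abs_mult intro!: mult_right_mono)
  qed (use q in auto)
  have eq: "tau (min t s) * q s = indicator {0..t} s * (tau s * q s) + tau t * (q s - indicator {0..t} s * q s)"
    if "s \<in> space (lebesgue_upto S)" for s
    using that by (auto simp: indicator_def space_restrict_space min_def)
  have "integrable (lebesgue_upto S) (\<lambda>s. tau (min t s) * q s) \<longleftrightarrow>
      integrable (lebesgue_upto S) (\<lambda>s. indicator {0..t} s * (tau s * q s) + tau t * (q s - indicator {0..t} s * q s))"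
    by (intro Bochner_Integration.integrable_cong refl eq)
  then show "integrable (lebesgue_upto S) (\<lambda>s. tau (min t s) * q s)" using q i1 i2 by simp
  have "(\<integral>s. tau (min t s) * q s \<partial>lebesgue_upto S) =
      (\<integral>s. indicator {0..t} s * (tau s * q s) + tau t * (q s - indicator {0..t} s * q s) \<partial>lebesgue_upto S)"
    by (intro Bochner_Integration.integral_cong refl eq)
  then show "(\<integral>s. tau (min t s) * q s \<partial>lebesgue_upto S) = (\<integral>s. indicator {0..t} s * (tau s * q s) \<partial>lebesgue_upto S)
      + tau t * ((\<integral>s. q s \<partial>lebesgue_upto S) - (\<integral>s. indicator {0..t} s * q s \<partial>lebesgue_upto S))"
    using q i1 i2 by simp
qed

text \<open>In clock time \<open>min x y\<close> is the Green function of the negative second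
  derivative with \<open>u = 0\<close> at 0 and \<open>u' = 0\<close> at \<open>tau S\<close>. After
  cancellation the only boundary term left carries the factor \<open>cos (freq k)\<close>, which is
  0.\<close>

lemma integral_min_tau_sin:
  assumes t: "t \<in> {0..S}" and k: "1 \<le> k"
  shows "(\<integral>s. tau (min t s) * (sin (omega k * tau s) * rho s) \<partial>lebesgue_upto S) = sin (omega k * tau t) / (omega k)\<^sup>2"
proof -
  let ?w = "omega k"
  have w: "?w \<noteq> 0" using omega_pos[OF k] by simp
  have "continuous_on {0..S} (\<lambda>s. sin (?w * tau s) * rho s)"
    by (intro continuous_intros continuous_tau continuous_rho)
  then have q: "integrable (lebesgue_upto S) (\<lambda>s. sin (?w * tau s) * rho s)"
    unfolding integrable_lebesgue_upto by (rule borel_integrable_atLeastAtMost')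
  have P: "((\<lambda>x. - cos (?w * x) / ?w) has_real_derivative sin (?w * x)) (at x)" for x
    using w by (auto intro!: derivative_eq_intros)
  have 1: "(\<integral>s. indicator {0..t} s * (sin (?w * tau s) * rho s) \<partial>lebesgue_upto S) = - cos (?w * tau t) / ?w - (- cos (?w * tau 0) / ?w)"
    using t by (intro integral_clock_change[OF _ _ _ P]) (auto intro!: continuous_intros)
  have 2: "(\<integral>s. sin (?w * tau s) * rho s \<partial>lebesgue_upto S) = - cos (?w * tau S) / ?w - (- cos (?w * 0) / ?w)"
    by (intro integral_clock_change_full[OF P]) (auto intro!: continuous_intros)
  have 3: "(\<integral>s. indicator {0..t} s * (tau s * (sin (?w * tau s) * rho s)) \<partial>lebesgue_upto S) =
      - tau t * cos (?w * tau t) / ?w + sin (?w * tau t) / ?w\<^sup>2"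
  proof -
    \<comment> \<open>The primitive is found by integrating \<open>x * sin (w * x)\<close> by
      parts.\<close>
    have "((\<lambda>x. - x * cos (?w * x) / ?w + sin (?w * x) / ?w\<^sup>2) has_real_derivative x * sin (?w * x)) (at x)" for x
      using w by (auto intro!: derivative_eq_intros simp: power2_eq_square field_simps)
    from integral_clock_change[OF _ _ _ this, of 0 t]
    have "(\<integral>s. indicator {0..t} s * (tau s * sin (?w * tau s) * rho s) \<partial>lebesgue_upto S) =
      - tau t * cos (?w * tau t) / ?w + sin (?w * tau t) / ?w\<^sup>2"
      using t by (simp add: continuous_intros)
    then show ?thesis by (simp add: mult.assoc)
  qed
  show ?thesis
    unfolding integral_min_tau_split(2)[OF t q] 1 2 3
    using cos_freq[OF k] by (simp add: omega_tau_S)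
qed

end

section \<open>A sine series\<close>

text \<open>The frequencies \<open>freq\<close> with the index counted from 0:
  \<open>half_odd_freq i\<close> is \<open>freq (Suc i)\<close>.\<close>

definition half_odd_freq :: "nat \<Rightarrow> real" where
  "half_odd_freq i = (real i + 1 / 2) * pi"

definition sin_square_sum :: "nat \<Rightarrow> real \<Rightarrow> real" where
  "sin_square_sum n x = (\<Sum>i<n. 2 * (sin (half_odd_freq i * x))\<^sup>2 / (half_odd_freq i)\<^sup>2)"

text \<open>The derivative of \<open>sin_square_sum n\<close>, and a Fourier partial sum of the odd
  square wave of period 2 that equals 1 on (0, 1). The jumps at 0 and 1 confine uniform estimates to
  intervals \<open>[d, 1 - d]\<close>.\<close>

definition sin_sum :: "nat \<Rightarrow> real \<Rightarrow> real" where
  "sin_sum n x = (\<Sum>i<n. 2 * sin (2 * half_odd_freq i * x) / half_odd_freq i)"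

lemma half_odd_freq_pos: "0 < half_odd_freq i"
  by (simp add: half_odd_freq_def add_nonneg_pos)

lemma half_odd_freq_nonzero [simp]: "half_odd_freq i \<noteq> 0"
  using half_odd_freq_pos[of i] by simp

lemma has_derivative_sin_square_sum:
  "(sin_square_sum n has_real_derivative sin_sum n x) (at x within A)"
proof -
  have "((\<lambda>x. 2 * (sin (half_odd_freq i * x))\<^sup>2 / (half_odd_freq i)\<^sup>2) has_real_derivative
      2 * sin (2 * half_odd_freq i * x) / half_odd_freq i) (at x within A)" for i
  proof -
    have eq: "2 * sin (2 * half_odd_freq i * x) / half_odd_freq i =
        2 / (half_odd_freq i)\<^sup>2 * (2 * (sin (half_odd_freq i * x) * (cos (half_odd_freq i * x) * half_odd_freq i)))"
      using sin_double[of "half_odd_freq i * x"] half_odd_freq_pos[of i] by (simp add: power2_eq_square mult_ac)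
    have "((\<lambda>x. 2 / (half_odd_freq i)\<^sup>2 * (sin (half_odd_freq i * x))\<^sup>2) has_real_derivative
        2 * sin (2 * half_odd_freq i * x) / half_odd_freq i) (at x within A)"
      unfolding eq by (rule DERIV_cmult) (auto intro!: derivative_eq_intros simp: mult_ac)
    then show ?thesis by simp
  qed
  then show ?thesis
    unfolding sin_square_sum_def[abs_def] sin_sum_def by (intro DERIV_sum) auto
qed

text \<open>Multiplication by \<open>sin (pi * x)\<close> turns each cosine into a difference of
  consecutive terms \<open>sin (2 * n * pi * x)\<close>, so that the sum telescopes.\<close>

lemma Dirichlet_kernel_odd:
  "sin (pi * x) * (\<Sum>i<n. 4 * cos (2 * half_odd_freq i * x)) = 2 * sin (2 * real n * pi * x)"
proof (induction n)
  case (Suc n)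
  have "2 * (sin (pi * x) * cos (2 * half_odd_freq n * x)) =
      sin (pi * x + 2 * half_odd_freq n * x) + sin (pi * x - 2 * half_odd_freq n * x)"
    by (simp add: sin_add sin_diff)
  also have "pi * x + 2 * half_odd_freq n * x = 2 * real (Suc n) * pi * x"
    by (simp add: half_odd_freq_def algebra_simps)
  also have "pi * x - 2 * half_odd_freq n * x = - (2 * real n * pi * x)"
    by (simp add: half_odd_freq_def algebra_simps)
  finally show ?case using Suc by (simp add: algebra_simps)
qed simp

lemma has_derivative_sin_sum:
  assumes "sin (pi * x) \<noteq> 0"
  shows "(sin_sum n has_real_derivative 2 * sin (2 * real n * pi * x) / sin (pi * x)) (at x within A)"
proof -
  have "((\<lambda>x. 2 * sin (2 * half_odd_freq i * x) / half_odd_freq i) has_real_derivative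
      4 * cos (2 * half_odd_freq i * x)) (at x within A)" for i
    using half_odd_freq_pos[of i] by (auto intro!: derivative_eq_intros)
  then have "(sin_sum n has_real_derivative (\<Sum>i<n. 4 * cos (2 * half_odd_freq i * x))) (at x within A)"
    unfolding sin_sum_def[abs_def] by (intro DERIV_sum) auto
  also have "(\<Sum>i<n. 4 * cos (2 * half_odd_freq i * x)) = 2 * sin (2 * real n * pi * x) / sin (pi * x)"
    using Dirichlet_kernel_odd[of x n] assms by (simp add: field_simps)
  finally show ?thesis .
qed

text \<open>At the midpoint the sines alternate in sign and the sum is \<open>4 / pi\<close> times
  the Leibniz series. This single value anchors the limit of \<open>sin_sum\<close> on all of (0,
  1).\<close>

lemma sin_sum_half_tendsto: "(\<lambda>n. sin_sum n (1 / 2)) \<longlonglongrightarrow> 1"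
proof -
  have eq: "2 * sin (2 * half_odd_freq i * (1 / 2)) / half_odd_freq i = 4 / pi * ((-1) ^ i * 1 / real (i * 2 + 1))" for i
  proof -
    have "sin (2 * half_odd_freq i * (1 / 2)) = sin (pi / 2 + real i * pi)"
      by (simp add: half_odd_freq_def algebra_simps)
    also have "\<dots> = (-1) ^ i" by (simp add: sin_add)
    finally show ?thesis by (simp add: half_odd_freq_def field_simps)
  qed
  have "summable (\<lambda>i. (-1) ^ i * 1 / real (i * 2 + 1))"
    using summable_arctan_series[of 1] by simp
  then have "(\<lambda>i. (-1) ^ i * 1 / real (i * 2 + 1)) sums (pi / 4)"
    unfolding pi_series by (rule summable_sums)
  then have "(\<lambda>i. 4 / pi * ((-1) ^ i * 1 / real (i * 2 + 1))) sums (4 / pi * (pi / 4))"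
    by (rule sums_mult)
  then show ?thesis
    unfolding sums_def sin_sum_def eq by simp
qed

lemma sin_pi_ge:
  assumes "0 < d" "d \<le> x" "x \<le> 1 - d"
  shows "sin (pi * d) \<le> sin (pi * x)"
proof -
  have *: "sin (pi * d) \<le> sin (pi * y)" if "d \<le> y" "y \<le> 1 / 2" for y
  proof (rule sin_monotone_2pi_le)
    have "0 \<le> pi * d" using assms by simp
    then show "- (pi / 2) \<le> pi * d" using pi_gt_zero by linarith
  qed (use that mult_left_mono[of y "1/2" pi] in auto)
  show ?thesis
  proof (cases "x \<le> 1 / 2")
    case False
    have "sin (pi * x) = sin (pi * (1 - x))"
      by (simp add: right_diff_distrib sin_diff)
    then show ?thesis using *[of "1 - x"] assms False by simp
  qed (use * assms in auto)
qed

text \<open>Subtracting the primitive \<open>U\<close> of the rapidly oscillating part leaves a function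
  whose derivative is \<open>O(1/n)\<close> away from the integers.\<close>

lemma sin_sum_tendsto_rate:
  assumes d: "0 < d" "d \<le> 1 / 2"
  obtains K where "\<And>n x. d \<le> x \<Longrightarrow> x \<le> 1 - d \<Longrightarrow> 0 < n \<Longrightarrow> \<bar>sin_sum n x - sin_sum n (1 / 2)\<bar> \<le> K / real n"
proof
  \<comment> \<open>A lower bound for \<open>sin (pi * y)\<close> on \<open>[d, 1 - d]\<close>. The
    constant \<open>K\<close> is settled only by the final estimate; it is built from
    \<open>c\<close>, which is fixed before \<open>n\<close> and \<open>x\<close>.\<close>
  define c where "c = sin (pi * d)"
  have c: "0 < c" unfolding c_def using d mult_strict_left_mono[of d 1 pi] by (intro sin_gt_zero) auto
  fix n :: nat and x :: real
  assume x: "d \<le> x" "x \<le> 1 - d" and n: "0 < n"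
  define U where "U y = - cos (2 * real n * pi * y) / (real n * pi * sin (pi * y))" for y
  \<comment> \<open>The remainder of the integration by parts, from differentiating
    \<open>1 / sin (pi * y)\<close>; it is the derivative of \<open>sin_sum n - U\<close>.\<close>
  define V where "V y = - cos (2 * real n * pi * y) * cos (pi * y) / (real n * (sin (pi * y))\<^sup>2)" for y
  have c_le: "c \<le> sin (pi * y)" if "y \<in> {d..1-d}" for y
    unfolding c_def using that d by (intro sin_pi_ge) auto
  have U': "(U has_real_derivative 2 * sin (2 * real n * pi * y) / sin (pi * y) - V y) (at y within A)"
    if "sin (pi * y) > 0" for y A
  proof -
    have num: "((\<lambda>y. - cos (2 * real n * pi * y)) has_real_derivative sin (2 * real n * pi * y) * (2 * real n * pi)) (at y within A)"
      by (auto intro!: derivative_eq_intros)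
    have den: "((\<lambda>y. real n * pi * sin (pi * y)) has_real_derivative real n * pi * (cos (pi * y) * pi)) (at y within A)"
      by (auto intro!: derivative_eq_intros)
    note D = DERIV_divide[OF num den]
    have "((sin (2 * real n * pi * y) * (2 * real n * pi)) * (real n * pi * sin (pi * y)) -
        (- cos (2 * real n * pi * y)) * (real n * pi * (cos (pi * y) * pi))) /
       ((real n * pi * sin (pi * y)) * (real n * pi * sin (pi * y))) =
       2 * sin (2 * real n * pi * y) / sin (pi * y) - V y"
      unfolding V_def using that n
      by (simp add: divide_simps power2_eq_square) (simp add: algebra_simps)
    with D show ?thesis using that n unfolding U_def[abs_def] by simp
  qed
  \<comment> \<open>Mean value inequality from the midpoint; the two values of \<open>U\<close> are
    themselves of order \<open>1 / n\<close> and are added back below.\<close>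
  have "norm ((sin_sum n x - U x) - (sin_sum n (1/2) - U (1/2))) \<le> 1 / (real n * c\<^sup>2) * norm (x - 1/2)"
  proof (rule field_differentiable_bound[where S = "{d..1-d}" and f' = V])
    fix y assume y: "y \<in> {d..1-d}"
    then have pos: "0 < sin (pi * y)" using c_le[OF y] c by linarith
    show "((\<lambda>y. sin_sum n y - U y) has_real_derivative V y) (at y within {d..1-d})"
      using DERIV_diff[OF has_derivative_sin_sum[of y n] U'[OF pos]] pos by simp
    have "\<bar>cos (2 * real n * pi * y) * cos (pi * y)\<bar> \<le> 1 * 1"
      unfolding abs_mult by (intro mult_mono) auto
    moreover have "real n * c\<^sup>2 \<le> real n * (sin (pi * y))\<^sup>2"
      using c_le[OF y] c by (intro mult_left_mono power_mono) auto
    ultimately show "norm (V y) \<le> 1 / (real n * c\<^sup>2)"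
      unfolding V_def using n c by (auto simp: abs_mult intro!: frac_le)
  qed (use x d in auto)
  also have "\<dots> \<le> 1 / (real n * c\<^sup>2) * 1"
    using x d n c by (intro mult_left_mono) auto
  finally have 1: "\<bar>(sin_sum n x - U x) - (sin_sum n (1/2) - U (1/2))\<bar> \<le> (1 / c\<^sup>2) / real n"
    by (simp add: mult.commute)
  have U_le: "\<bar>U y\<bar> \<le> (1 / (pi * c)) / real n" if "y \<in> {d..1-d}" for y
  proof -
    have "real n * pi * c \<le> real n * pi * sin (pi * y)"
      using c_le[OF that] by (intro mult_left_mono) auto
    then have "\<bar>U y\<bar> \<le> 1 / (real n * pi * c)"
      unfolding U_def using n c c_le[OF that] by (auto simp: abs_mult intro!: frac_le)
    then show ?thesis by (simp add: mult.commute mult.left_commute)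
  qed
  have "\<bar>sin_sum n x - sin_sum n (1 / 2)\<bar> \<le> (1 / c\<^sup>2) / real n + (1 / (pi * c)) / real n + (1 / (pi * c)) / real n"
    using 1 U_le[of x] U_le[of "1/2"] x d by auto
  then show "\<bar>sin_sum n x - sin_sum n (1 / 2)\<bar> \<le> (1 / c\<^sup>2 + 1 / (pi * c) + 1 / (pi * c)) / real n"
    by (simp add: add_divide_distrib)
qed

text \<open>Weierstrass test: \<open>half_odd_freq i\<close> is at least \<open>i + 1\<close>, so
  the terms are dominated by \<open>2 / (i + 1)^2\<close>. The limit is left unidentified
  here.\<close>

lemma uniform_limit_sin_square_sum:
  obtains F where "uniform_limit UNIV sin_square_sum F sequentially" "continuous_on UNIV F"
proof -
  have bound: "norm (2 * (sin (half_odd_freq i * x))\<^sup>2 / (half_odd_freq i)\<^sup>2) \<le> 2 * inverse (real (Suc i) ^ 2)" for i x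
  proof -
    have "real (Suc i) \<le> half_odd_freq i"
    proof -
      have "real (Suc i) \<le> (real i + 1 / 2) * 2" by simp
      also have "\<dots> \<le> half_odd_freq i" unfolding half_odd_freq_def using pi_ge_two by (intro mult_left_mono) auto
      finally show ?thesis .
    qed
    then have "real (Suc i) ^ 2 \<le> (half_odd_freq i)\<^sup>2" by (intro power_mono) auto
    moreover have "(sin (half_odd_freq i * x))\<^sup>2 \<le> 1" by (simp add: abs_square_le_1)
    ultimately have "2 * (sin (half_odd_freq i * x))\<^sup>2 / (half_odd_freq i)\<^sup>2 \<le> 2 * 1 / real (Suc i) ^ 2"
      by (intro frac_le mult_left_mono) auto
    then show ?thesis by (simp add: divide_inverse)
  qed
  have sm: "summable (\<lambda>i. 2 * inverse (real (Suc i) ^ 2))"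
    using inverse_power_summable[of 2, where ?'a = real]
    by (intro summable_mult) (simp only: summable_Suc_iff[of "\<lambda>n. inverse (real n ^ 2)"])
  have lim: "uniform_limit UNIV (\<lambda>n x. \<Sum>i<n. 2 * (sin (half_odd_freq i * x))\<^sup>2 / (half_odd_freq i)\<^sup>2)
      (\<lambda>x. \<Sum>i. 2 * (sin (half_odd_freq i * x))\<^sup>2 / (half_odd_freq i)\<^sup>2) sequentially"
    by (rule Weierstrass_m_test[OF bound sm])
  moreover have "continuous_on UNIV (\<lambda>x. \<Sum>i. 2 * (sin (half_odd_freq i * x))\<^sup>2 / (half_odd_freq i)\<^sup>2)"
    by (rule uniform_limit_theorem[OF _ lim])
      (auto intro!: always_eventually continuous_intros)
  ultimately show ?thesis using that unfolding sin_square_sum_def[abs_def] by blast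
qed

text \<open>On compact parts of (0, 1) the derivatives of the partial sums tend uniformly to 1, so
  the limit minus the identity is constant there; continuity and the value 0 at 0 make this constant
  vanish on the closed interval.\<close>

lemma sin_square_series:
  "uniform_limit {0..1} sin_square_sum (\<lambda>x. x) sequentially"
proof -
  obtain F where F: "uniform_limit UNIV sin_square_sum F sequentially" "continuous_on UNIV F"
    by (rule uniform_limit_sin_square_sum)
  have lim: "(\<lambda>n. sin_square_sum n x) \<longlonglongrightarrow> F x" for x
    using tendsto_uniform_limitI[OF F(1), of x] by simp
  have const: "F y - y = F x - x" if xy: "x \<in> {0<..<1}" "y \<in> {0<..<1}" for x y
  proof -
    \<comment> \<open>Chosen so that \<open>x\<close>, \<open>y\<close> and the midpoint all lie in
      \<open>[d, 1 - d]\<close>, where the rate estimate holds.\<close>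
    define d where "d = Min {x, 1 - x, y, 1 - y, 1 / 2}"
    have d: "0 < d" "d \<le> 1 / 2" "d \<le> x" "x \<le> 1 - d" "d \<le> y" "y \<le> 1 - d"
      using xy by (auto simp: d_def min_def)
    obtain K where K: "\<And>n x. d \<le> x \<Longrightarrow> x \<le> 1 - d \<Longrightarrow> 0 < n \<Longrightarrow>
        \<bar>sin_sum n x - sin_sum n (1 / 2)\<bar> \<le> K / real n"
      using sin_sum_tendsto_rate[OF d(1,2)] by blast
    have bound: "norm ((sin_square_sum n y - y) - (sin_square_sum n x - x)) \<le>
        (K / real n + \<bar>sin_sum n (1 / 2) - 1\<bar>) * norm (y - x)" if n: "0 < n" for n
    proof (rule field_differentiable_bound[where S = "{d..1-d}" and f' = "\<lambda>z. sin_sum n z - 1"])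
      fix z assume "z \<in> {d..1-d}"
      then show "norm (sin_sum n z - 1) \<le> K / real n + \<bar>sin_sum n (1 / 2) - 1\<bar>"
        using K[of z n] n by auto
      show "((\<lambda>z. sin_square_sum n z - z) has_real_derivative sin_sum n z - 1) (at z within {d..1-d})"
        by (intro derivative_intros has_derivative_sin_square_sum)
    qed (use d in auto)
    have "(\<lambda>n. (K / real n + \<bar>sin_sum n (1 / 2) - 1\<bar>) * norm (y - x)) \<longlonglongrightarrow> (0 + \<bar>1 - 1\<bar>) * norm (y - x)"
      by (intro tendsto_intros sin_sum_half_tendsto lim_const_over_n)
    then have null: "(\<lambda>n. (K / real n + \<bar>sin_sum n (1 / 2) - 1\<bar>) * norm (y - x)) \<longlonglongrightarrow> 0"
      by simp
    have "\<forall>\<^sub>F n in sequentially. norm ((sin_square_sum n y - y) - (sin_square_sum n x - x)) \<le>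
        (K / real n + \<bar>sin_sum n (1 / 2) - 1\<bar>) * norm (y - x)"
      using eventually_gt_at_top[of 0] by eventually_elim (rule bound)
    then have "(\<lambda>n. (sin_square_sum n y - y) - (sin_square_sum n x - x)) \<longlonglongrightarrow> 0"
      by (rule Lim_null_comparison[OF _ null])
    moreover have "(\<lambda>n. (sin_square_sum n y - y) - (sin_square_sum n x - x)) \<longlonglongrightarrow> (F y - y) - (F x - x)"
      by (intro tendsto_intros lim)
    ultimately show ?thesis using LIMSEQ_unique by fastforce
  qed
  have F0: "F 0 = 0"
    using lim[of 0] by (simp add: sin_square_sum_def[abs_def] LIMSEQ_const_iff)
  have Fx: "F x = x" if "x \<in> {0..1}" for x
  proof -
    have cl: "closure {0<..<1::real} = {0..1}" by (simp add: closure_greaterThanLessThan)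
    have c: "F z - z = F (1/2) - 1/2" if "z \<in> {0..1}" for z
    proof (rule continuous_constant_on_closure[of "{0<..<1::real}" "\<lambda>z. F z - z"])
      show "continuous_on (closure {0<..<1}) (\<lambda>z. F z - z)"
        by (intro continuous_intros continuous_on_subset[OF F(2)]) auto
      show "F w - w = F (1/2) - 1/2" if "w \<in> {0<..<1}" for w
        using const[of "1/2" w] that by simp
      show "z \<in> closure {0<..<1}" using that cl by simp
    qed
    show ?thesis using c[of x] c[of 0] F0 that by simp
  qed
  have "uniform_limit {0..1} sin_square_sum F sequentially"
    by (rule uniform_limit_on_subset[OF F(1)]) auto
  then show ?thesis
    using Fx by (subst (asm) uniform_limit_cong'[where g = sin_square_sum and i = "\<lambda>x. x"]) auto
qed

section \<open>The weighted eigenvalue problem\<close>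

context bridge_clock
begin

lemma constant_of_derivative_zero:
  assumes "\<And>t. t \<in> {0..S} \<Longrightarrow> (f has_real_derivative 0) (at t within {0..S})" "t \<in> {0..S}"
  shows "f t = f 0"
proof -
  have "\<exists>c. \<forall>x\<in>{0..S}. f x = c"
    using assms(1) by (intro has_field_derivative_zero_constant) auto
  then show ?thesis using assms(2) S_pos by auto
qed

lemma cos_zero_freq:
  assumes "cos x = 0" "0 < x"
  obtains k where "1 \<le> k" "x = freq k"
proof -
  obtain i :: int where i: "x = of_int i * pi + pi / 2"
    using assms(1) cos_zero_iff_int2 by blast
  have "0 \<le> i"
  proof (rule ccontr)
    assume "\<not> 0 \<le> i"
    then have "real_of_int i \<le> -1" by linarith
    then have "real_of_int i * pi \<le> -1 * pi" by (intro mult_right_mono) auto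
    then show False using i assms(2) pi_gt_zero by linarith
  qed
  then have "x = freq (nat i + 1)" using i by (simp add: freq_def algebra_simps)
  then show ?thesis using that[of "nat i + 1"] by simp
qed

text \<open>With \<open>K t = \<integral>\<^sub>t\<^sup>S \<rho> G\<close> the integral equation becomes the first-order system
  \<open>l G' = \<rho> K\<close>, \<open>K' = - \<rho> G\<close> with \<open>G 0 = 0 = K S\<close>; rotating (or, for \<open>l < 0\<close>, hyperbolically
  rotating) the pair by the clock \<open>\<tau>\<close> yields constants.\<close>

lemma eigenfunctions_of_min_tau:
  assumes G: "continuous_on {0..S} G" and l: "l \<noteq> 0"
    and eq: "\<And>t. t \<in> {0..S} \<Longrightarrow> (\<integral>s. tau (min t s) * (rho s * G s) \<partial>lebesgue_upto S) = l * G t"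
    and nonzero: "\<exists>t\<in>{0..S}. G t \<noteq> 0"
  shows "\<exists>k\<ge>1. \<exists>C. l = (tau S / freq k)\<^sup>2 \<and> (\<forall>t\<in>{0..S}. G t = C * sin (omega k * tau t))"
proof -
  define q where "q s = rho s * G s" for s
  have q: "continuous_on {0..S} q"
    unfolding q_def[abs_def] by (intro continuous_intros continuous_rho G)
  have tq: "continuous_on {0..S} (\<lambda>s. tau s * q s)"
    by (intro continuous_intros continuous_tau q)
  have iq: "integrable (lebesgue_upto S) q"
    unfolding integrable_lebesgue_upto by (rule borel_integrable_atLeastAtMost'[OF q])
  define Q where "Q t = integral {0..t} q" for t
  define P where "P t = integral {0..t} (\<lambda>s. tau s * q s)" for t
  define K where "K t = Q S - Q t" for t
  have QS: "(\<integral>s. q s \<partial>lebesgue_upto S) = Q S"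
  proof -
    have "(\<integral>s. q s \<partial>lebesgue_upto S) = (\<integral>s. indicator {0..S} s * q s \<partial>lebesgue_upto S)"
      by (intro Bochner_Integration.integral_cong) (auto simp: space_restrict_space)
    then show ?thesis using integral_indicator_upto[OF _ _ q, of S] S_pos by (simp add: Q_def)
  qed
  have G_eq: "(P t + tau t * K t) / l = G t" if t: "t \<in> {0..S}" for t
  proof -
    have "l * G t = (\<integral>s. tau (min t s) * q s \<partial>lebesgue_upto S)"
      using eq[OF t] by (simp add: q_def)
    also have "\<dots> = P t + tau t * K t"
      using t by (simp add: integral_min_tau_split(2)[OF t iq] QS P_def Q_def K_def
        integral_indicator_upto[OF _ _ q] integral_indicator_upto[OF _ _ tq])
    finally show ?thesis using l by (simp add: field_simps)
  qed
  have dtau: "(tau has_real_derivative rho t) (at t within {0..S})" if "t \<in> {0..S}" for t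
    by (rule has_derivative_tau[OF that])
  have dK: "(K has_real_derivative - (rho t * G t)) (at t within {0..S})" if "t \<in> {0..S}" for t
    using DERIV_diff[OF DERIV_const integral_has_real_derivative[OF q that], of "Q S"]
    by (simp add: K_def[abs_def] Q_def[abs_def] q_def)
  have dG: "(G has_real_derivative rho t * K t / l) (at t within {0..S})" if t: "t \<in> {0..S}" for t
  proof (rule has_field_derivative_transform_within[OF _ zero_less_one t])
    \<comment> \<open>The two terms with \<open>tau t\<close> cancel because
      \<open>q = rho * G\<close>; only \<open>rho * K\<close> survives.\<close>
    have "((\<lambda>t. P t + tau t * K t) has_real_derivative tau t * q t + (rho t * K t + - (rho t * G t) * tau t)) (at t within {0..S})"
      unfolding P_def[abs_def]
      by (intro DERIV_add DERIV_mult integral_has_real_derivative[OF tq t] dtau dK t)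
    then have "((\<lambda>t. P t + tau t * K t) has_real_derivative rho t * K t) (at t within {0..S})"
      by (rule DERIV_cong) (simp add: q_def)
    then show "((\<lambda>t. (P t + tau t * K t) / l) has_real_derivative rho t * K t / l) (at t within {0..S})"
      by (rule DERIV_cdivide)
  qed (use G_eq in auto)
  have KS: "K S = 0" by (simp add: K_def)
  have S: "S \<in> {0..S}" using S_pos by simp
  have G0: "G 0 = 0" using G_eq[of 0] S_pos by (simp add: P_def)
  show ?thesis
  proof (cases "0 < l")
    case True
    define w where "w = 1 / sqrt l"
    have w: "0 < w" and w2: "1 / l = w * w" using True by (simp_all add: w_def)
    have dG': "(G has_real_derivative rho t * K t * (w * w)) (at t within {0..S})" if "t \<in> {0..S}" for t
      using dG[OF that] by (simp add: w2[symmetric])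
    have dcos: "((\<lambda>t. cos (w * tau t)) has_real_derivative - sin (w * tau t) * (w * rho t)) (at t within {0..S})" if "t \<in> {0..S}" for t
      by (rule DERIV_chain2[OF DERIV_cos DERIV_cmult[OF dtau[OF that]]])
    have dsin: "((\<lambda>t. sin (w * tau t)) has_real_derivative cos (w * tau t) * (w * rho t)) (at t within {0..S})" if "t \<in> {0..S}" for t
      by (rule DERIV_chain2[OF DERIV_sin DERIV_cmult[OF dtau[OF that]]])
    \<comment> \<open>\<open>A\<close> and \<open>B\<close> are the coordinates of the pair
      \<open>(G, w * K)\<close> rotated by the angle \<open>w * tau t\<close>. They are conserved,
      and \<open>G 0 = 0\<close> gives the values at time 0.\<close>
    have A: "G t * cos (w * tau t) - w * K t * sin (w * tau t) = 0" if "t \<in> {0..S}" for t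
    proof -
      have "((\<lambda>t. G t * cos (w * tau t) - w * K t * sin (w * tau t)) has_real_derivative 0) (at t within {0..S})" if "t \<in> {0..S}" for t
        by (rule DERIV_cong[OF DERIV_diff[OF DERIV_mult[OF dG' dcos] DERIV_mult[OF DERIV_cmult[OF dK] dsin]]])
          (use that in \<open>auto simp: algebra_simps\<close>)
      from constant_of_derivative_zero[of "\<lambda>t. G t * cos (w * tau t) - w * K t * sin (w * tau t)", OF this that]
      show ?thesis using G0 by simp
    qed
    have B: "G t * sin (w * tau t) + w * K t * cos (w * tau t) = w * K 0" if "t \<in> {0..S}" for t
    proof -
      have "((\<lambda>t. G t * sin (w * tau t) + w * K t * cos (w * tau t)) has_real_derivative 0) (at t within {0..S})" if "t \<in> {0..S}" for t
        by (rule DERIV_cong[OF DERIV_add[OF DERIV_mult[OF dG' dsin] DERIV_mult[OF DERIV_cmult[OF dK] dcos]]])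
          (use that in \<open>auto simp: algebra_simps\<close>)
      from constant_of_derivative_zero[of "\<lambda>t. G t * sin (w * tau t) + w * K t * cos (w * tau t)", OF this that]
      show ?thesis using G0 by simp
    qed
    have G_sin: "G t = w * K 0 * sin (w * tau t)" if "t \<in> {0..S}" for t
    proof -
      have "G t = G t * ((sin (w * tau t))\<^sup>2 + (cos (w * tau t))\<^sup>2)" by simp
      also have "\<dots> = (G t * sin (w * tau t) + w * K t * cos (w * tau t)) * sin (w * tau t) +
          (G t * cos (w * tau t) - w * K t * sin (w * tau t)) * cos (w * tau t)"
        by algebra
      finally show ?thesis unfolding A[OF that] B[OF that] by simp
    qed
    have "w * K 0 \<noteq> 0" using nonzero G_sin by force
    \<comment> \<open>Solving the rotation for \<open>w * K\<close> at time \<open>S\<close> turns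
      the free-end condition \<open>K S = 0\<close> into the quantisation of
      \<open>w\<close>.\<close>
    moreover have "w * K 0 * cos (w * tau S) = 0"
    proof -
      have "w * K S * ((sin (w * tau S))\<^sup>2 + (cos (w * tau S))\<^sup>2) =
          (G S * sin (w * tau S) + w * K S * cos (w * tau S)) * cos (w * tau S) -
          (G S * cos (w * tau S) - w * K S * sin (w * tau S)) * sin (w * tau S)"
        by algebra
      then show ?thesis unfolding A[OF S] B[OF S] using KS by simp
    qed
    ultimately have "cos (w * tau S) = 0" by simp
    moreover have "0 < w * tau S" using w tau_S_pos by simp
    ultimately obtain k where k: "1 \<le> k" "w * tau S = freq k" by (rule cos_zero_freq)
    have wk: "w = omega k" using k(2) tau_S_pos by (simp add: omega_def field_simps)
    have "l = 1 / (w * w)" using w2 w l by (simp add: field_simps)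
    also have "\<dots> = (tau S / freq k)\<^sup>2"
      unfolding wk omega_def by (simp add: power2_eq_square)
    finally show ?thesis using k(1) G_sin unfolding wk by blast
  next
    case False
    define w where "w = 1 / sqrt (- l)"
    have w: "0 < w" and w2: "1 / l = - (w * w)" using False l by (simp_all add: w_def)
    have dG': "(G has_real_derivative - (rho t * K t * (w * w))) (at t within {0..S})" if "t \<in> {0..S}" for t
    proof -
      have "rho t * K t / l = rho t * K t * (1 / l)" by simp
      then show ?thesis using dG[OF that] by (simp only: w2 mult_minus_right)
    qed
    have dexp: "((\<lambda>t. exp (a * tau t)) has_real_derivative exp (a * tau t) * (a * rho t)) (at t within {0..S})" if "t \<in> {0..S}" for t a
      by (rule DERIV_chain2[OF DERIV_exp DERIV_cmult[OF dtau[OF that]]])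
    have A: "(G t + w * K t) * exp (w * tau t) = w * K 0" if "t \<in> {0..S}" for t
    proof -
      have "((\<lambda>t. (G t + w * K t) * exp (w * tau t)) has_real_derivative 0) (at t within {0..S})" if "t \<in> {0..S}" for t
        by (rule DERIV_cong[OF DERIV_mult[OF DERIV_add[OF dG' DERIV_cmult[OF dK]] dexp]])
          (use that in \<open>auto simp: algebra_simps\<close>)
      from constant_of_derivative_zero[of "\<lambda>t. (G t + w * K t) * exp (w * tau t)", OF this that]
      show ?thesis using G0 by simp
    qed
    have B: "(G t - w * K t) * exp (- w * tau t) = - (w * K 0)" if "t \<in> {0..S}" for t
    proof -
      have "((\<lambda>t. (G t - w * K t) * exp (- w * tau t)) has_real_derivative 0) (at t within {0..S})" if "t \<in> {0..S}" for t
        by (rule DERIV_cong[OF DERIV_mult[OF DERIV_diff[OF dG' DERIV_cmult[OF dK]] dexp]])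
          (use that in \<open>auto simp: algebra_simps\<close>)
      from constant_of_derivative_zero[of "\<lambda>t. (G t - w * K t) * exp (- w * tau t)", OF this that]
      show ?thesis using G0 by simp
    qed
    \<comment> \<open>At \<open>S\<close>, where \<open>K\<close> vanishes, the two conserved
      quantities are opposite. This forces \<open>G S = 0\<close>, then \<open>w * K 0 = 0\<close>,
      so there are no negative eigenvalues.\<close>
    have "G S * (exp (w * tau S) + exp (- w * tau S)) = 0"
      using A[OF S] B[OF S] KS by (simp add: distrib_left)
    moreover have "exp (w * tau S) + exp (- w * tau S) > 0" by (intro add_pos_pos) auto
    ultimately have "G S = 0" by (metis mult_eq_0_iff less_irrefl)
    then have wK: "w * K 0 = 0" using A[OF S] KS by simp
    have "G t = 0" if "t \<in> {0..S}" for t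
    proof -
      have "G t + w * K t = 0" "G t - w * K t = 0"
        using A[OF that] B[OF that] unfolding wK by simp_all
      then show ?thesis by linarith
    qed
    then show ?thesis using nonzero by blast
  qed
qed

section \<open>Transfer of the eigenvalue problem to the weighted space\<close>

abbreviation weight :: "real measure" where "weight \<equiv> bridge_weight \<alpha> T S"

lemma space_weight [simp]: "space weight = {0..S}"
  by (simp add: bridge_weight_def space_restrict_space)

lemma measurable_weight: "g \<in> borel_measurable weight \<longleftrightarrow> g \<in> borel_measurable (lebesgue_upto S)"
  by (simp add: bridge_weight_def)

lemma powr_measurable: "(\<lambda>s. (T - s) powr a) \<in> borel_measurable (lebesgue_upto S)"
  by (intro measurable_restrict_space1) measurable

lemma integral_weight:
  fixes h :: "real \<Rightarrow> real"
  assumes "h \<in> borel_measurable (lebesgue_upto S)"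
  shows "(\<integral>s. h s \<partial>weight) = (\<integral>s. (T - s) powr (- 4 * \<alpha>) * h s \<partial>lebesgue_upto S)"
  unfolding bridge_weight_def using assms powr_measurable by (subst integral_density) auto

lemma integrable_weight:
  fixes h :: "real \<Rightarrow> real"
  assumes "h \<in> borel_measurable (lebesgue_upto S)"
  shows "integrable weight h \<longleftrightarrow> integrable (lebesgue_upto S) (\<lambda>s. (T - s) powr (- 4 * \<alpha>) * h s)"
  unfolding bridge_weight_def using assms powr_measurable by (subst integrable_density) auto

lemma measurable_continuous_upto:
  fixes h :: "real \<Rightarrow> real"
  shows "continuous_on {0..S} h \<Longrightarrow> h \<in> borel_measurable (lebesgue_upto S)"
  using square_integrable_continuous[of S h] by (simp add: square_integrable_def)

lemma integrable_continuous_upto: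
  fixes h :: "real \<Rightarrow> real"
  shows "continuous_on {0..S} h \<Longrightarrow> integrable (lebesgue_upto S) h"
  unfolding integrable_lebesgue_upto by (rule borel_integrable_atLeastAtMost')

definition bridge_cov :: "real \<Rightarrow> real \<Rightarrow> real" where
  "bridge_cov s t = (T - s) powr \<alpha> * (T - t) powr \<alpha> * tau (min s t)"

definition eigval :: "nat \<Rightarrow> real" where "eigval k = (tau S / freq k)\<^sup>2"

definition eigfun :: "nat \<Rightarrow> real \<Rightarrow> real" where
  "eigfun k t = sqrt (2 / tau S) * (T - t) powr \<alpha> * sin (omega k * tau t)"

lemma eigval_pos: "1 \<le> k \<Longrightarrow> 0 < eigval k"
  using freq_pos[of k] tau_S_pos by (simp add: eigval_def)

lemma eigval_inj:
  assumes "1 \<le> i" "1 \<le> j" "eigval i = eigval j"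
  shows "i = j"
proof -
  have "tau S / freq i = tau S / freq j"
    using assms freq_pos[of i] freq_pos[of j] tau_S_pos unfolding eigval_def
    by (intro power2_eq_imp_eq[of "tau S / freq i"]) auto
  then have "freq i = freq j" using tau_S_pos by simp
  then show ?thesis by (rule freq_inj)
qed

lemma continuous_eigfun: "continuous_on {0..S} (eigfun k)"
  unfolding eigfun_def[abs_def] by (intro continuous_intros continuous_powr continuous_tau)

text \<open>The bookkeeping behind the exponent \<open>-4 * \<alpha>\<close>: kernel and
  eigenfunction, or two eigenfunctions, each contribute one factor
  \<open>(T - s) powr \<alpha>\<close>, and what remains is exactly the clock speed.\<close>

lemma weight_powr:
  assumes "s \<in> {0..S}"
  shows "(T - s) powr (- 4 * \<alpha>) * ((T - s) powr \<alpha> * (T - s) powr \<alpha>) = rho s"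
  using less_T[OF assms] by (simp add: rho_def powr_add[symmetric])

lemma eigfun_orthonormal:
  assumes "1 \<le> i" "1 \<le> j"
  shows "(\<integral>s. eigfun i s * eigfun j s \<partial>weight) = (if i = j then 1 else 0)"
proof -
  have "(\<integral>s. eigfun i s * eigfun j s \<partial>weight) =
      (\<integral>s. (T - s) powr (- 4 * \<alpha>) * (eigfun i s * eigfun j s) \<partial>lebesgue_upto S)"
    by (intro integral_weight measurable_continuous_upto continuous_intros continuous_eigfun)
  also have "\<dots> = (\<integral>s. 2 / tau S * (sin (omega i * tau s) * sin (omega j * tau s) * rho s) \<partial>lebesgue_upto S)"
  proof (intro Bochner_Integration.integral_cong refl)
    fix s assume "s \<in> space (lebesgue_upto S)"
    then have s: "s \<in> {0..S}" by (simp add: space_restrict_space)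
    have "sqrt (2 / tau S) * sqrt (2 / tau S) = 2 / tau S" using tau_S_pos by simp
    moreover have "(T - s) powr (- 4 * \<alpha>) * (eigfun i s * eigfun j s) =
        (sqrt (2 / tau S) * sqrt (2 / tau S)) * (sin (omega i * tau s) * sin (omega j * tau s) * rho s)"
      unfolding eigfun_def weight_powr[OF s, symmetric] by (simp only: mult_ac)
    ultimately show "(T - s) powr (- 4 * \<alpha>) * (eigfun i s * eigfun j s) =
        2 / tau S * (sin (omega i * tau s) * sin (omega j * tau s) * rho s)"
      by (simp only:)
  qed
  also have "\<dots> = (if i = j then 1 else 0)"
    using tau_S_pos by (simp add: integral_sin_sin[OF assms])
  finally show ?thesis .
qed

lemma square_integrable_eigfun: "square_integrable weight (eigfun k)"
  unfolding square_integrable_def measurable_weight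
  by (auto simp: integrable_weight measurable_continuous_upto continuous_eigfun continuous_intros continuous_powr
      intro!: integrable_continuous_upto)

lemma eigfun_not_AE_zero:
  assumes "1 \<le> k"
  shows "\<not> (AE s in weight. eigfun k s = 0)"
proof
  assume "AE s in weight. eigfun k s = 0"
  then have "(\<integral>s. eigfun k s * eigfun k s \<partial>weight) = (\<integral>s. 0 \<partial>weight)"
    using square_integrable_eigfun[of k] by (intro integral_cong_AE) (auto simp: square_integrable_def)
  then show False using eigfun_orthonormal[OF assms assms] by simp
qed

text \<open>After the powers of \<open>T - s\<close> are absorbed into \<open>rho\<close>, this is
  the Green function identity \<open>integral_min_tau_sin\<close>, and
  \<open>1 / (omega k)^2\<close> is \<open>eigval k\<close>. The kernel \<open>R\<close> is kept
  abstract because a covariance is known only on \<open>[0, S]\<close>.\<close>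

lemma eigfun_eigenpair:
  assumes R: "\<And>s t. s \<in> {0..S} \<Longrightarrow> t \<in> {0..S} \<Longrightarrow> R s t = bridge_cov s t" and k: "1 \<le> k"
  shows "weighted_eigenpair R weight (eigval k) (eigfun k)"
  unfolding weighted_eigenpair_def
proof (intro conjI ballI square_integrable_eigfun eigfun_not_AE_zero k)
  fix t assume "t \<in> space weight"
  then have t: "t \<in> {0..S}" by simp
  let ?h = "\<lambda>s. bridge_cov t s * eigfun k s"
  have cont: "continuous_on {0..S} ?h"
    unfolding bridge_cov_def using t
    by (intro continuous_intros continuous_powr continuous_eigfun continuous_on_compose2[OF continuous_tau]) auto
  have Rh: "R t s * eigfun k s = ?h s" if "s \<in> space weight" for s
    using R[of t s] t that by simp
  have ih: "integrable weight ?h"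
    using cont by (auto simp: integrable_weight measurable_continuous_upto
      intro!: integrable_continuous_upto continuous_intros continuous_powr)
  show "integrable weight (\<lambda>s. R t s * eigfun k s)"
    by (subst Bochner_Integration.integrable_cong[OF refl Rh]) (auto simp: ih)
  have "(\<integral>s. R t s * eigfun k s \<partial>weight) = (\<integral>s. ?h s \<partial>weight)"
    by (rule Bochner_Integration.integral_cong[OF refl Rh])
  also have "\<dots> = (\<integral>s. (T - s) powr (- 4 * \<alpha>) * ?h s \<partial>lebesgue_upto S)"
    by (intro integral_weight measurable_continuous_upto cont)
  also have "\<dots> = (\<integral>s. (sqrt (2 / tau S) * (T - t) powr \<alpha>) * (tau (min t s) * (sin (omega k * tau s) * rho s)) \<partial>lebesgue_upto S)"
  proof (intro Bochner_Integration.integral_cong refl)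
    fix s assume "s \<in> space (lebesgue_upto S)"
    then have s: "s \<in> {0..S}" by (simp add: space_restrict_space)
    show "(T - s) powr (- 4 * \<alpha>) * ?h s =
        (sqrt (2 / tau S) * (T - t) powr \<alpha>) * (tau (min t s) * (sin (omega k * tau s) * rho s))"
      unfolding eigfun_def bridge_cov_def weight_powr[OF s, symmetric] by (simp only: mult_ac)
  qed
  also have "\<dots> = sqrt (2 / tau S) * (T - t) powr \<alpha> * (sin (omega k * tau t) / (omega k)\<^sup>2)"
    by (simp add: integral_min_tau_sin[OF t k])
  also have "\<dots> = eigval k * eigfun k t"
    by (simp add: eigval_def eigfun_def omega_def power_divide)
  finally show "(\<integral>s. R t s * eigfun k s \<partial>weight) = eigval k * eigfun k t" .
qed

text \<open>Dividing \<open>g\<close> by \<open>(T - t) powr \<alpha>\<close> gives a function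
  \<open>G\<close> that solves the unweighted problem in clock time. The work lies in passing from
  square integrability of \<open>g\<close> to continuity of \<open>G\<close>.\<close>

lemma eigenpair_classification:
  assumes R: "\<And>s t. s \<in> {0..S} \<Longrightarrow> t \<in> {0..S} \<Longrightarrow> R s t = bridge_cov s t"
    and pair: "weighted_eigenpair R weight l g" and l: "l \<noteq> 0"
  shows "\<exists>k\<ge>1. \<exists>c. l = eigval k \<and> (\<forall>t\<in>{0..S}. g t = c * eigfun k t)"
proof -
  have g_meas[measurable]: "g \<in> borel_measurable (lebesgue_upto S)"
    and g_sq: "integrable weight (\<lambda>s. (g s)\<^sup>2)" and g_nz: "\<not> (AE s in weight. g s = 0)"
    and g_eq: "\<And>t. t \<in> {0..S} \<Longrightarrow> (\<integral>s. R t s * g s \<partial>weight) = l * g t"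
    using pair by (auto simp: weighted_eigenpair_def square_integrable_def measurable_weight)
  note [measurable] = powr_measurable
  define G where "G s = (T - s) powr (- \<alpha>) * g s" for s
  have gG: "g s = (T - s) powr \<alpha> * G s" if "s \<in> {0..S}" for s
    using less_T[OF that] by (simp add: G_def powr_minus)
  have [measurable]: "G \<in> borel_measurable (lebesgue_upto S)" unfolding G_def[abs_def] by measurable
  have [measurable]: "rho \<in> borel_measurable (lebesgue_upto S)" "tau \<in> borel_measurable (lebesgue_upto S)"
    by (intro measurable_continuous_upto continuous_rho continuous_tau)+
  define q where "q s = rho s * G s" for s
  \<comment> \<open>The total power \<open>-3 * \<alpha>\<close> in \<open>q\<close> is split as
    \<open>-\<alpha>\<close> and \<open>-2 * \<alpha>\<close>: the first factor is continuous, and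
    the square of the second, taken with \<open>g\<close>, is the weight times the square of
    \<open>g\<close>.\<close>
  have iq: "integrable (lebesgue_upto S) q"
  proof -
    have "square_integrable (lebesgue_upto S) (\<lambda>s. (T - s) powr (- \<alpha>))"
      by (intro square_integrable_continuous continuous_powr)
    moreover have "square_integrable (lebesgue_upto S) (\<lambda>s. (T - s) powr (- 2 * \<alpha>) * g s)"
      unfolding square_integrable_def
    proof
      have "((T - s) powr (- 2 * \<alpha>) * g s)\<^sup>2 = (T - s) powr (- 4 * \<alpha>) * (g s)\<^sup>2" for s
        by (simp add: power_mult_distrib power2_eq_square powr_add[symmetric])
      then show "integrable (lebesgue_upto S) (\<lambda>s. ((T - s) powr (- 2 * \<alpha>) * g s)\<^sup>2)"
        using g_sq by (simp add: integrable_weight)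
    qed measurable
    ultimately have "integrable (lebesgue_upto S) (\<lambda>s. (T - s) powr (- \<alpha>) * ((T - s) powr (- 2 * \<alpha>) * g s))"
      by (rule integrable_square_integrable_mult)
    moreover have "q = (\<lambda>s. (T - s) powr (- \<alpha>) * ((T - s) powr (- 2 * \<alpha>) * g s))"
      by (auto simp: q_def rho_def G_def)
    ultimately show ?thesis by simp
  qed
  have eq: "(\<integral>s. tau (min t s) * q s \<partial>lebesgue_upto S) = l * G t" if t: "t \<in> {0..S}" for t
  proof -
    have "l * g t = (\<integral>s. bridge_cov t s * g s \<partial>weight)"
      unfolding g_eq[OF t, symmetric] by (intro Bochner_Integration.integral_cong) (use R t in auto)
    also have "\<dots> = (\<integral>s. (T - s) powr (- 4 * \<alpha>) * (bridge_cov t s * g s) \<partial>lebesgue_upto S)"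
    proof (rule integral_weight)
      have "(\<lambda>s. tau (min t s)) \<in> borel_measurable (lebesgue_upto S)"
        using t by (intro measurable_continuous_upto continuous_on_compose2[OF continuous_tau] continuous_intros) auto
      then show "(\<lambda>s. bridge_cov t s * g s) \<in> borel_measurable (lebesgue_upto S)"
        unfolding bridge_cov_def by measurable
    qed
    also have "\<dots> = (\<integral>s. (T - t) powr \<alpha> * (tau (min t s) * q s) \<partial>lebesgue_upto S)"
    proof (intro Bochner_Integration.integral_cong refl)
      fix s assume "s \<in> space (lebesgue_upto S)"
      then have s: "s \<in> {0..S}" by (simp add: space_restrict_space)
      show "(T - s) powr (- 4 * \<alpha>) * (bridge_cov t s * g s) = (T - t) powr \<alpha> * (tau (min t s) * q s)"
        unfolding q_def bridge_cov_def gG[OF s] weight_powr[OF s, symmetric] by (simp only: mult_ac)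
    qed
    also have "\<dots> = (T - t) powr \<alpha> * (\<integral>s. tau (min t s) * q s \<partial>lebesgue_upto S)" by simp
    finally have "(T - t) powr \<alpha> * (\<integral>s. tau (min t s) * q s \<partial>lebesgue_upto S) = (T - t) powr \<alpha> * (l * G t)"
      by (simp only: gG[OF t] mult.left_commute)
    then show ?thesis using less_T[OF t] by simp
  qed
  \<comment> \<open>\<open>l * G\<close> inherits the modulus of continuity of \<open>tau\<close>,
    with the integral of \<open>\<bar>q\<bar>\<close> as constant; \<open>l\<close> is then divided
    out.\<close>
  have contG: "continuous_on {0..S} G"
  proof -
    define C where "C = (\<integral>s. \<bar>q s\<bar> \<partial>lebesgue_upto S)"
    have iabs: "integrable (lebesgue_upto S) (\<lambda>s. \<bar>q s\<bar>)" using iq by simp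
    have "continuous_on {0..S} (\<lambda>t. l * G t)"
      unfolding continuous_on_def
    proof
      fix a assume a: "a \<in> {0..S}"
      have bound: "norm (l * G t - l * G a) \<le> \<bar>tau t - tau a\<bar> * C" if t: "t \<in> {0..S}" for t
      proof -
        have diff: "l * G t - l * G a = (\<integral>s. tau (min t s) * q s - tau (min a s) * q s \<partial>lebesgue_upto S)"
          unfolding eq[OF t, symmetric] eq[OF a, symmetric]
          using integral_min_tau_split(1)[OF t iq] integral_min_tau_split(1)[OF a iq] by simp
        have "norm (l * G t - l * G a) \<le> (\<integral>s. norm (tau (min t s) * q s - tau (min a s) * q s) \<partial>lebesgue_upto S)"
          unfolding diff by (rule integral_norm_bound)
        also have "\<dots> \<le> (\<integral>s. \<bar>tau t - tau a\<bar> * \<bar>q s\<bar> \<partial>lebesgue_upto S)"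
        proof (rule integral_mono)
          show "integrable (lebesgue_upto S) (\<lambda>s. norm (tau (min t s) * q s - tau (min a s) * q s))"
            by (rule integrable_norm[OF Bochner_Integration.integrable_diff[OF
              integral_min_tau_split(1)[OF t iq] integral_min_tau_split(1)[OF a iq]]])
          show "integrable (lebesgue_upto S) (\<lambda>s. \<bar>tau t - tau a\<bar> * \<bar>q s\<bar>)" using iabs by simp
          fix s assume "s \<in> space (lebesgue_upto S)"
          then have s: "s \<in> {0..S}" by (simp add: space_restrict_space)
          \<comment> \<open>As \<open>tau\<close> is increasing, this compares \<open>tau t\<close>
            and \<open>tau a\<close> after truncation at \<open>tau s\<close>, and truncation is
            1-Lipschitz.\<close>
          have "\<bar>tau (min t s) - tau (min a s)\<bar> \<le> \<bar>tau t - tau a\<bar>"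
            using s t a tau_mono[of t a] tau_mono[of a t] tau_mono[of s t] tau_mono[of s a] tau_mono[of t s] tau_mono[of a s]
            by (auto simp: min_def)
          then show "norm (tau (min t s) * q s - tau (min a s) * q s) \<le> \<bar>tau t - tau a\<bar> * \<bar>q s\<bar>"
            unfolding left_diff_distrib[symmetric] by (simp add: abs_mult mult_right_mono)
        qed
        finally show ?thesis by (simp add: C_def)
      qed
      have "((\<lambda>t. \<bar>tau t - tau a\<bar> * C) \<longlongrightarrow> \<bar>tau a - tau a\<bar> * C) (at a within {0..S})"
        using continuous_tau a by (intro tendsto_intros) (auto simp: continuous_on_def)
      then have null: "((\<lambda>t. \<bar>tau t - tau a\<bar> * C) \<longlongrightarrow> 0) (at a within {0..S})" by simp
      have "((\<lambda>t. l * G t - l * G a) \<longlongrightarrow> 0) (at a within {0..S})"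
      proof (rule Lim_null_comparison[OF _ null])
        show "\<forall>\<^sub>F t in at a within {0..S}. norm (l * G t - l * G a) \<le> \<bar>tau t - tau a\<bar> * C"
          using bound by (auto simp: eventually_at_filter)
      qed
      then show "((\<lambda>t. l * G t) \<longlongrightarrow> l * G a) (at a within {0..S})" by (simp add: LIM_zero_iff)
    qed
    then have "continuous_on {0..S} (\<lambda>t. l * G t / l)"
      using l by (intro continuous_on_divide continuous_on_const) auto
    moreover have "(\<lambda>t. l * G t / l) = G" using l by auto
    ultimately show ?thesis by (simp only:)
  qed
  have "\<exists>t\<in>{0..S}. G t \<noteq> 0"
  proof (rule ccontr)
    assume "\<not> (\<exists>t\<in>{0..S}. G t \<noteq> 0)"
    then have "AE s in weight. g s = 0" using gG by (intro AE_I2) auto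
    then show False using g_nz by simp
  qed
  then obtain k C where k: "1 \<le> k" "l = (tau S / freq k)\<^sup>2" "\<And>t. t \<in> {0..S} \<Longrightarrow> G t = C * sin (omega k * tau t)"
    using eigenfunctions_of_min_tau[OF contG l eq[unfolded q_def]] by blast
  have "g t = C / sqrt (2 / tau S) * eigfun k t" if "t \<in> {0..S}" for t
  proof -
    have "sqrt (2 / tau S) \<noteq> 0" using tau_S_pos by simp
    then show ?thesis using k(3)[OF that] gG[OF that] by (simp add: eigfun_def)
  qed
  then show ?thesis using k(1,2) unfolding eigval_def by blast
qed

end

section \<open>The Karhunen--Loeve expansion\<close>

context bridge_clock
begin

lemma eigval_eigfun:
  assumes "1 \<le> k"
  shows "sqrt (eigval k) * eigfun k t =
    sqrt (2 * tau S) * (T - t) powr \<alpha> * (sin (omega k * tau t) / freq k)"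
proof -
  have "sqrt (eigval k) = tau S / freq k"
    using freq_pos[OF assms] tau_S_pos by (simp add: eigval_def real_sqrt_abs)
  moreover have "sqrt (2 * tau S) = tau S * sqrt (2 / tau S)"
  proof -
    have "2 * tau S = (tau S)\<^sup>2 * (2 / tau S)" using tau_S_pos by (simp add: power2_eq_square)
    then have "sqrt (2 * tau S) = sqrt ((tau S)\<^sup>2) * sqrt (2 / tau S)" by (simp only: real_sqrt_mult)
    then show ?thesis using tau_S_pos by simp
  qed
  ultimately show ?thesis by (simp add: eigfun_def)
qed

text \<open>By the classification each \<open>f' k\<close> is a multiple of some
  \<open>eigfun (\<pi> k)\<close>. Norm 1 makes the factor a sign, orthogonality makes \<pi>
  injective, and the completeness condition on the eigenspaces makes it surjective.\<close>

lemma KL_expansion_unique: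
  assumes R: "\<And>s t. s \<in> {0..S} \<Longrightarrow> t \<in> {0..S} \<Longrightarrow> covariance_kernel M X s t = bridge_cov s t"
    and KL: "weighted_KL_expansion M X weight \<kappa>' f' \<xi>'"
  shows "\<exists>\<pi>. bij_betw \<pi> {1..} {1..} \<and>
    (\<forall>k\<ge>1. \<kappa>' k = eigval (\<pi> k) \<and> (\<exists>\<sigma>\<in>{-1, 1}. \<forall>t\<in>{0..S}. f' k t = \<sigma> * eigfun (\<pi> k) t))"
proof -
  have nz: "\<kappa>' k \<noteq> 0" and pair: "weighted_eigenpair (covariance_kernel M X) weight (\<kappa>' k) (f' k)" if "1 \<le> k" for k
    using KL that by (auto simp: weighted_KL_expansion_def)
  have ortho: "(\<integral>s. f' i s * f' j s \<partial>weight) = (if i = j then 1 else 0)" if "1 \<le> i" "1 \<le> j" for i j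
    using KL that by (auto simp: weighted_KL_expansion_def)
  have span: "\<exists>K c. finite K \<and> K \<subseteq> {k. 1 \<le> k \<and> \<kappa>' k = l} \<and> (\<forall>t\<in>{0..S}. g t = (\<Sum>k\<in>K. c k * f' k t))"
    if "l \<noteq> 0" "weighted_eigenpair (covariance_kernel M X) weight l g" for l g
    using KL that unfolding weighted_KL_expansion_def space_weight by blast
  have "\<exists>m c. 1 \<le> m \<and> \<kappa>' k = eigval m \<and> (\<forall>t\<in>{0..S}. f' k t = c * eigfun m t)" if "1 \<le> k" for k
    using eigenpair_classification[OF R pair[OF that] nz[OF that]] by blast
  then obtain \<pi> c where \<pi>: "\<And>k. 1 \<le> k \<Longrightarrow> 1 \<le> \<pi> k" "\<And>k. 1 \<le> k \<Longrightarrow> \<kappa>' k = eigval (\<pi> k)"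
    and f': "\<And>k t. 1 \<le> k \<Longrightarrow> t \<in> {0..S} \<Longrightarrow> f' k t = c k * eigfun (\<pi> k) t"
    by metis
  have inner: "(\<integral>s. f' i s * f' j s \<partial>weight) = c i * c j * (if \<pi> i = \<pi> j then 1 else 0)" if "1 \<le> i" "1 \<le> j" for i j
  proof -
    have "(\<integral>s. f' i s * f' j s \<partial>weight) = (\<integral>s. c i * c j * (eigfun (\<pi> i) s * eigfun (\<pi> j) s) \<partial>weight)"
      using that by (intro Bochner_Integration.integral_cong) (auto simp: f')
    then show ?thesis using eigfun_orthonormal[OF \<pi>(1)[OF that(1)] \<pi>(1)[OF that(2)]] by simp
  qed
  have cc: "c k * c k = 1" if "1 \<le> k" for k
    using inner[OF that that] ortho[OF that that] by simp
  have "inj_on \<pi> {1..}"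
  proof (rule inj_onI, rule ccontr)
    fix i j :: nat assume ij: "i \<in> {1..}" "j \<in> {1..}" "\<pi> i = \<pi> j" "i \<noteq> j"
    then have "c i * c j = 0" using inner[of i j] ortho[of i j] by simp
    then show False using cc[of i] cc[of j] ij by auto
  qed
  moreover have "\<pi> ` {1..} = {1..}"
  proof (intro equalityI subsetI)
    fix m :: nat assume "m \<in> {1..}"
    then have m: "1 \<le> m" by simp
    have "eigval m \<noteq> 0" using eigval_pos[OF m] by simp
    from span[OF this eigfun_eigenpair[OF R m]]
    obtain K d where K: "finite K" "K \<subseteq> {k. 1 \<le> k \<and> \<kappa>' k = eigval m}" "\<forall>t\<in>{0..S}. eigfun m t = (\<Sum>k\<in>K. d k * f' k t)"
      by blast
    \<comment> \<open>An empty sum would make \<open>eigfun m\<close> vanish; so some index carries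
      the eigenvalue \<open>eigval m\<close>, and distinctness of the eigenvalues sends it to
      \<open>m\<close>.\<close>
    have "K \<noteq> {}"
    proof
      assume "K = {}"
      then have "AE s in weight. eigfun m s = 0" using K(3) by (intro AE_I2) simp
      then show False using eigfun_not_AE_zero[OF m] by simp
    qed
    then obtain k where k: "1 \<le> k" "\<kappa>' k = eigval m" using K(2) by auto
    then have "\<pi> k = m" using eigval_inj[OF \<pi>(1)[OF k(1)] m] \<pi>(2)[OF k(1)] by simp
    then show "m \<in> \<pi> ` {1..}" using k(1) by auto
  qed (use \<pi>(1) in auto)
  moreover have "\<exists>\<sigma>\<in>{-1, 1}. \<forall>t\<in>{0..S}. f' k t = \<sigma> * eigfun (\<pi> k) t" if "1 \<le> k" for k
  proof -
    have "c k \<in> {-1, 1}" using cc[OF that] square_eq_1_iff[of "c k"] by auto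
    then show ?thesis using f'[OF that] by blast
  qed
  ultimately show ?thesis using \<pi>(2) by (auto simp: bij_betw_def)
qed

end

section \<open>Construction of the coefficients and convergence of the expansion\<close>

locale bridge_process = wiener_process M B + bridge_clock \<alpha> S T
  for M :: "'a measure" and B :: "real \<Rightarrow> 'a \<Rightarrow> real" and \<alpha> S T :: real +
  fixes X :: "real \<Rightarrow> 'a \<Rightarrow> real"
  assumes X_integral: "\<And>t. t \<in> {0..S} \<Longrightarrow>
    wiener_integral_upto M B S (\<lambda>s. indicator {0..t} s * ((T - t) / (T - s)) powr \<alpha>) (X t)"
begin

text \<open>The cosine is the clock derivative of the eigenfunction's sine, up to a constant; the
  factor \<open>(T - s) powr (- \<alpha>)\<close> squares to \<open>rho\<close> and so turns
  Lebesgue inner products into integrals in clock time.\<close>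

definition basis :: "nat \<Rightarrow> real \<Rightarrow> real" where
  "basis k s = sqrt (2 / tau S) * cos (omega k * tau s) * (T - s) powr (- \<alpha>)"

text \<open>A Wiener integral is determined only up to null sets, so a version is chosen.\<close>

definition xi :: "nat \<Rightarrow> 'a \<Rightarrow> real" where
  "xi k = (SOME I. wiener_integral_upto M B S (basis k) I)"

lemma xi_integral: "wiener_integral_upto M B S (basis k) (xi k)"
proof -
  have "continuous_on {0..S} (basis k)"
    unfolding basis_def[abs_def] by (intro continuous_intros continuous_powr continuous_tau)
  from wiener_integral_upto_exists[OF this S_pos] show ?thesis
    unfolding xi_def by (rule someI_ex)
qed

lemma kernel_powr:
  assumes "s \<in> {0..S}" "t \<in> {0..S}"
  shows "((T - t) / (T - s)) powr \<alpha> = (T - t) powr \<alpha> * (T - s) powr (- \<alpha>)"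
  using less_T[OF assms(1)] less_T[OF assms(2)] by (simp add: powr_divide powr_minus_divide)

lemma powr_rho: "s \<in> {0..S} \<Longrightarrow> (T - s) powr (- \<alpha>) * (T - s) powr (- \<alpha>) = rho s"
  by (simp add: rho_def powr_add[symmetric])

lemma basis_orthonormal:
  assumes "1 \<le> i" "1 \<le> j"
  shows "(\<integral>s. basis i s * basis j s \<partial>lebesgue_upto S) = (if i = j then 1 else 0)"
proof -
  have "(\<integral>s. basis i s * basis j s \<partial>lebesgue_upto S) =
      (\<integral>s. 2 / tau S * (cos (omega i * tau s) * cos (omega j * tau s) * rho s) \<partial>lebesgue_upto S)"
  proof (intro Bochner_Integration.integral_cong refl)
    fix s assume "s \<in> space (lebesgue_upto S)"
    then have s: "s \<in> {0..S}" by (simp add: space_restrict_space)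
    have "sqrt (2 / tau S) * sqrt (2 / tau S) = 2 / tau S" using tau_S_pos by simp
    moreover have "basis i s * basis j s =
        (sqrt (2 / tau S) * sqrt (2 / tau S)) * (cos (omega i * tau s) * cos (omega j * tau s) * rho s)"
      unfolding basis_def powr_rho[OF s, symmetric] by (simp only: mult_ac)
    ultimately show "basis i s * basis j s = 2 / tau S * (cos (omega i * tau s) * cos (omega j * tau s) * rho s)"
      by (simp only:)
  qed
  also have "\<dots> = (if i = j then 1 else 0)"
    using tau_S_pos by (simp add: integral_cos_cos[OF assms])
  finally show ?thesis .
qed

lemma xi_std_normal: "1 \<le> k \<Longrightarrow> distributed M lborel (xi k) std_normal_density"
  using basis_orthonormal[of k k]
  by (intro wiener_integral_upto_std_normal[OF xi_integral]) (simp add: power2_eq_square)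

lemma xi_indep: "indep_vars (\<lambda>_. borel) xi {1..}"
  by (rule wiener_integral_upto_indep[OF xi_integral]) (simp add: basis_orthonormal)

lemma X_square_integrable: "t \<in> {0..S} \<Longrightarrow> square_integrable M (X t)"
  using wiener_integral_upto_square_integrable[OF X_integral] by blast

lemma xi_square_integrable: "square_integrable M (xi k)"
  using wiener_integral_upto_square_integrable[OF xi_integral] by blast

lemma expectation_X_X:
  assumes s: "s \<in> {0..S}" and t: "t \<in> {0..S}"
  shows "expectation (\<lambda>\<omega>. X s \<omega> * X t \<omega>) = bridge_cov s t"
proof -
  have "expectation (\<lambda>\<omega>. X s \<omega> * X t \<omega>) =
      (\<integral>r. (indicator {0..s} r * ((T - s) / (T - r)) powr \<alpha>) * (indicator {0..t} r * ((T - t) / (T - r)) powr \<alpha>) \<partial>lebesgue_upto S)"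
    by (rule wiener_integral_upto_covariance[OF X_integral[OF s] X_integral[OF t]])
  also have "\<dots> = (\<integral>r. ((T - s) powr \<alpha> * (T - t) powr \<alpha>) * (indicator {0..min s t} r * rho r) \<partial>lebesgue_upto S)"
  proof (intro Bochner_Integration.integral_cong refl)
    fix r assume "r \<in> space (lebesgue_upto S)"
    then have r: "r \<in> {0..S}" by (simp add: space_restrict_space)
    have ind: "indicat_real {0..min s t} r = indicator {0..s} r * indicator {0..t} r"
      by (auto simp: indicator_def)
    show "(indicator {0..s} r * ((T - s) / (T - r)) powr \<alpha>) * (indicator {0..t} r * ((T - t) / (T - r)) powr \<alpha>) =
        ((T - s) powr \<alpha> * (T - t) powr \<alpha>) * (indicator {0..min s t} r * rho r)"
      unfolding kernel_powr[OF r s] kernel_powr[OF r t] powr_rho[OF r, symmetric] ind by (simp only: mult_ac)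
  qed
  also have "\<dots> = ((T - s) powr \<alpha> * (T - t) powr \<alpha>) * (\<integral>r. indicator {0..min s t} r * rho r \<partial>lebesgue_upto S)"
    by simp
  also have "(\<integral>r. indicator {0..min s t} r * rho r \<partial>lebesgue_upto S) = tau (min s t)"
    using s t tau_eq_integral[of "min s t"] integral_indicator_upto[OF _ _ continuous_rho, of "min s t"] by (auto simp: min_def)
  finally show ?thesis by (simp add: bridge_cov_def)
qed

lemma covariance_kernel_X:
  assumes "s \<in> {0..S}" "t \<in> {0..S}"
  shows "covariance_kernel M X s t = bridge_cov s t"
  using expectation_X_X[OF assms] wiener_integral_upto_expectation[OF X_integral] assms
  by (simp add: covariance_kernel_def)

text \<open>By the isometry this is a clock integral of a cosine up to \<open>tau t\<close>, hence a
  sine divided by \<open>omega k\<close>: precisely the coefficient of \<open>xi k\<close> in the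
  expansion.\<close>

lemma expectation_X_xi:
  assumes t: "t \<in> {0..S}" and k: "1 \<le> k"
  shows "expectation (\<lambda>\<omega>. X t \<omega> * xi k \<omega>) = sqrt (eigval k) * eigfun k t"
proof -
  have "expectation (\<lambda>\<omega>. X t \<omega> * xi k \<omega>) =
      (\<integral>r. (indicator {0..t} r * ((T - t) / (T - r)) powr \<alpha>) * basis k r \<partial>lebesgue_upto S)"
    by (rule wiener_integral_upto_covariance[OF X_integral[OF t] xi_integral])
  also have "\<dots> = (\<integral>r. (sqrt (2 / tau S) * (T - t) powr \<alpha>) * (indicator {0..t} r * (cos (omega k * tau r) * rho r)) \<partial>lebesgue_upto S)"
  proof (intro Bochner_Integration.integral_cong refl)
    fix r assume "r \<in> space (lebesgue_upto S)"
    then have r: "r \<in> {0..S}" by (simp add: space_restrict_space)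
    show "(indicator {0..t} r * ((T - t) / (T - r)) powr \<alpha>) * basis k r =
        (sqrt (2 / tau S) * (T - t) powr \<alpha>) * (indicator {0..t} r * (cos (omega k * tau r) * rho r))"
      unfolding kernel_powr[OF r t] powr_rho[OF r, symmetric] basis_def by (simp only: mult_ac)
  qed
  also have "\<dots> = (sqrt (2 / tau S) * (T - t) powr \<alpha>) * (sin (omega k * tau t) / omega k)"
    using integral_cos_clock[of t "omega k"] t omega_pos[OF k] by simp
  also have "\<dots> = sqrt (eigval k) * eigfun k t"
    using freq_pos[OF k] tau_S_pos by (simp add: eigval_def eigfun_def omega_def)
  finally show ?thesis .
qed

text \<open>Since the coefficients \<open>a k\<close> are also the covariances of \<open>X t\<close>
  with the orthonormal \<open>xi k\<close>, cross term and norm of the partial sum are both the sum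
  of the \<open>(a k)^2\<close>. The error is the variance of \<open>X t\<close> minus this
  sum.\<close>

lemma L2_error:
  assumes t: "t \<in> {0..S}"
  shows "expectation (\<lambda>\<omega>. (X t \<omega> - (\<Sum>k=1..n. sqrt (eigval k) * xi k \<omega> * eigfun k t))\<^sup>2) =
    (T - t) powr (2 * \<alpha>) * tau S * (tau t / tau S - sin_square_sum n (tau t / tau S))"
proof -
  define a where "a k = sqrt (eigval k) * eigfun k t" for k
  have sum_eq: "(\<Sum>k=1..n. sqrt (eigval k) * xi k \<omega> * eigfun k t) = (\<Sum>k=1..n. a k * xi k \<omega>)" for \<omega>
    by (intro sum.cong) (auto simp: a_def)
  have sq: "square_integrable M (\<lambda>\<omega>. \<Sum>k=1..n. a k * xi k \<omega>)"
    by (intro square_integrable_sum square_integrable_cmult xi_square_integrable)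
  have int: "integrable M (\<lambda>\<omega>. a k * (X t \<omega> * xi k \<omega>))" for k
    using integrable_square_integrable_mult[OF X_square_integrable[OF t] xi_square_integrable[of k]] by simp
  have "expectation (\<lambda>\<omega>. X t \<omega> * (\<Sum>k=1..n. a k * xi k \<omega>)) = expectation (\<lambda>\<omega>. \<Sum>k=1..n. a k * (X t \<omega> * xi k \<omega>))"
    by (intro Bochner_Integration.integral_cong) (auto simp: sum_distrib_left mult_ac)
  also have "\<dots> = (\<Sum>k=1..n. a k * expectation (\<lambda>\<omega>. X t \<omega> * xi k \<omega>))"
    using int by (subst Bochner_Integration.integral_sum) auto
  also have "\<dots> = (\<Sum>k=1..n. (a k)\<^sup>2)"
    by (intro sum.cong) (auto simp: expectation_X_xi[OF t] a_def power2_eq_square)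
  finally have cross: "expectation (\<lambda>\<omega>. X t \<omega> * (\<Sum>k=1..n. a k * xi k \<omega>)) = (\<Sum>k=1..n. (a k)\<^sup>2)" .
  have xi_xi: "expectation (\<lambda>\<omega>. xi i \<omega> * xi j \<omega>) = (if i = j then 1 else 0)" if "1 \<le> i" "1 \<le> j" for i j
    using wiener_integral_upto_covariance[OF xi_integral xi_integral] basis_orthonormal[OF that] by simp
  have "expectation (\<lambda>\<omega>. (\<Sum>k=1..n. a k * xi k \<omega>)\<^sup>2) = (\<Sum>k=1..n. (a k)\<^sup>2 * expectation (\<lambda>\<omega>. (xi k \<omega>)\<^sup>2))"
    by (intro integral_square_orthogonal_sum xi_square_integrable) (auto simp: xi_xi)
  also have "\<dots> = (\<Sum>k=1..n. (a k)\<^sup>2)"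
    using xi_xi by (intro sum.cong) (auto simp: power2_eq_square)
  finally have norm: "expectation (\<lambda>\<omega>. (\<Sum>k=1..n. a k * xi k \<omega>)\<^sup>2) = (\<Sum>k=1..n. (a k)\<^sup>2)" .
  have powr2: "((T - t) powr \<alpha>)\<^sup>2 = (T - t) powr (2 * \<alpha>)"
    by (simp add: power2_eq_square powr_add[symmetric])
  have var: "expectation (\<lambda>\<omega>. (X t \<omega>)\<^sup>2) = (T - t) powr (2 * \<alpha>) * tau t"
    using expectation_X_X[OF t t] by (simp add: bridge_cov_def powr2[symmetric] power2_eq_square)
  \<comment> \<open>The index is shifted to start at 0, as in \<open>sin_square_sum\<close>.\<close>
  have "(\<Sum>k=1..n. (a k)\<^sup>2) = (\<Sum>i<n. (a (Suc i))\<^sup>2)"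
    by (induction n) auto
  also have "\<dots> = (\<Sum>i<n. (T - t) powr (2 * \<alpha>) * tau S * (2 * (sin (half_odd_freq i * (tau t / tau S)))\<^sup>2 / (half_odd_freq i)\<^sup>2))"
  proof (intro sum.cong refl)
    fix i
    have "freq (Suc i) = half_odd_freq i" by (simp add: freq_def half_odd_freq_def algebra_simps)
    moreover have "omega (Suc i) * tau t = half_odd_freq i * (tau t / tau S)"
      using calculation by (simp add: omega_def)
    moreover have "(sqrt (2 * tau S))\<^sup>2 = 2 * tau S" using tau_S_pos by simp
    ultimately show "(a (Suc i))\<^sup>2 = (T - t) powr (2 * \<alpha>) * tau S * (2 * (sin (half_odd_freq i * (tau t / tau S)))\<^sup>2 / (half_odd_freq i)\<^sup>2)"
      unfolding a_def by (simp add: eigval_eigfun power_mult_distrib power_divide powr2)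
  qed
  also have "\<dots> = (T - t) powr (2 * \<alpha>) * tau S * sin_square_sum n (tau t / tau S)"
    by (simp add: sin_square_sum_def sum_distrib_left)
  finally have sum_a: "(\<Sum>k=1..n. (a k)\<^sup>2) = (T - t) powr (2 * \<alpha>) * tau S * sin_square_sum n (tau t / tau S)" .
  show ?thesis
    unfolding sum_eq integral_square_diff[OF X_square_integrable[OF t] sq] cross norm var sum_a
    using tau_S_pos by (simp add: algebra_simps)
qed

lemma uniform_L2_convergence:
  "L2_uniformly_tendsto M {0..S} (\<lambda>n t \<omega>. \<Sum>k=1..n. sqrt (eigval k) * xi k \<omega> * eigfun k t) X"
  unfolding L2_uniformly_tendsto_def
proof (intro conjI ballI allI)
  fix t n assume t: "t \<in> {0..S}"
  show "square_integrable M (X t)" by (rule X_square_integrable[OF t])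
  have "square_integrable M (\<lambda>\<omega>. \<Sum>k=1..n. (sqrt (eigval k) * eigfun k t) * xi k \<omega>)"
    by (intro square_integrable_sum square_integrable_cmult xi_square_integrable)
  then show "square_integrable M (\<lambda>\<omega>. \<Sum>k=1..n. sqrt (eigval k) * xi k \<omega> * eigfun k t)"
    by (simp add: mult_ac)
next
  \<comment> \<open>The prefactor of the error is continuous on a compact interval; its bound
    \<open>C\<close> enters the tolerance \<open>e / (C * tau S)\<close> required of the sine
    series.\<close>
  have "bounded ((\<lambda>t. (T - t) powr (2 * \<alpha>)) ` {0..S})"
    by (intro compact_imp_bounded compact_continuous_image continuous_powr) auto
  then obtain C where "0 < C" and C': "\<forall>x\<in>(\<lambda>t. (T - t) powr (2 * \<alpha>)) ` {0..S}. norm x \<le> C"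
    unfolding bounded_pos by blast
  then have C: "(T - t) powr (2 * \<alpha>) \<le> C" if "t \<in> {0..S}" for t
    using that by auto
  show "uniform_limit {0..S} (\<lambda>n t. expectation (\<lambda>\<omega>. (X t \<omega> - (\<Sum>k=1..n. sqrt (eigval k) * xi k \<omega> * eigfun k t))\<^sup>2)) (\<lambda>_. 0) sequentially"
  proof (rule uniform_limitI)
    fix e :: real assume e: "0 < e"
    have "0 < e / (C * tau S)" using e \<open>0 < C\<close> tau_S_pos by simp
    from uniform_limitD[OF sin_square_series this]
    show "\<forall>\<^sub>F n in sequentially. \<forall>t\<in>{0..S}.
      dist (expectation (\<lambda>\<omega>. (X t \<omega> - (\<Sum>k=1..n. sqrt (eigval k) * xi k \<omega> * eigfun k t))\<^sup>2)) 0 < e"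
    proof eventually_elim
      case (elim n)
      show ?case
      proof
        fix t assume t: "t \<in> {0..S}"
        define x where "x = tau t / tau S"
        have "x \<in> {0..1}" using tau_bounds[OF t] tau_S_pos by (simp add: x_def)
        then have "\<bar>x - sin_square_sum n x\<bar> < e / (C * tau S)"
          using elim by (simp add: dist_real_def abs_minus_commute)
        then have "C * tau S * \<bar>x - sin_square_sum n x\<bar> < e"
          using \<open>0 < C\<close> tau_S_pos by (simp add: field_simps)
        moreover have "(T - t) powr (2 * \<alpha>) * tau S * \<bar>x - sin_square_sum n x\<bar> \<le> C * tau S * \<bar>x - sin_square_sum n x\<bar>"
          using C[OF t] tau_S_pos by (intro mult_right_mono) auto
        ultimately have "(T - t) powr (2 * \<alpha>) * tau S * \<bar>x - sin_square_sum n x\<bar> < e" by linarith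
        then show "dist (expectation (\<lambda>\<omega>. (X t \<omega> - (\<Sum>k=1..n. sqrt (eigval k) * xi k \<omega> * eigfun k t))\<^sup>2)) 0 < e"
          unfolding L2_error[OF t] x_def[symmetric] using tau_S_pos by (simp add: abs_mult)
      qed
    qed
  qed
qed

lemma KL_expansion_xi: "weighted_KL_expansion M X weight eigval eigfun xi"
  unfolding weighted_KL_expansion_def
proof (intro conjI allI impI)
  fix k :: nat assume k: "1 \<le> k"
  show "eigval k \<noteq> 0" using eigval_pos[OF k] by simp
  show "weighted_eigenpair (covariance_kernel M X) weight (eigval k) (eigfun k)"
    by (rule eigfun_eigenpair[OF covariance_kernel_X k])
  show "distributed M lborel (xi k) std_normal_density" by (rule xi_std_normal[OF k])
next
  fix i j :: nat assume "1 \<le> i" "1 \<le> j"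
  then show "(\<integral>s. eigfun i s * eigfun j s \<partial>weight) = (if i = j then 1 else 0)"
    by (rule eigfun_orthonormal)
next
  fix l g assume "l \<noteq> 0" "weighted_eigenpair (covariance_kernel M X) weight l g"
  from eigenpair_classification[OF covariance_kernel_X this(2,1)]
  obtain k c where "1 \<le> k" "l = eigval k" "\<forall>t\<in>{0..S}. g t = c * eigfun k t" by blast
  \<comment> \<open>The eigenspaces are one-dimensional, so a single index spans.\<close>
  then show "\<exists>K c. finite K \<and> K \<subseteq> {k. 1 \<le> k \<and> eigval k = l} \<and> (\<forall>t\<in>space weight. g t = (\<Sum>k\<in>K. c k * eigfun k t))"
    by (intro exI[of _ "{k}"] exI[of _ "\<lambda>_. c"]) auto
next
  show "indep_vars (\<lambda>_. borel) xi {1..}" by (rule xi_indep)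
  show "L2_uniformly_tendsto M (space weight) (\<lambda>n t \<omega>. \<Sum>k=1..n. sqrt (eigval k) * xi k \<omega> * eigfun k t) X"
    unfolding space_weight by (rule uniform_L2_convergence)
qed

end

text \<open>The formulas for eigenvalues and eigenfunctions are asserted as existence together with
  uniqueness: the listed family admits an expansion, and every expansion uses this family up to a
  reordering and signs. The final series is then claimed for the coefficients of any such
  expansion.\<close>

theorem theorem2p6:
  fixes M :: "'a measure" and B X :: "real \<Rightarrow> 'a \<Rightarrow> real" and \<alpha> S T :: real
    and \<tau> :: "real \<Rightarrow> real" and \<mu> :: "real measure"
    and \<kappa> :: "nat \<Rightarrow> real" and f :: "nat \<Rightarrow> real \<Rightarrow> real"
  assumes "wiener_process M B"
    and "\<alpha> > 0" and "0 < S" and "S < T"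
    and "alpha_wiener_bridge M B \<alpha> T X"
    and "\<tau> = bridge_tau \<alpha> T"
    and "\<mu> = bridge_weight \<alpha> T S"
    and "\<kappa> = (\<lambda>k. (\<tau> S / ((real k - 1 / 2) * pi))\<^sup>2)"
    and "f = (\<lambda>k t. sqrt (2 / \<tau> S) * (T - t) powr \<alpha> * sin ((real k - 1 / 2) * pi * (\<tau> t / \<tau> S)))"
  shows
    "(\<exists>\<xi>. weighted_KL_expansion M X \<mu> \<kappa> f \<xi>) \<and>
     (\<forall>\<kappa>' f' \<xi>'. weighted_KL_expansion M X \<mu> \<kappa>' f' \<xi>' \<longrightarrow>
        (\<exists>\<pi>. bij_betw \<pi> {1..} {1..} \<and>
          (\<forall>k\<ge>1. \<kappa>' k = \<kappa> (\<pi> k) \<and>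
            (\<exists>\<sigma>\<in>{-1, 1}. \<forall>t\<in>{0..S}. f' k t = \<sigma> * f (\<pi> k) t)))) \<and>
     (\<forall>\<xi>. weighted_KL_expansion M X \<mu> \<kappa> f \<xi> \<longrightarrow>
        L2_uniformly_tendsto M {0..S}
          (\<lambda>n t \<omega>. \<Sum>k=1..n. sqrt (2 * \<tau> S) * (T - t) powr \<alpha> *
             (sin ((real k - 1 / 2) * pi * (\<tau> t / \<tau> S)) / ((real k - 1 / 2) * pi)) * \<xi> k \<omega>)
          X)"
proof -
  interpret W: wiener_process M B by fact
  interpret bridge_clock \<alpha> S T using assms by unfold_locales
  interpret bridge_process M B \<alpha> S T X
  proof
    fix t assume t: "t \<in> {0..S}"
    then have "has_wiener_integral M B (\<lambda>s. ((T - t) / (T - s)) powr \<alpha>) 0 t (X t)"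
      using assms(4,5) by (auto simp: alpha_wiener_bridge_def)
    then show "wiener_integral_upto M B S (\<lambda>s. indicator {0..t} s * ((T - t) / (T - s)) powr \<alpha>) (X t)"
      using t by (intro wiener_integral_upto_of_has_wiener_integral) auto
  qed
  have tau: "\<tau> = tau" by (simp add: assms(6) tau_def)
  have \<kappa>: "\<kappa> = eigval"
    by (simp add: assms(8) tau eigval_def[abs_def] freq_def)
  have sin_eq: "sin ((real k - 1 / 2) * pi * (\<tau> t / \<tau> S)) = sin (omega k * tau t)" for k t
    by (simp add: tau omega_def freq_def)
  have f: "f = eigfun"
    unfolding assms(9) sin_eq by (simp add: tau eigfun_def[abs_def])
  have "L2_uniformly_tendsto M {0..S}
      (\<lambda>n t \<omega>. \<Sum>k=1..n. sqrt (2 * \<tau> S) * (T - t) powr \<alpha> *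
         (sin ((real k - 1 / 2) * pi * (\<tau> t / \<tau> S)) / ((real k - 1 / 2) * pi)) * \<xi> k \<omega>) X"
    if KL: "weighted_KL_expansion M X \<mu> \<kappa> f \<xi>" for \<xi>
  proof -
    \<comment> \<open>The partial sums agree term by term, whatever the variables \<xi> are, so the
      convergence contained in \<open>KL\<close> carries over.\<close>
    have "(\<Sum>k=1..n. sqrt (eigval k) * \<xi> k \<omega> * eigfun k t) =
        (\<Sum>k=1..n. sqrt (2 * \<tau> S) * (T - t) powr \<alpha> *
         (sin ((real k - 1 / 2) * pi * (\<tau> t / \<tau> S)) / ((real k - 1 / 2) * pi)) * \<xi> k \<omega>)" for n t \<omega>
    proof (intro sum.cong refl)
      fix k assume "k \<in> {1..n}"
      then have "sqrt (eigval k) * eigfun k t = sqrt (2 * \<tau> S) * (T - t) powr \<alpha> *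
         (sin ((real k - 1 / 2) * pi * (\<tau> t / \<tau> S)) / ((real k - 1 / 2) * pi))"
        unfolding sin_eq by (simp add: eigval_eigfun tau freq_def)
      then show "sqrt (eigval k) * \<xi> k \<omega> * eigfun k t = sqrt (2 * \<tau> S) * (T - t) powr \<alpha> *
         (sin ((real k - 1 / 2) * pi * (\<tau> t / \<tau> S)) / ((real k - 1 / 2) * pi)) * \<xi> k \<omega>"
        by (metis mult.assoc mult.commute)
    qed
    moreover have "L2_uniformly_tendsto M {0..S} (\<lambda>n t \<omega>. \<Sum>k=1..n. sqrt (eigval k) * \<xi> k \<omega> * eigfun k t) X"
      using KL unfolding weighted_KL_expansion_def \<kappa> f assms(7) space_weight by blast
    ultimately show ?thesis by simp
  qed
  then show ?thesis
    using KL_expansion_xi KL_expansion_unique[OF covariance_kernel_X]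
    unfolding \<kappa> f assms(7) by blast
qed

end
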